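(* Let $\Sigma$ be a connected oriented minimal surface immersed in $\mathbb{R}^3$, with induced metric $\mathbf{g}_\Sigma$, Gauss curvature $\mathcal{K}=\mathcal{K}_{\mathbf{g}_\Sigma}<0$ everywhere, and unit normal vector field $\mathbf{N}$. Let $\mathbf{V}$ be a constant unit vector field in $\mathbb{R}^3$ such that the angle function $\mathbf{N}_{\mathbf{V}}=\langle \mathbf{N},\mathbf{V}\rangle_{\mathbb{R}^3}$ takes values in $(-1,1]$ on $\Sigma$. Define the first Chern-Ricci function on $\Sigma$ by $$\mathrm{CR}^1_{\mathbf{V}} := \ln\left( (-\mathcal{K})^{-\frac14}\,(1+\mathbf{N}_{\mathbf{V}})\right).$$ Then: (1) $\mathrm{CR}^1_{\mathbf{V}}$ is harmonic on $\Sigma$, that is, $$\triangle_{\mathbf{g}_\Sigma}\, \ln\left(\frac{1+\mathbf{N}_{\mathbf{V}}}{(-\mathcal{K})^{\frac14}}\right)=0 .$$ (2) If $\mathrm{CR}^1_{\mathbf{V}}$ is constant on $\Sigma$, then $\Sigma$ is a part of the Enneper surface, up to isometries and homotheties of $\mathbb{R}^3$.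
   Context: $\triangle_{\mathbf{g}_\Sigma}$ denotes the Laplace-Beltrami operator of the induced metric $\mathbf{g}_\Sigma$. The angle function of an oriented surface $\Sigma$ in $\mathbb{R}^3$ with unit normal $\mathbf{N}$, with respect to a constant unit vector field $\mathbf{V}$, is $\mathbf{N}_{\mathbf{V}}(p)=\langle \mathbf{N}(p),\mathbf{V}\rangle_{\mathbb{R}^3}\in[-1,1]$ for $p\in\Sigma$. The Enneper surface is the surface given by the patch $$\mathbf{X}_{\mathrm{Enn}}(u,v)=\left(\tfrac12\left(u-\tfrac{u^3}{3}+uv^2\right),\ \tfrac12\left(-v+\tfrac{v^3}{3}-u^2v\right),\ \tfrac12\left(u^2-v^2\right)\right),\qquad (u,v)\in\mathbb{R}^2 .$$ That $\Sigma$, with immersion $\mathbf{X}:\Sigma\to\mathbb{R}^3$, is a part of the Enneper surface up to isometries and homotheties means: there is a single map $S:\mathbb{R}^3\to\mathbb{R}^3$, a composition of isometries and homotheties of $\mathbb{R}^3$, such that every point of $\Sigma$ has an open neighborhood $U$ and a diffeomorphism $\varphi$ from $U$ onto an open subset of $\mathbb{R}^2$ with $\mathbf{X}|_U=S\circ\mathbf{X}_{\mathrm{Enn}}\circ\varphi$. *)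

theory Defs
  imports "HOL-Analysis.Analysis"
begin

section \<open>Smooth maps on open subsets of the plane\<close>

definition pd :: "2 \<Rightarrow> (real^2 \<Rightarrow> 'b::real_normed_vector) \<Rightarrow> real^2 \<Rightarrow> 'b" where
  "pd i f x = frechet_derivative f (at x) (axis i 1)"

text \<open>Only meant for open \<open>S\<close>: the derivatives are full ones, not relative to \<open>S\<close>.\<close>

primrec Ck_on :: "nat \<Rightarrow> (real^2) set \<Rightarrow> (real^2 \<Rightarrow> 'b::real_normed_vector) \<Rightarrow> bool" where
  "Ck_on 0 S f \<longleftrightarrow> continuous_on S f"
| "Ck_on (Suc k) S f \<longleftrightarrow> (\<forall>x\<in>S. f differentiable (at x)) \<and> (\<forall>i. Ck_on k S (pd i f))"

definition smooth_on :: "(real^2) set \<Rightarrow> (real^2 \<Rightarrow> 'b::real_normed_vector) \<Rightarrow> bool" where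
  "smooth_on S f \<longleftrightarrow> (\<forall>k. Ck_on k S f)"


section \<open>Smooth surfaces\<close>

text \<open>A chart is a pair of a domain and a coordinate map; the values of the coordinate map
  outside the domain are irrelevant.\<close>

type_synonym 'a chart = "'a set \<times> ('a \<Rightarrow> real^2)"

definition chart_inv :: "'a chart \<Rightarrow> real^2 \<Rightarrow> 'a" where
  "chart_inv c = inv_into (fst c) (snd c)"

definition is_chart :: "'a topology \<Rightarrow> 'a chart \<Rightarrow> bool" where
  "is_chart T c \<longleftrightarrow> openin T (fst c) \<and> open (snd c ` fst c) \<and>
     homeomorphic_map (subtopology T (fst c)) (top_of_set (snd c ` fst c)) (snd c)"

definition smooth_transition :: "'a chart \<Rightarrow> 'a chart \<Rightarrow> bool" where
  "smooth_transition c d \<longleftrightarrow> smooth_on (snd c ` (fst c \<inter> fst d)) (snd d \<circ> chart_inv c)"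

definition compatible_charts :: "'a chart \<Rightarrow> 'a chart \<Rightarrow> bool" where
  "compatible_charts c d \<longleftrightarrow> smooth_transition c d \<and> smooth_transition d c"

definition smooth_surface :: "'a topology \<Rightarrow> 'a chart set \<Rightarrow> bool" where
  "smooth_surface T A \<longleftrightarrow> Hausdorff_space T \<and> second_countable T \<and>
     (\<forall>c\<in>A. is_chart T c) \<and> (\<Union>c\<in>A. fst c) = topspace T \<and>
     (\<forall>c\<in>A. \<forall>d\<in>A. compatible_charts c d)"

definition oriented_atlas :: "'a chart set \<Rightarrow> bool" where
  "oriented_atlas A \<longleftrightarrow> (\<forall>c\<in>A. \<forall>d\<in>A. \<forall>x \<in> snd c ` (fst c \<inter> fst d).
     det (matrix (frechet_derivative (snd d \<circ> chart_inv c) (at x))) > 0)"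

definition smooth_map :: "'a chart set \<Rightarrow> ('a \<Rightarrow> 'b::real_normed_vector) \<Rightarrow> bool" where
  "smooth_map A f \<longleftrightarrow> (\<forall>c\<in>A. smooth_on (snd c ` fst c) (f \<circ> chart_inv c))"

text \<open>The geometric quantities below are given by coordinate formulas that do not depend on the
  chart; they are evaluated at \<open>p\<close> in some chart of the atlas around \<open>p\<close>.\<close>

definition chart_at :: "'a chart set \<Rightarrow> 'a \<Rightarrow> 'a chart" where
  "chart_at A p = (SOME c. c \<in> A \<and> p \<in> fst c)"


section \<open>Riemannian metrics in coordinates\<close>

type_synonym metric = "real^2 \<Rightarrow> real^2^2"

text \<open>\<open>christoffel G k i j\<close> is $\Gamma^k_{ij}$, and \<open>riemann G l k i j\<close> is the coefficient
  $R^l{}_{kij}$ of $\partial_l$ in $R(\partial_i,\partial_j)\partial_k$, where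
  $R(X,Y) = \nabla_X\nabla_Y - \nabla_Y\nabla_X - \nabla_{[X,Y]}$.\<close>

definition christoffel :: "metric \<Rightarrow> 2 \<Rightarrow> 2 \<Rightarrow> 2 \<Rightarrow> real^2 \<Rightarrow> real" where
  "christoffel G k i j x = 1/2 * (\<Sum>l\<in>UNIV. matrix_inv (G x) $ k $ l *
     (pd i (\<lambda>y. G y $ j $ l) x + pd j (\<lambda>y. G y $ i $ l) x - pd l (\<lambda>y. G y $ i $ j) x))"

definition riemann :: "metric \<Rightarrow> 2 \<Rightarrow> 2 \<Rightarrow> 2 \<Rightarrow> 2 \<Rightarrow> real^2 \<Rightarrow> real" where
  "riemann G l k i j x =
     pd i (christoffel G l j k) x - pd j (christoffel G l i k) x
     + (\<Sum>m\<in>UNIV. christoffel G m j k x * christoffel G l i m x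
                  - christoffel G m i k x * christoffel G l j m x)"

text \<open>The sectional curvature
  $g(R(\partial_1,\partial_2)\partial_2,\partial_1) / (g_{11}g_{22}-g_{12}^2)$.\<close>

definition metric_curvature :: "metric \<Rightarrow> real^2 \<Rightarrow> real" where
  "metric_curvature G x = (\<Sum>l\<in>UNIV. riemann G l 2 1 2 x * G x $ l $ 1) / det (G x)"

definition metric_laplacian :: "metric \<Rightarrow> (real^2 \<Rightarrow> real) \<Rightarrow> real^2 \<Rightarrow> real" where
  "metric_laplacian G f x = 1 / sqrt (det (G x)) *
     (\<Sum>i\<in>UNIV. \<Sum>j\<in>UNIV. pd i (\<lambda>y. sqrt (det (G y)) * matrix_inv (G y) $ i $ j * pd j f y) x)"


section \<open>Immersed surfaces in three-space\<close>

definition immersion :: "'a chart set \<Rightarrow> ('a \<Rightarrow> real^3) \<Rightarrow> bool" where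
  "immersion A X \<longleftrightarrow> smooth_map A X \<and>
     (\<forall>c\<in>A. \<forall>x \<in> snd c ` fst c. inj (frechet_derivative (X \<circ> chart_inv c) (at x)))"

definition unit_normal :: "'a chart set \<Rightarrow> ('a \<Rightarrow> real^3) \<Rightarrow> ('a \<Rightarrow> real^3) \<Rightarrow> bool" where
  "unit_normal A X N \<longleftrightarrow> smooth_map A N \<and>
     (\<forall>c\<in>A. \<forall>p \<in> fst c. norm (N p) = 1 \<and>
        (\<forall>h. N p \<bullet> frechet_derivative (X \<circ> chart_inv c) (at (snd c p)) h = 0))"

definition induced_metric :: "('a \<Rightarrow> real^3) \<Rightarrow> 'a chart \<Rightarrow> metric" where
  "induced_metric X c x = (\<chi> i j. pd i (X \<circ> chart_inv c) x \<bullet> pd j (X \<circ> chart_inv c) x)"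

text \<open>The matrix of $-\langle dN, dX\rangle$.\<close>

definition second_form ::
  "('a \<Rightarrow> real^3) \<Rightarrow> ('a \<Rightarrow> real^3) \<Rightarrow> 'a chart \<Rightarrow> real^2 \<Rightarrow> real^2^2" where
  "second_form X N c x = (\<chi> i j. - (pd i (N \<circ> chart_inv c) x \<bullet> pd j (X \<circ> chart_inv c) x))"

definition mean_curvature ::
  "'a chart set \<Rightarrow> ('a \<Rightarrow> real^3) \<Rightarrow> ('a \<Rightarrow> real^3) \<Rightarrow> 'a \<Rightarrow> real" where
  "mean_curvature A X N p = (let c = chart_at A p; x = snd c p in
     1/2 * trace (matrix_inv (induced_metric X c x) ** second_form X N c x))"

definition gauss_curvature :: "'a chart set \<Rightarrow> ('a \<Rightarrow> real^3) \<Rightarrow> 'a \<Rightarrow> real" where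
  "gauss_curvature A X p = (let c = chart_at A p in
     metric_curvature (induced_metric X c) (snd c p))"

definition laplace_beltrami ::
  "'a chart set \<Rightarrow> ('a \<Rightarrow> real^3) \<Rightarrow> ('a \<Rightarrow> real) \<Rightarrow> 'a \<Rightarrow> real" where
  "laplace_beltrami A X f p = (let c = chart_at A p in
     metric_laplacian (induced_metric X c) (f \<circ> chart_inv c) (snd c p))"

text \<open>Smoothness is part of the notion: without it the partial derivatives in the
  Laplacian could be meaningless.\<close>

definition harmonic ::
  "'a topology \<Rightarrow> 'a chart set \<Rightarrow> ('a \<Rightarrow> real^3) \<Rightarrow> ('a \<Rightarrow> real) \<Rightarrow> bool" where
  "harmonic T A X f \<longleftrightarrow> smooth_map A f \<and> (\<forall>p \<in> topspace T. laplace_beltrami A X f p = 0)"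

definition minimal ::
  "'a topology \<Rightarrow> 'a chart set \<Rightarrow> ('a \<Rightarrow> real^3) \<Rightarrow> ('a \<Rightarrow> real^3) \<Rightarrow> bool" where
  "minimal T A X N \<longleftrightarrow> (\<forall>p \<in> topspace T. mean_curvature A X N p = 0)"

definition angle_function :: "('a \<Rightarrow> real^3) \<Rightarrow> real^3 \<Rightarrow> 'a \<Rightarrow> real" where
  "angle_function N V p = N p \<bullet> V"

definition chern_ricci1 ::
  "'a chart set \<Rightarrow> ('a \<Rightarrow> real^3) \<Rightarrow> ('a \<Rightarrow> real^3) \<Rightarrow> real^3 \<Rightarrow> 'a \<Rightarrow> real" where
  "chern_ricci1 A X N V p =
     ln ((- gauss_curvature A X p) powr (-1/4) * (1 + angle_function N V p))"


section \<open>The Enneper surface\<close>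

definition enneper :: "real^2 \<Rightarrow> real^3" where
  "enneper w = (let u = w $ 1; v = w $ 2 in
     vector [1/2 * (u - u^3/3 + u * v^2),
             1/2 * (- v + v^3/3 - u^2 * v),
             1/2 * (u^2 - v^2)])"

inductive isometry_homothety_comp :: "(real^3 \<Rightarrow> real^3) \<Rightarrow> bool" where
  isometry: "(\<forall>x y. dist (S x) (S y) = dist x y) \<Longrightarrow> isometry_homothety_comp S"
| homothety: "r \<noteq> 0 \<Longrightarrow> isometry_homothety_comp (\<lambda>x. a + r *\<^sub>R (x - a))"
| comp: "isometry_homothety_comp S \<Longrightarrow> isometry_homothety_comp S' \<Longrightarrow>
    isometry_homothety_comp (S \<circ> S')"

text \<open>A diffeomorphism of an open subset of the surface onto an open subset of the plane is the
  same thing as a chart compatible with the whole atlas.\<close>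

definition part_of_enneper :: "'a topology \<Rightarrow> 'a chart set \<Rightarrow> ('a \<Rightarrow> real^3) \<Rightarrow> bool" where
  "part_of_enneper T A X \<longleftrightarrow> (\<exists>S. isometry_homothety_comp S \<and>
     (\<forall>p \<in> topspace T. \<exists>U \<phi>. p \<in> U \<and> is_chart T (U, \<phi>) \<and>
        (\<forall>c\<in>A. compatible_charts c (U, \<phi>)) \<and>
        (\<forall>q\<in>U. X q = S (enneper (\<phi> q)))))"

end

theory Submission
  imports Defs
begin

text \<open>Both parts become transparent in one special coordinate. Complete \<open>V\<close> to an orthonormal frame
  and let \<open>w\<close> be the stereographic projection of the normal \<open>N\<close> from \<open>- V\<close>; it is defined because
  \<open>N \<bullet> V > - 1\<close>. As \<open>K = det II / det I\<close> (Gauss's equation, \<open>theorema_egregium\<close>), \<open>K < 0\<close> makes the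
  differential of the Gauss map invertible, so \<open>w\<close> is a local coordinate of the surface (\<open>gauss_chart\<close>).

  In this coordinate the normal is a known function of \<open>w\<close>, namely the normal of one parametrization
  \<open>enn\<close> of Enneper's surface with respect to the frame. Hence the tangent vectors of any surface are
  combinations of the derivatives \<open>enn1\<close> and \<open>enn2\<close> of \<open>enn\<close>. Symmetry of the second fundamental form and
  vanishing of the mean curvature leave only two coefficients (\<open>pd_Y\<close>),
  \<open>Y\<^sub>1 = P enn1 - Q enn2\<close> and \<open>Y\<^sub>2 = Q enn1 + P enn2\<close>, and \<open>Y\<^sub>1\<^sub>2 = Y\<^sub>2\<^sub>1\<close> says that \<open>P - iQ\<close> is holomorphic
  (\<open>cauchy_riemann\<close>). Geometrically \<open>(P - iQ) dw\<^sup>2\<close> is the Hopf differential up to a constant factor,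
  and its modulus is what the Chern-Ricci function measures (\<open>curvature_angle_eq_logmod\<close>): with \<open>\<kappa> = (1 + |w|\<^sup>2)\<^sup>2 / 4\<close> one
  has \<open>- K = 1 / (\<kappa>\<^sup>2 (P\<^sup>2 + Q\<^sup>2))\<close> and \<open>1 + N \<bullet> V = 1 / sqrt \<kappa>\<close>, so
  \<open>ln ((- K) powr (-1/4) * (1 + N \<bullet> V)) = ln (P\<^sup>2 + Q\<^sup>2) / 4\<close>.

  The logarithm of the modulus of a holomorphic function is harmonic for the flat metric. The induced
  metric is \<open>\<kappa> (P\<^sup>2 + Q\<^sup>2)\<close> times the flat one in the coordinate \<open>w\<close>, and harmonicity is a conformal
  invariant in dimension two (\<open>metric_laplacian_conformal_pullback\<close>), which gives the first part in
  every chart of the atlas.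

  If the function is constant, the modulus of \<open>P - iQ\<close> is constant, so \<open>P\<close> and \<open>Q\<close> are, and integration
  yields \<open>X = b + P enn + Q enn_conj\<close> locally, where \<open>enn_conj\<close> is the conjugate surface of \<open>enn\<close>. The
  parameters \<open>b\<close>, \<open>P\<close>, \<open>Q\<close> are determined near each point, hence the same everywhere on the connected
  surface. Finally \<open>P enn + Q enn_conj\<close> is a multiple of \<open>enn\<close> for a frame rotated about \<open>V\<close>
  (\<open>enn_rotated_frame\<close>), which is Enneper's surface up to a similarity of space.\<close>

section \<open>Calculus of smooth maps in the plane\<close>

lemma pd_eq: "(f has_derivative f') (at x) \<Longrightarrow> pd i f x = f' (axis i 1)"
  unfolding pd_def by (metis frechet_derivative_at)

lemma plane_decomp: "(h::real^2) = h $ 1 *\<^sub>R axis 1 1 + h $ 2 *\<^sub>R axis 2 1"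
  by (simp add: vec_eq_iff forall_2 axis_def)

lemma has_derivative_pd:
  assumes "f differentiable (at x)"
  shows "(f has_derivative (\<lambda>h. h $ 1 *\<^sub>R pd 1 f x + h $ 2 *\<^sub>R pd 2 f x)) (at x)"
proof -
  let ?L = "frechet_derivative f (at x)"
  have d: "(f has_derivative ?L) (at x)" using assms frechet_derivative_works by blast
  then interpret bounded_linear ?L by (rule has_derivative_bounded_linear)
  have "?L h = h $ 1 *\<^sub>R pd 1 f x + h $ 2 *\<^sub>R pd 2 f x" for h
    unfolding pd_def by (subst plane_decomp[of h]) (simp only: add scaleR)
  then have "?L = (\<lambda>h. h $ 1 *\<^sub>R pd 1 f x + h $ 2 *\<^sub>R pd 2 f x)" by blast
  then show ?thesis using d by simp
qed

lemma frechet_derivative_pd: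
  assumes "f differentiable (at x)"
  shows "frechet_derivative f (at x) h = h $ 1 *\<^sub>R pd 1 f x + h $ 2 *\<^sub>R pd 2 f x"
  by (rule fun_cong[OF frechet_derivative_at[OF has_derivative_pd[OF assms], symmetric]])

lemma pd_cong:
  assumes "open S" "x \<in> S" "\<And>y. y \<in> S \<Longrightarrow> f y = g y"
  shows "pd i f x = pd i g x"
proof -
  have "(f has_derivative f') (at x) = (g has_derivative f') (at x)" for f'
    using has_derivative_transform_within_open[OF _ assms(1,2), of f f' UNIV g]
      has_derivative_transform_within_open[OF _ assms(1,2), of g f' UNIV f] assms(3) by auto
  then show ?thesis unfolding pd_def frechet_derivative_def by (simp only:)
qed

lemma differentiable_cong:
  assumes "open S" "x \<in> S" "\<And>y. y \<in> S \<Longrightarrow> f y = g y" "f differentiable (at x)"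
  shows "g differentiable (at x)"
  using has_derivative_transform_within_open[OF _ assms(1,2), of f _ UNIV g] assms(3,4)
  unfolding differentiable_def by blast

lemma pd_add:
  assumes "f differentiable (at x)" "g differentiable (at x)"
  shows "pd i (\<lambda>x. f x + g x) x = pd i f x + pd i g x"
  by (subst pd_eq[OF has_derivative_add[OF has_derivative_pd has_derivative_pd]])
     (use assms exhaust_2[of i] in \<open>auto simp: axis_def\<close>)

lemma pd_bilinear:
  assumes "bounded_bilinear B" "f differentiable (at x)" "g differentiable (at x)"
  shows "pd i (\<lambda>x. B (f x) (g x)) x = B (f x) (pd i g x) + B (pd i f x) (g x)"
  by (subst pd_eq[OF bounded_bilinear.FDERIV[OF assms(1) has_derivative_pd has_derivative_pd]])
     (use assms exhaust_2[of i] in \<open>auto simp: axis_def\<close>)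

lemma pd_linear:
  assumes "bounded_linear L" "f differentiable (at x)"
  shows "pd i (\<lambda>x. L (f x)) x = L (pd i f x)"
  by (subst pd_eq[OF bounded_linear.has_derivative[OF assms(1) has_derivative_pd]])
     (use assms exhaust_2[of i] in \<open>auto simp: axis_def\<close>)

lemma pd_compose:
  fixes g :: "real^2 \<Rightarrow> real^2"
  assumes "g differentiable (at x)" "f differentiable (at (g x))"
  shows "pd i (\<lambda>x. f (g x)) x = (pd i g x $ 1) *\<^sub>R pd 1 f (g x) + (pd i g x $ 2) *\<^sub>R pd 2 f (g x)"
  using pd_eq[OF diff_chain_at[OF has_derivative_pd[OF assms(1)] has_derivative_pd[OF assms(2)]], of i]
  using exhaust_2[of i] by (auto simp: axis_def o_def)

lemma pd_component:
  fixes f :: "real^2 \<Rightarrow> real^'n"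
  assumes "f differentiable (at x)"
  shows "pd i (\<lambda>x. f x $ k) x = pd i f x $ k"
  using pd_linear[OF bounded_linear_vec_nth assms] .

lemma pd_real_compose:
  fixes f :: "real^2 \<Rightarrow> real"
  assumes "f differentiable (at x)" "(\<phi> has_real_derivative d) (at (f x))"
  shows "pd i (\<lambda>x. \<phi> (f x)) x = d * pd i f x"
    and "(\<lambda>x. \<phi> (f x)) differentiable (at x)"
proof -
  note * = diff_chain_at[OF has_derivative_pd[OF assms(1)] assms(2)[unfolded has_field_derivative_def], unfolded o_def]
  show "pd i (\<lambda>x. \<phi> (f x)) x = d * pd i f x"
    using pd_eq[OF *, of i] exhaust_2[of i] by (auto simp: axis_def)
  show "(\<lambda>x. \<phi> (f x)) differentiable (at x)" using * differentiable_def by blast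
qed

lemma pd_const [simp]: "pd i (\<lambda>x. c) x = 0"
  by (simp add: pd_def)

lemma pd_coordinate [simp]: "pd i (\<lambda>x. x $ j) x = (if i = j then 1 else 0)"
  using pd_eq[OF bounded_linear_imp_has_derivative[OF bounded_linear_vec_nth]] by (auto simp: axis_def)

lemma pd_inner:
  "f differentiable (at x) \<Longrightarrow> g differentiable (at x) \<Longrightarrow>
    pd i (\<lambda>x. f x \<bullet> g x) x = f x \<bullet> pd i g x + pd i f x \<bullet> g x"
  by (rule pd_bilinear[OF bounded_bilinear_inner])

lemma pd_scaleR:
  "f differentiable (at x) \<Longrightarrow> g differentiable (at x) \<Longrightarrow>
    pd i (\<lambda>x. f x *\<^sub>R g x) x = f x *\<^sub>R pd i g x + pd i f x *\<^sub>R g x"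
  by (rule pd_bilinear[OF bounded_bilinear_scaleR])

lemma pd_mult:
  fixes f g :: "real^2 \<Rightarrow> real"
  shows "f differentiable (at x) \<Longrightarrow> g differentiable (at x) \<Longrightarrow>
    pd i (\<lambda>x. f x * g x) x = f x * pd i g x + pd i f x * g x"
  by (rule pd_bilinear[OF bounded_bilinear_mult])

lemma pd_minus: "f differentiable (at x) \<Longrightarrow> pd i (\<lambda>x. - f x) x = - pd i f x"
  by (rule pd_linear[OF bounded_linear_minus[OF bounded_linear_ident]])

lemma pd_diff:
  "f differentiable (at x) \<Longrightarrow> g differentiable (at x) \<Longrightarrow>
    pd i (\<lambda>x. f x - g x) x = pd i f x - pd i g x"
  using pd_add[of f x "\<lambda>x. - g x" i] pd_minus[of g x i] by (simp add: differentiable_minus)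

lemma Ck_on_cong:
  assumes "open S" "\<And>x. x \<in> S \<Longrightarrow> f x = g x" "Ck_on k S f"
  shows "Ck_on k S g"
  using assms(2,3)
proof (induction k arbitrary: f g)
  case 0 then show ?case by (metis Ck_on.simps(1) continuous_on_cong)
next
  case (Suc k)
  have "pd i f x = pd i g x" if "x \<in> S" for i x
    using pd_cong[OF assms(1) that] Suc.prems(1) by blast
  then have "Ck_on k S (pd i g)" for i using Suc.IH[of "pd i f" "pd i g"] Suc.prems(2) by simp
  moreover have "g differentiable (at x)" if "x \<in> S" for x
    using differentiable_cong[OF assms(1) that, of f g] Suc.prems that by simp
  ultimately show ?case by simp
qed

lemma smooth_on_cong:
  "open S \<Longrightarrow> smooth_on S f \<Longrightarrow> (\<And>x. x \<in> S \<Longrightarrow> f x = g x) \<Longrightarrow> smooth_on S g"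
  unfolding smooth_on_def using Ck_on_cong by metis

lemma Ck_on_Suc_D: "Ck_on (Suc k) S f \<Longrightarrow> Ck_on k S f"
proof (induction k arbitrary: f)
  case 0
  then show ?case
    by (auto intro!: continuous_at_imp_continuous_on differentiable_imp_continuous_within)
next
  case (Suc k) then show ?case by (metis Ck_on.simps(2))
qed

lemma Ck_on_subset: "Ck_on k S f \<Longrightarrow> T \<subseteq> S \<Longrightarrow> Ck_on k T f"
  by (induction k arbitrary: f) (auto intro: continuous_on_subset)

lemma smooth_on_subset: "smooth_on S f \<Longrightarrow> T \<subseteq> S \<Longrightarrow> smooth_on T f"
  unfolding smooth_on_def using Ck_on_subset by metis

lemma smooth_on_differentiable: "smooth_on S f \<Longrightarrow> x \<in> S \<Longrightarrow> f differentiable (at x)"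
  unfolding smooth_on_def by (metis Ck_on.simps(2))

lemma smooth_on_pd: "smooth_on S f \<Longrightarrow> smooth_on S (pd i f)"
  unfolding smooth_on_def by (metis Ck_on.simps(2))

lemma smooth_on_continuous: "smooth_on S f \<Longrightarrow> continuous_on S f"
  unfolding smooth_on_def by (metis Ck_on.simps(1))

lemma Ck_on_const: "Ck_on k S (\<lambda>x. c)"
proof (induction k arbitrary: c)
  case (Suc k)
  have "pd i (\<lambda>x. c) = (\<lambda>x. 0)" for i by auto
  then show ?case using Suc by auto
qed auto

text \<open>The closure properties of \<open>Ck_on k\<close> hold by induction on \<open>k\<close>: a partial derivative of the compound
  function is a sum of products of maps to which the induction hypothesis applies.\<close>

lemma Ck_on_linear:
  assumes "open S" "bounded_linear L" "Ck_on k S f"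
  shows "Ck_on k S (\<lambda>x. L (f x))"
  using assms(3)
proof (induction k arbitrary: f)
  case 0 then show ?case
    using assms(2) by (simp add: bounded_linear.continuous_on)
next
  case (Suc k)
  have "(\<lambda>x. L (f x)) differentiable (at x)" if "x \<in> S" for x
    using bounded_linear.has_derivative[OF assms(2) has_derivative_pd, of f x] that Suc.prems
    by (auto simp: differentiable_def[of "\<lambda>x. L (f x)"])
  moreover have "Ck_on k S (pd i (\<lambda>x. L (f x)))" for i
    by (rule Ck_on_cong[OF assms(1) _ Suc.IH[of "pd i f"]])
       (use Suc.prems pd_linear[OF assms(2)] in auto)
  ultimately show ?case by auto
qed

lemma Ck_on_add:
  assumes "open S" "Ck_on k S f" "Ck_on k S g"
  shows "Ck_on k S (\<lambda>x. f x + g x)"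
  using assms(2,3)
proof (induction k arbitrary: f g)
  case 0 then show ?case by (simp add: continuous_on_add)
next
  case (Suc k)
  have "Ck_on k S (pd i (\<lambda>x. f x + g x))" for i
    by (rule Ck_on_cong[OF assms(1) _ Suc.IH[of "pd i f" "pd i g"]])
       (use Suc.prems in \<open>auto simp: pd_add\<close>)
  then show ?case using Suc.prems by auto
qed

lemma Ck_on_bilinear:
  assumes "open S" "bounded_bilinear B" "Ck_on k S f" "Ck_on k S g"
  shows "Ck_on k S (\<lambda>x. B (f x) (g x))"
  using assms(3,4)
proof (induction k arbitrary: f g)
  case 0 then show ?case by (simp add: bounded_bilinear.continuous_on[OF assms(2)])
next
  case (Suc k)
  have "(\<lambda>x. B (f x) (g x)) differentiable (at x)" if "x \<in> S" for x
    using bounded_bilinear.FDERIV[OF assms(2) has_derivative_pd has_derivative_pd, of f x g]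
      that Suc.prems by (auto simp: differentiable_def[of "\<lambda>x. B (f x) (g x)"])
  moreover have "Ck_on k S (pd i (\<lambda>x. B (f x) (g x)))" for i
  proof (rule Ck_on_cong[OF assms(1)])
    show "Ck_on k S (\<lambda>x. B (f x) (pd i g x) + B (pd i f x) (g x))"
      using Ck_on_add[OF assms(1) Suc.IH Suc.IH] Suc.prems Ck_on_Suc_D by (metis Ck_on.simps(2))
  qed (use Suc.prems pd_bilinear[OF assms(2)] in auto)
  ultimately show ?case by auto
qed

lemma Ck_on_compose:
  fixes g :: "real^2 \<Rightarrow> real^2"
  assumes "open S" "g ` S \<subseteq> T" "Ck_on k T f" "Ck_on k S g"
  shows "Ck_on k S (\<lambda>x. f (g x))"
  using assms(3,4)
proof (induction k arbitrary: f)
  case 0 then show ?case using assms(2) continuous_on_compose2 by (metis Ck_on.simps(1))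
next
  case (Suc k)
  have "(\<lambda>x. f (g x)) differentiable (at x)" if "x \<in> S" for x
    using that Suc.prems assms(2) differentiable_chain_at[of g x f] by (auto simp: o_def image_subset_iff)
  moreover have "Ck_on k S (pd i (\<lambda>x. f (g x)))" for i
  proof (rule Ck_on_cong[OF assms(1)])
    have "Ck_on k S (pd i g)" "\<And>j. Ck_on k S (\<lambda>x. pd j f (g x))"
      using Suc.prems Suc.IH Ck_on_Suc_D by (metis Ck_on.simps(2))+
    then show "Ck_on k S (\<lambda>x. (pd i g x $ 1) *\<^sub>R pd 1 f (g x) + (pd i g x $ 2) *\<^sub>R pd 2 f (g x))"
      by (intro Ck_on_add Ck_on_bilinear[OF _ bounded_bilinear_scaleR]
          Ck_on_linear[OF _ bounded_linear_vec_nth] assms(1)) auto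
  qed (use Suc.prems assms(2) in \<open>auto simp: pd_compose image_subset_iff\<close>)
  ultimately show ?case by auto
qed

lemma Ck_on_inverse:
  fixes f :: "real^2 \<Rightarrow> real"
  assumes "open S" "Ck_on k S f" "\<And>x. x \<in> S \<Longrightarrow> f x \<noteq> 0"
  shows "Ck_on k S (\<lambda>x. inverse (f x))"
  using assms(2)
proof (induction k)
  case 0 then show ?case using assms(3) by (auto intro!: continuous_on_inverse)
next
  case (Suc k)
  have fd: "f differentiable (at x)" if "x \<in> S" for x using that Suc.prems by auto
  have d: "(inverse has_real_derivative - (inverse (f x) * inverse (f x))) (at (f x))" if "x \<in> S" for x
    using DERIV_inverse[OF assms(3)[OF that]] by (simp add: power2_eq_square)
  have "Ck_on k S (pd i (\<lambda>x. inverse (f x)))" for i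
  proof (rule Ck_on_cong[OF assms(1)])
    have "Ck_on k S (pd i f)" "Ck_on k S (\<lambda>x. inverse (f x))"
      using Suc Ck_on_Suc_D by (metis Ck_on.simps(2))+
    then show "Ck_on k S (\<lambda>x. - (inverse (f x) * inverse (f x) * pd i f x))"
      by (intro Ck_on_linear[OF assms(1) bounded_linear_minus[OF bounded_linear_ident]]
          Ck_on_bilinear[OF assms(1) bounded_bilinear_mult])
  qed (use pd_real_compose(1)[OF fd d] in auto)
  then show ?case using pd_real_compose(2)[OF fd d] by auto
qed

lemma Ck_on_ln:
  fixes f :: "real^2 \<Rightarrow> real"
  assumes "open S" "Ck_on k S f" "\<And>x. x \<in> S \<Longrightarrow> f x > 0"
  shows "Ck_on k S (\<lambda>x. ln (f x))"
proof (cases k)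
  case 0 then show ?thesis using assms(2,3) by (auto intro!: continuous_on_ln simp: less_imp_neq[symmetric])
next
  case (Suc k)
  have fd: "f differentiable (at x)" if "x \<in> S" for x using that assms(2) Suc by auto
  have d: "(ln has_real_derivative inverse (f x)) (at (f x))" if "x \<in> S" for x
    using DERIV_ln[OF assms(3)[OF that]] .
  have "Ck_on k S (pd i (\<lambda>x. ln (f x)))" for i
  proof (rule Ck_on_cong[OF assms(1)])
    have "Ck_on k S (pd i f)" "Ck_on k S (\<lambda>x. inverse (f x))"
      using assms Suc Ck_on_Suc_D Ck_on_inverse by (metis Ck_on.simps(2), metis less_irrefl)
    then show "Ck_on k S (\<lambda>x. inverse (f x) * pd i f x)"
      by (intro Ck_on_bilinear[OF assms(1) bounded_bilinear_mult])
  qed (use pd_real_compose(1)[OF fd d] in auto)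
  then show ?thesis using pd_real_compose(2)[OF fd d] Suc by auto
qed

named_theorems smooth_intros

lemma smooth_on_const [smooth_intros]: "smooth_on S (\<lambda>x. c)"
  unfolding smooth_on_def by (simp add: Ck_on_const)

lemma smooth_on_linear: "bounded_linear L \<Longrightarrow> open S \<Longrightarrow> smooth_on S f \<Longrightarrow> smooth_on S (\<lambda>x. L (f x))"
  unfolding smooth_on_def by (simp add: Ck_on_linear)

lemmas smooth_on_component [smooth_intros] = smooth_on_linear[OF bounded_linear_vec_nth]
lemmas smooth_on_minus [smooth_intros] = smooth_on_linear[OF bounded_linear_minus[OF bounded_linear_ident]]

lemma smooth_on_add [smooth_intros]:
  "open S \<Longrightarrow> smooth_on S f \<Longrightarrow> smooth_on S g \<Longrightarrow> smooth_on S (\<lambda>x. f x + g x)"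
  unfolding smooth_on_def by (simp add: Ck_on_add)

lemma smooth_on_diff [smooth_intros]:
  "open S \<Longrightarrow> smooth_on S f \<Longrightarrow> smooth_on S g \<Longrightarrow> smooth_on S (\<lambda>x. f x - g x)"
  using smooth_on_add[of S f "\<lambda>x. - g x"] smooth_on_minus[of S g] by simp

lemma smooth_on_bilinear:
  "bounded_bilinear B \<Longrightarrow> open S \<Longrightarrow> smooth_on S f \<Longrightarrow> smooth_on S g \<Longrightarrow> smooth_on S (\<lambda>x. B (f x) (g x))"
  unfolding smooth_on_def by (simp add: Ck_on_bilinear)

lemma smooth_on_mult [smooth_intros]:
  "open S \<Longrightarrow> smooth_on S f \<Longrightarrow> smooth_on S g \<Longrightarrow> smooth_on S (\<lambda>x. f x * g x :: real)"
  by (rule smooth_on_bilinear[OF bounded_bilinear_mult])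

lemmas smooth_on_scaleR [smooth_intros] = smooth_on_bilinear[OF bounded_bilinear_scaleR]
lemmas smooth_on_inner [smooth_intros] = smooth_on_bilinear[OF bounded_bilinear_inner]

lemma smooth_on_inverse [smooth_intros]:
  "open S \<Longrightarrow> smooth_on S f \<Longrightarrow> (\<And>x. x \<in> S \<Longrightarrow> f x \<noteq> (0::real)) \<Longrightarrow> smooth_on S (\<lambda>x. inverse (f x))"
  unfolding smooth_on_def by (simp add: Ck_on_inverse)

lemma smooth_on_divide [smooth_intros]:
  "open S \<Longrightarrow> smooth_on S f \<Longrightarrow> smooth_on S g \<Longrightarrow> (\<And>x. x \<in> S \<Longrightarrow> g x \<noteq> (0::real)) \<Longrightarrow>
    smooth_on S (\<lambda>x. f x / g x)"
  unfolding divide_inverse by (intro smooth_intros)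

lemma smooth_on_power [smooth_intros]:
  "open S \<Longrightarrow> smooth_on S f \<Longrightarrow> smooth_on S (\<lambda>x. f x ^ n :: real)"
  by (induction n) (auto intro!: smooth_intros)

lemma smooth_on_ln [smooth_intros]:
  "open S \<Longrightarrow> smooth_on S f \<Longrightarrow> (\<And>x. x \<in> S \<Longrightarrow> f x > (0::real)) \<Longrightarrow> smooth_on S (\<lambda>x. ln (f x))"
  unfolding smooth_on_def by (simp add: Ck_on_ln)

lemma smooth_on_compose:
  fixes g :: "real^2 \<Rightarrow> real^2"
  shows "open S \<Longrightarrow> smooth_on T f \<Longrightarrow> smooth_on S g \<Longrightarrow> g ` S \<subseteq> T \<Longrightarrow> smooth_on S (\<lambda>x. f (g x))"
  unfolding smooth_on_def by (simp add: Ck_on_compose)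

lemma smooth_on_id [smooth_intros]: "smooth_on S (\<lambda>x. x)"
proof -
  have "pd i (\<lambda>x. x) = (\<lambda>x. axis i 1)" for i
    using pd_eq[OF has_derivative_ident] by auto
  then have "Ck_on k S (\<lambda>x. x)" for k
    by (cases k) (auto intro: Ck_on_const continuous_on_id)
  then show ?thesis by (simp add: smooth_on_def)
qed

text \<open>Schwarz's theorem: the second difference of \<open>f\<close> over a small square is, by the mean value
  theorem applied in the two orders, \<open>h\<^sup>2\<close> times a value of either mixed derivative nearby.\<close>

lemma second_difference_mean_value:
  fixes f :: "real^2 \<Rightarrow> real"
  assumes S: "open S" and f: "smooth_on S f" and h: "h > 0"
    and sq: "\<And>s t. 0 \<le> s \<Longrightarrow> s \<le> h \<Longrightarrow> 0 \<le> t \<Longrightarrow> t \<le> h \<Longrightarrow> x + s *\<^sub>R axis i 1 + t *\<^sub>R axis j 1 \<in> S"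
  shows "\<exists>s t. 0 < s \<and> s < h \<and> 0 < t \<and> t < h \<and>
     f (x + h *\<^sub>R axis i 1 + h *\<^sub>R axis j 1) - f (x + h *\<^sub>R axis i 1) - f (x + h *\<^sub>R axis j 1) + f x
       = h * h * pd j (pd i f) (x + s *\<^sub>R axis i 1 + t *\<^sub>R axis j 1)"
proof -
  have dir: "((\<lambda>s. g (a + s *\<^sub>R axis k 1)) has_real_derivative pd k g (a + s *\<^sub>R axis k 1)) (at s)"
    if "smooth_on S g" "a + s *\<^sub>R axis k 1 \<in> S" for g :: "real^2 \<Rightarrow> real" and a k s
  proof -
    have "((\<lambda>s::real. a + s *\<^sub>R axis k 1) has_derivative (\<lambda>s. s *\<^sub>R axis k 1)) (at s)"
      by (auto intro!: derivative_eq_intros)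
    from diff_chain_at[OF this has_derivative_pd[OF smooth_on_differentiable[OF that]]]
    show ?thesis unfolding has_field_derivative_def o_def
      using exhaust_2[of k] by (auto simp: axis_def fun_eq_iff elim!: has_derivative_eq_rhs)
  qed
  \<comment> \<open>The second difference is \<open>F h - F 0\<close>, and the derivative of \<open>F\<close> is a first difference of \<open>pd i f\<close>.\<close>
  define F where "F s = f (x + h *\<^sub>R axis j 1 + s *\<^sub>R axis i 1) - f (x + s *\<^sub>R axis i 1)" for s
  have "\<exists>s. 0 < s \<and> s < h \<and> F h - F 0 = (h - 0) *
     (pd i f (x + h *\<^sub>R axis j 1 + s *\<^sub>R axis i 1) - pd i f (x + s *\<^sub>R axis i 1))"
  proof (rule MVT2[OF h])
    fix s assume "0 \<le> s" "s \<le> h"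
    then have "x + h *\<^sub>R axis j 1 + s *\<^sub>R axis i 1 \<in> S" "x + s *\<^sub>R axis i 1 \<in> S"
      using sq[of s h] sq[of s 0] h by (auto simp: algebra_simps)
    then show "(F has_real_derivative
        pd i f (x + h *\<^sub>R axis j 1 + s *\<^sub>R axis i 1) - pd i f (x + s *\<^sub>R axis i 1)) (at s)"
      unfolding F_def by (intro DERIV_diff dir f)
  qed
  then obtain s where s: "0 < s" "s < h" and Fs: "F h - F 0 = h *
     (pd i f (x + h *\<^sub>R axis j 1 + s *\<^sub>R axis i 1) - pd i f (x + s *\<^sub>R axis i 1))" by auto
  have "\<exists>t. 0 < t \<and> t < h \<and> pd i f (x + s *\<^sub>R axis i 1 + h *\<^sub>R axis j 1)
       - pd i f (x + s *\<^sub>R axis i 1 + 0 *\<^sub>R axis j 1)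
     = (h - 0) * pd j (pd i f) (x + s *\<^sub>R axis i 1 + t *\<^sub>R axis j 1)"
  proof (rule MVT2[OF h])
    fix t assume "0 \<le> t" "t \<le> h"
    then show "((\<lambda>t. pd i f (x + s *\<^sub>R axis i 1 + t *\<^sub>R axis j 1)) has_real_derivative
        pd j (pd i f) (x + s *\<^sub>R axis i 1 + t *\<^sub>R axis j 1)) (at t)"
      using sq[of s t] s by (intro dir smooth_on_pd f) auto
  qed
  then obtain t where t: "0 < t" "t < h" and
    Ft: "pd i f (x + s *\<^sub>R axis i 1 + h *\<^sub>R axis j 1) - pd i f (x + s *\<^sub>R axis i 1)
     = h * pd j (pd i f) (x + s *\<^sub>R axis i 1 + t *\<^sub>R axis j 1)" by auto
  have swap: "x + h *\<^sub>R axis j 1 + r *\<^sub>R axis i 1 = x + r *\<^sub>R axis i 1 + h *\<^sub>R axis j 1" for r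
    by (simp only: add.assoc add.commute[of "h *\<^sub>R axis j 1"])
  have "F h - F 0 = h * h * pd j (pd i f) (x + s *\<^sub>R axis i 1 + t *\<^sub>R axis j 1)"
    using Fs Ft by (simp only: swap mult.assoc)
  moreover have "F h - F 0 = f (x + h *\<^sub>R axis i 1 + h *\<^sub>R axis j 1)
      - f (x + h *\<^sub>R axis i 1) - f (x + h *\<^sub>R axis j 1) + f x"
    unfolding F_def swap by simp
  ultimately show ?thesis using s t by metis
qed

lemma pd_commute_real:
  fixes f :: "real^2 \<Rightarrow> real"
  assumes S: "open S" and f: "smooth_on S f" and x: "x \<in> S"
  shows "pd i (pd j f) x = pd j (pd i f) x"
proof (rule ccontr)
  assume ne: "pd i (pd j f) x \<noteq> pd j (pd i f) x"
  define e where "e = \<bar>pd i (pd j f) x - pd j (pd i f) x\<bar> / 2"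
  have e: "e > 0" using ne by (simp add: e_def)
  have c: "continuous (at x) (pd k (pd l f))" for k l
    using smooth_on_continuous[OF smooth_on_pd[OF smooth_on_pd[OF f]]] S x
    by (metis continuous_on_eq_continuous_at)
  have "\<exists>d>0. \<forall>y. dist y x < d \<longrightarrow> dist (pd k (pd l f) y) (pd k (pd l f) x) < e" for k l
    using c[of k l] e unfolding continuous_at_eps_delta by auto
  then obtain d where d: "\<And>k l. d k l > 0"
    "\<And>k l y. dist y x < d k l \<Longrightarrow> dist (pd k (pd l f) y) (pd k (pd l f) x) < e" by metis
  obtain r where r: "r > 0" "ball x r \<subseteq> S" using S x openE by blast
  \<comment> \<open>The points of the square of side \<open>h\<close> have distance at most \<open>2 * h\<close> from \<open>x\<close>.\<close>
  define h where "h = min r (min (d i j) (d j i)) / 3"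
  have h: "h > 0" using r(1) d(1)[of i j] d(1)[of j i] by (simp add: h_def)
  have h3: "3 * h \<le> r" "3 * h \<le> d i j" "3 * h \<le> d j i" by (simp_all add: h_def)
  have near: "dist (x + s *\<^sub>R axis k 1 + t *\<^sub>R axis l 1) x < 3 * h"
    if "0 \<le> s" "s \<le> h" "0 \<le> t" "t \<le> h" for s t k l
  proof -
    have "norm (s *\<^sub>R axis k (1::real) + t *\<^sub>R axis l 1 :: real^2) \<le> s + t"
      using that norm_triangle_ineq[of "s *\<^sub>R axis k (1::real) :: real^2" "t *\<^sub>R axis l 1"] by simp
    moreover have "dist (x + s *\<^sub>R axis k 1 + t *\<^sub>R axis l 1) x
        = norm (s *\<^sub>R axis k (1::real) + t *\<^sub>R axis l 1 :: real^2)"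
      by (simp add: dist_norm)
    ultimately show ?thesis using that h by linarith
  qed
  have sq: "x + s *\<^sub>R axis k 1 + t *\<^sub>R axis l 1 \<in> S"
    if "0 \<le> s" "s \<le> h" "0 \<le> t" "t \<le> h" for s t k l
    using near[OF that, of k l] r(2) h3(1) by (auto simp: subset_iff dist_commute)
  obtain s t where st: "0 < s" "s < h" "0 < t" "t < h" and eq1:
     "f (x + h *\<^sub>R axis i 1 + h *\<^sub>R axis j 1) - f (x + h *\<^sub>R axis i 1) - f (x + h *\<^sub>R axis j 1) + f x
       = h * h * pd j (pd i f) (x + s *\<^sub>R axis i 1 + t *\<^sub>R axis j 1)"
    using second_difference_mean_value[OF S f h, of x i j] sq by auto
  obtain s' t' where st': "0 < s'" "s' < h" "0 < t'" "t' < h" and eq2: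
     "f (x + h *\<^sub>R axis j 1 + h *\<^sub>R axis i 1) - f (x + h *\<^sub>R axis j 1) - f (x + h *\<^sub>R axis i 1) + f x
       = h * h * pd i (pd j f) (x + s' *\<^sub>R axis j 1 + t' *\<^sub>R axis i 1)"
    using second_difference_mean_value[OF S f h, of x j i] sq by auto
  have sw: "x + h *\<^sub>R axis j 1 + h *\<^sub>R axis i 1 = x + h *\<^sub>R axis i 1 + h *\<^sub>R axis j 1"
    by (simp add: algebra_simps)
  have "h * h * pd j (pd i f) (x + s *\<^sub>R axis i 1 + t *\<^sub>R axis j 1)
      = h * h * pd i (pd j f) (x + s' *\<^sub>R axis j 1 + t' *\<^sub>R axis i 1)"
    using eq1 eq2 unfolding sw by linarith
  then have eq: "pd j (pd i f) (x + s *\<^sub>R axis i 1 + t *\<^sub>R axis j 1)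
      = pd i (pd j f) (x + s' *\<^sub>R axis j 1 + t' *\<^sub>R axis i 1)" using h by simp
  have "dist (pd j (pd i f) (x + s *\<^sub>R axis i 1 + t *\<^sub>R axis j 1)) (pd j (pd i f) x) < e"
    using near[of s t i j] st h3 by (intro d(2)) linarith
  moreover have "dist (pd i (pd j f) (x + s' *\<^sub>R axis j 1 + t' *\<^sub>R axis i 1)) (pd i (pd j f) x) < e"
    using near[of s' t' j i] st' h3 by (intro d(2)) linarith
  moreover have "\<bar>u - v\<bar> < \<bar>w - v\<bar> / 2 \<Longrightarrow> \<not> \<bar>u - w\<bar> < \<bar>w - v\<bar> / 2" for u v w :: real
    by (simp add: abs_if split: if_splits)
  ultimately show False unfolding eq e_def dist_real_def by blast
qed

lemma pd_commute:
  fixes f :: "real^2 \<Rightarrow> 'b::real_inner"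
  assumes S: "open S" and f: "smooth_on S f" and x: "x \<in> S"
  shows "pd i (pd j f) x = pd j (pd i f) x"
proof -
  have *: "pd k (pd l (\<lambda>x. c \<bullet> f x)) x = c \<bullet> pd k (pd l f) x" for k l and c :: 'b
  proof -
    have "pd k (pd l (\<lambda>x. c \<bullet> f x)) x = pd k (\<lambda>x. c \<bullet> pd l f x) x"
      by (rule pd_cong[OF S x]) (rule pd_linear[OF bounded_linear_inner_right smooth_on_differentiable[OF f]])
    then show ?thesis
      using pd_linear[OF bounded_linear_inner_right smooth_on_differentiable[OF smooth_on_pd[OF f] x]] by metis
  qed
  have "c \<bullet> pd i (pd j f) x = c \<bullet> pd j (pd i f) x" for c
    using pd_commute_real[OF S smooth_on_inner[OF S smooth_on_const f] x, of i j c] * by simp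
  then show ?thesis using vector_eq_ldot by blast
qed

section \<open>Smooth local inverses in the plane\<close>

definition jac :: "(real^2 \<Rightarrow> real^2) \<Rightarrow> real^2 \<Rightarrow> real" where
  "jac \<psi> x = pd 1 \<psi> x $ 1 * pd 2 \<psi> x $ 2 - pd 2 \<psi> x $ 1 * pd 1 \<psi> x $ 2"

text \<open>The columns of the inverse of the Jacobian matrix of \<open>\<psi>\<close>.\<close>

definition inv_pd :: "2 \<Rightarrow> (real^2 \<Rightarrow> real^2) \<Rightarrow> real^2 \<Rightarrow> real^2" where
  "inv_pd i \<psi> x = inverse (jac \<psi> x) *\<^sub>R
     (if i = 1 then pd 2 \<psi> x $ 2 *\<^sub>R axis 1 1 - pd 1 \<psi> x $ 2 *\<^sub>R axis 2 1
      else pd 1 \<psi> x $ 1 *\<^sub>R axis 2 1 - pd 2 \<psi> x $ 1 *\<^sub>R axis 1 1)"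

lemma smooth_on_jac [smooth_intros]: "open S \<Longrightarrow> smooth_on S \<psi> \<Longrightarrow> smooth_on S (jac \<psi>)"
  unfolding jac_def by (intro smooth_intros smooth_on_pd)

lemma smooth_on_inv_pd:
  assumes "open S" "smooth_on S \<psi>" "\<And>x. x \<in> S \<Longrightarrow> jac \<psi> x \<noteq> 0"
  shows "smooth_on S (inv_pd i \<psi>)"
  using assms unfolding inv_pd_def by (cases "i = 1") (auto intro!: smooth_intros smooth_on_pd)

lemma inv_pd_left:
  assumes "jac \<psi> x \<noteq> 0"
  shows "pd 1 \<psi> x $ 1 *\<^sub>R inv_pd 1 \<psi> x + pd 1 \<psi> x $ 2 *\<^sub>R inv_pd 2 \<psi> x = axis 1 1"
    and "pd 2 \<psi> x $ 1 *\<^sub>R inv_pd 1 \<psi> x + pd 2 \<psi> x $ 2 *\<^sub>R inv_pd 2 \<psi> x = axis 2 1"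
  using assms by (simp_all add: vec_eq_iff forall_2 inv_pd_def axis_def field_simps)
    (simp_all add: jac_def algebra_simps)

lemma inv_pd_right:
  assumes "jac \<psi> x \<noteq> 0"
  shows "inv_pd i \<psi> x $ 1 *\<^sub>R pd 1 \<psi> x + inv_pd i \<psi> x $ 2 *\<^sub>R pd 2 \<psi> x = axis i 1"
  using assms exhaust_2[of i] by (auto simp: vec_eq_iff forall_2 inv_pd_def axis_def field_simps)
    (simp_all add: jac_def algebra_simps)

text \<open>The derivatives of the inverse \<open>g\<close> are \<open>inv_pd i \<psi> \<circ> g\<close>, so \<open>g\<close> gains one order of differentiability
  at each step of an induction.\<close>

lemma smooth_on_left_inverse:
  assumes S: "open S" and \<psi>: "smooth_on S \<psi>" and nz: "\<And>x. x \<in> S \<Longrightarrow> jac \<psi> x \<noteq> 0"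
    and V: "open (\<psi> ` S)" and g: "\<And>x. x \<in> S \<Longrightarrow> g (\<psi> x) = x"
  shows "smooth_on (\<psi> ` S) g"
proof -
  have dg: "(g has_derivative (\<lambda>h. h $ 1 *\<^sub>R inv_pd 1 \<psi> x + h $ 2 *\<^sub>R inv_pd 2 \<psi> x)) (at (\<psi> x))"
    if x: "x \<in> S" for x
  proof (rule has_derivative_inverse_on[where f=\<psi> and S=S and x=x and g=g
        and f'="\<lambda>x h. h $ 1 *\<^sub>R pd 1 \<psi> x + h $ 2 *\<^sub>R pd 2 \<psi> x"
        and g'="\<lambda>x h. h $ 1 *\<^sub>R inv_pd 1 \<psi> x + h $ 2 *\<^sub>R inv_pd 2 \<psi> x"])
    show "open S" "x \<in> S" "\<And>x. x \<in> S \<Longrightarrow> g (\<psi> x) = x" using S x g by auto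
    show "(\<psi> has_derivative (\<lambda>h. h $ 1 *\<^sub>R pd 1 \<psi> x + h $ 2 *\<^sub>R pd 2 \<psi> x)) (at x)" if "x \<in> S" for x
      using has_derivative_pd smooth_on_differentiable[OF \<psi> that] by blast
    have "(h $ 1 *\<^sub>R inv_pd 1 \<psi> x + h $ 2 *\<^sub>R inv_pd 2 \<psi> x) $ 1 *\<^sub>R pd 1 \<psi> x +
       (h $ 1 *\<^sub>R inv_pd 1 \<psi> x + h $ 2 *\<^sub>R inv_pd 2 \<psi> x) $ 2 *\<^sub>R pd 2 \<psi> x
       = h $ 1 *\<^sub>R (inv_pd 1 \<psi> x $ 1 *\<^sub>R pd 1 \<psi> x + inv_pd 1 \<psi> x $ 2 *\<^sub>R pd 2 \<psi> x)
        + h $ 2 *\<^sub>R (inv_pd 2 \<psi> x $ 1 *\<^sub>R pd 1 \<psi> x + inv_pd 2 \<psi> x $ 2 *\<^sub>R pd 2 \<psi> x)" for h :: "real^2"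
      by (simp add: algebra_simps)
    then show "(\<lambda>h. h $ 1 *\<^sub>R pd 1 \<psi> x + h $ 2 *\<^sub>R pd 2 \<psi> x) \<circ>
        (\<lambda>h. h $ 1 *\<^sub>R inv_pd 1 \<psi> x + h $ 2 *\<^sub>R inv_pd 2 \<psi> x) = id"
      unfolding inv_pd_right[OF nz[OF x]] plane_decomp[symmetric] by auto
  qed
  then have pdg: "pd i g (\<psi> x) = inv_pd i \<psi> (g (\<psi> x))" if "x \<in> S" for x i
    using pd_eq[OF dg[OF that], of i] that exhaust_2[of i] by (auto simp: g axis_def)
  have dif: "g differentiable (at y)" if "y \<in> \<psi> ` S" for y
    using dg that differentiable_def by blast
  have "Ck_on k (\<psi> ` S) g" for k
  proof (induction k)
    case 0
    show ?case using dif by (auto intro!: continuous_at_imp_continuous_on differentiable_imp_continuous_within)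
  next
    case (Suc k)
    have "Ck_on k (\<psi> ` S) (pd i g)" for i
    proof (rule Ck_on_cong[OF V])
      show "Ck_on k (\<psi> ` S) (\<lambda>y. inv_pd i \<psi> (g y))"
        by (rule Ck_on_compose[OF V _ _ Suc, where T=S])
          (use smooth_on_inv_pd[OF S \<psi> nz] g in \<open>auto simp: smooth_on_def\<close>)
    qed (use pdg in auto)
    then show ?case using dif by simp
  qed
  then show ?thesis by (simp add: smooth_on_def)
qed

text \<open>The local inverse comes from the inverse function theorem, applied where the Jacobian determinant does
  not vanish; its smoothness is \<open>smooth_on_left_inverse\<close>.\<close>

lemma smooth_inverse_function:
  assumes S: "open S" and \<psi>: "smooth_on S \<psi>" and x0: "x0 \<in> S" and nz: "jac \<psi> x0 \<noteq> 0"
  obtains W where "open W" "x0 \<in> W" "W \<subseteq> S" "inj_on \<psi> W" "open (\<psi> ` W)"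
    "homeomorphism W (\<psi> ` W) \<psi> (inv_into W \<psi>)"
    "smooth_on (\<psi> ` W) (inv_into W \<psi>)" "\<And>x. x \<in> W \<Longrightarrow> jac \<psi> x \<noteq> 0"
proof -
  define S' where "S' = {x \<in> S. jac \<psi> x \<noteq> 0}"
  have S': "open S'" "S' \<subseteq> S" "x0 \<in> S'"
    using continuous_open_preimage[OF smooth_on_continuous[OF smooth_on_jac[OF S \<psi>]] S, of "- {0}"] x0 nz
    by (auto simp: S'_def Int_def vimage_def)
  define f' where "f' x = Blinfun (\<lambda>h::real^2. h $ 1 *\<^sub>R pd 1 \<psi> x + h $ 2 *\<^sub>R pd 2 \<psi> x)" for x
  have bl: "bounded_linear (\<lambda>h::real^2. h $ 1 *\<^sub>R a + h $ 2 *\<^sub>R b)" for a b :: "real^2"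
    by (intro bounded_linear_add bounded_linear_scaleR_const bounded_linear_vec_nth)
  have f'_apply: "blinfun_apply (f' x) h = h $ 1 *\<^sub>R pd 1 \<psi> x + h $ 2 *\<^sub>R pd 2 \<psi> x" for x h
    unfolding f'_def bounded_linear_Blinfun_apply[OF bl] ..
  define k where "k = Blinfun (\<lambda>h::real^2. h $ 1 *\<^sub>R inv_pd 1 \<psi> x0 + h $ 2 *\<^sub>R inv_pd 2 \<psi> x0)"
  have k_apply: "blinfun_apply k h = h $ 1 *\<^sub>R inv_pd 1 \<psi> x0 + h $ 2 *\<^sub>R inv_pd 2 \<psi> x0" for h
    unfolding k_def bounded_linear_Blinfun_apply[OF bl] ..
  obtain W V g g' where W: "open W" "W \<subseteq> S'" "x0 \<in> W" "open V" and hom: "homeomorphism W V \<psi> g"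
  proof (rule inverse_function_theorem[of S' \<psi> f' x0 k])
    show "(\<psi> has_derivative blinfun_apply (f' x)) (at x)" if "x \<in> S'" for x
      by (rule has_derivative_eq_rhs[OF has_derivative_pd[OF smooth_on_differentiable[OF \<psi>]]])
        (use that S' in \<open>auto simp: f'_apply\<close>)
    show "continuous_on S' f'"
      by (rule continuous_on_blinfun_componentwise)
        (auto simp: f'_apply intro!: continuous_intros
          continuous_on_subset[OF smooth_on_continuous[OF smooth_on_pd[OF \<psi>]] S'(2)])
    show "k o\<^sub>L f' x0 = id_blinfun"
    proof (rule blinfun_eqI)
      fix h
      have "blinfun_apply (k o\<^sub>L f' x0) h
         = h $ 1 *\<^sub>R (pd 1 \<psi> x0 $ 1 *\<^sub>R inv_pd 1 \<psi> x0 + pd 1 \<psi> x0 $ 2 *\<^sub>R inv_pd 2 \<psi> x0)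
         + h $ 2 *\<^sub>R (pd 2 \<psi> x0 $ 1 *\<^sub>R inv_pd 1 \<psi> x0 + pd 2 \<psi> x0 $ 2 *\<^sub>R inv_pd 2 \<psi> x0)"
        by (simp add: k_apply f'_apply algebra_simps)
      then show "blinfun_apply (k o\<^sub>L f' x0) h = blinfun_apply id_blinfun h"
        unfolding inv_pd_left[OF nz] plane_decomp[symmetric] by simp
    qed
  qed (use S' in auto)
  have inj: "inj_on \<psi> W" and V: "V = \<psi> ` W" and g: "\<And>x. x \<in> W \<Longrightarrow> g (\<psi> x) = x"
    using hom by (auto simp: homeomorphism_def inj_on_def) metis+
  have g_eq: "inv_into W \<psi> y = g y" if "y \<in> V" for y using that V g inj by auto
  have hom': "homeomorphism W (\<psi> ` W) \<psi> (inv_into W \<psi>)"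
    using hom g_eq unfolding V by (metis (no_types, lifting) homeomorphism_cong)
  have "smooth_on (\<psi> ` W) (inv_into W \<psi>)"
    by (rule smooth_on_left_inverse)
      (use W V inj S' smooth_on_subset[OF \<psi>] in \<open>auto simp: S'_def\<close>)
  then show ?thesis using that[of W] W S' V inj hom' by (auto simp: S'_def)
qed

section \<open>Gauss's equation for a coordinate patch\<close>

lemma matrix_inv_2:
  fixes A :: "real^2^2"
  assumes "det A \<noteq> 0"
  shows "matrix_inv A $ 1 $ 1 = A $ 2 $ 2 / det A" "matrix_inv A $ 1 $ 2 = - A $ 1 $ 2 / det A"
    "matrix_inv A $ 2 $ 1 = - A $ 2 $ 1 / det A" "matrix_inv A $ 2 $ 2 = A $ 1 $ 1 / det A"
proof -
  define B :: "real^2^2" where "B = vector [vector [A $ 2 $ 2 / det A, - A $ 1 $ 2 / det A],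
    vector [- A $ 2 $ 1 / det A, A $ 1 $ 1 / det A]]"
  have B: "A ** B = mat 1" "B ** A = mat 1"
    using assms unfolding B_def
    by (simp_all add: vec_eq_iff forall_2 matrix_matrix_mult_def sum_2 mat_def divide_simps)
      (simp_all add: det_2 algebra_simps)
  have "A ** matrix_inv A = mat 1 \<and> matrix_inv A ** A = mat 1"
    unfolding matrix_inv_def
    by (rule someI_ex[of "\<lambda>A'. A ** A' = mat 1 \<and> A' ** A = mat 1"]) (use B in blast)
  moreover have "(matrix_inv A ** A) ** B = matrix_inv A"
    by (simp only: matrix_mul_assoc[symmetric] B matrix_mul_rid)
  ultimately have "matrix_inv A = B" by (simp only: matrix_mul_lid)
  then show "matrix_inv A $ 1 $ 1 = A $ 2 $ 2 / det A" "matrix_inv A $ 1 $ 2 = - A $ 1 $ 2 / det A"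
    "matrix_inv A $ 2 $ 1 = - A $ 2 $ 1 / det A" "matrix_inv A $ 2 $ 2 = A $ 1 $ 1 / det A"
    by (simp_all add: B_def)
qed

text \<open>The two fundamental forms of a parametrization \<open>Y\<close> with unit normal \<open>M\<close>. A chart \<open>c\<close> yields such a
  pair \<open>X \<circ> chart_inv c\<close>, \<open>N \<circ> chart_inv c\<close>; everything local is proved for arbitrary pairs.\<close>

definition form1 :: "(real^2 \<Rightarrow> real^3) \<Rightarrow> real^2 \<Rightarrow> real^2^2" where
  "form1 Y x = (\<chi> i j. pd i Y x \<bullet> pd j Y x)"

definition form2 :: "(real^2 \<Rightarrow> real^3) \<Rightarrow> (real^2 \<Rightarrow> real^3) \<Rightarrow> real^2 \<Rightarrow> real^2^2" where
  "form2 Y M x = (\<chi> i j. - (pd i M x \<bullet> pd j Y x))"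

lemma form1_nth [simp]: "form1 Y x $ i $ j = pd i Y x \<bullet> pd j Y x" by (simp add: form1_def)
lemma form2_nth [simp]: "form2 Y M x $ i $ j = - (pd i M x \<bullet> pd j Y x)" by (simp add: form2_def)

text \<open>Multiplied by the determinant of the first form, the mean curvature is polynomial in the entries of
  the forms.\<close>

lemma trace_form:
  assumes "det (form1 Y x) \<noteq> 0"
  shows "trace (matrix_inv (form1 Y x) ** form2 Y M x) =
    (form1 Y x $ 2 $ 2 * form2 Y M x $ 1 $ 1 - form1 Y x $ 1 $ 2 * form2 Y M x $ 2 $ 1
     - form1 Y x $ 1 $ 2 * form2 Y M x $ 1 $ 2 + form1 Y x $ 1 $ 1 * form2 Y M x $ 2 $ 2) / det (form1 Y x)"
  using assms by (simp add: trace_def matrix_matrix_mult_def sum_2 matrix_inv_2 divide_simps)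
    (simp add: inner_commute algebra_simps)

text \<open>If \<open>a\<close> and \<open>b\<close> are independent, both \<open>m\<close> and \<open>v\<close> are multiples of \<open>a \<times> b\<close>.\<close>

lemma orthogonal_to_basis_eq_0:
  fixes a b m v :: "real^3"
  assumes "(a \<bullet> a) * (b \<bullet> b) - (a \<bullet> b)\<^sup>2 \<noteq> 0" "m \<noteq> 0" "m \<bullet> a = 0" "m \<bullet> b = 0"
    and "v \<bullet> a = 0" "v \<bullet> b = 0" "v \<bullet> m = 0"
  shows "v = 0"
proof -
  define w where "w = cross3 a b"
  have ww: "w \<bullet> w = (a \<bullet> a) * (b \<bullet> b) - (a \<bullet> b)\<^sup>2"
    unfolding w_def by (simp add: dot_cross power2_eq_square inner_commute)
  have par: "(w \<bullet> w) *\<^sub>R z = (z \<bullet> w) *\<^sub>R w" if "z \<bullet> a = 0" "z \<bullet> b = 0" for z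
  proof -
    have "cross3 z w = 0" using that by (simp add: w_def Lagrange)
    then have "cross3 w (cross3 z w) = 0" by simp
    then show ?thesis by (simp add: Lagrange inner_commute)
  qed
  have "m \<bullet> w \<noteq> 0" using par[of m] assms ww by auto
  moreover have "(v \<bullet> w) * (w \<bullet> m) = ((w \<bullet> w) *\<^sub>R v) \<bullet> m" using par[of v] assms by simp
  then have "(v \<bullet> w) * (w \<bullet> m) = 0" using assms by simp
  ultimately have "v \<bullet> w = 0" by (simp add: inner_commute)
  then show ?thesis using par[of v] assms ww by auto
qed

locale patch =
  fixes S :: "(real^2) set" and Y M :: "real^2 \<Rightarrow> real^3"
  assumes open_S: "open S" and smooth_Y: "smooth_on S Y" and smooth_M: "smooth_on S M"
    and regular: "\<And>x. x \<in> S \<Longrightarrow> det (form1 Y x) \<noteq> 0"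
    and unit: "\<And>x. x \<in> S \<Longrightarrow> norm (M x) = 1"
    and normal: "\<And>x i. x \<in> S \<Longrightarrow> M x \<bullet> pd i Y x = 0"
begin

lemmas smooth_Y1 = smooth_on_pd[OF smooth_Y]
lemmas smooth_Y2 = smooth_on_pd[OF smooth_Y1]
lemmas smooth_M1 = smooth_on_pd[OF smooth_M]
lemmas diffs = smooth_on_differentiable[OF smooth_Y] smooth_on_differentiable[OF smooth_Y1]
  smooth_on_differentiable[OF smooth_Y2] smooth_on_differentiable[OF smooth_M]
  smooth_on_differentiable[OF smooth_M1]

text \<open>Differentiate \<open>M \<bullet> pd j Y = 0\<close>.\<close>

lemma form2_eq:
  assumes x: "x \<in> S"
  shows "form2 Y M x $ i $ j = M x \<bullet> pd i (pd j Y) x"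
proof -
  have "pd i (\<lambda>x. M x \<bullet> pd j Y x) x = pd i (\<lambda>x. 0) x"
    by (rule pd_cong[OF open_S x]) (rule normal)
  then have "M x \<bullet> pd i (pd j Y) x + pd i M x \<bullet> pd j Y x = 0"
    using x by (simp add: pd_inner diffs)
  then show ?thesis by simp
qed

lemma form2_sym: "x \<in> S \<Longrightarrow> form2 Y M x $ 2 $ 1 = form2 Y M x $ 1 $ 2"
  by (simp only: form2_eq pd_commute[OF open_S smooth_Y, of x 2 1])

lemma smooth_form1: "smooth_on S (\<lambda>x. form1 Y x $ i $ j)"
  by (simp, intro smooth_intros open_S smooth_Y1)

lemma smooth_form2: "smooth_on S (\<lambda>x. form2 Y M x $ i $ j)"
  by (simp, intro smooth_intros open_S smooth_Y1 smooth_M1)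

lemma smooth_det_form1: "smooth_on S (\<lambda>x. det (form1 Y x))"
  unfolding det_2 by (intro smooth_intros open_S smooth_form1)

lemma smooth_matrix_inv: "smooth_on S (\<lambda>x. matrix_inv (form1 Y x) $ i $ j)"
proof -
  let ?o = "\<lambda>k::2. if k = 1 then 2 else 1 :: 2"
  have eq: "(if i = j then 1 else - 1) * (form1 Y x $ ?o j $ ?o i / det (form1 Y x))
      = matrix_inv (form1 Y x) $ i $ j" if "x \<in> S" for x
    using exhaust_2[of i] exhaust_2[of j] matrix_inv_2[OF regular[OF that]] by auto
  have "smooth_on S (\<lambda>x. (if i = j then 1 else - 1) * (form1 Y x $ ?o j $ ?o i / det (form1 Y x)))"
    by (intro smooth_on_mult smooth_on_const smooth_on_divide open_S smooth_form1 smooth_det_form1 regular)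
  from smooth_on_cong[OF open_S this eq] show ?thesis .
qed

text \<open>The derivatives of the metric combine to \<open>2 Y\<^sub>i\<^sub>j \<bullet> Y\<^sub>l\<close>.\<close>

lemma christoffel_form1:
  assumes x: "x \<in> S"
  shows "christoffel (form1 Y) k i j x
    = matrix_inv (form1 Y x) $ k $ 1 * (pd i (pd j Y) x \<bullet> pd 1 Y x)
    + matrix_inv (form1 Y x) $ k $ 2 * (pd i (pd j Y) x \<bullet> pd 2 Y x)"
proof -
  have "pd i (\<lambda>y. form1 Y y $ j $ l) x + pd j (\<lambda>y. form1 Y y $ i $ l) x - pd l (\<lambda>y. form1 Y y $ i $ j) x
      = 2 * (pd i (pd j Y) x \<bullet> pd l Y x)" for l
    using pd_commute[OF open_S smooth_Y x, of j i] pd_commute[OF open_S smooth_Y x, of l i]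
      pd_commute[OF open_S smooth_Y x, of l j]
    by (simp add: pd_inner diffs x inner_commute)
  then show ?thesis unfolding christoffel_def by (simp add: sum_2 algebra_simps)
qed

lemma smooth_christoffel: "smooth_on S (christoffel (form1 Y) k i j)"
proof -
  have "smooth_on S (\<lambda>x. matrix_inv (form1 Y x) $ k $ 1 * (pd i (pd j Y) x \<bullet> pd 1 Y x)
    + matrix_inv (form1 Y x) $ k $ 2 * (pd i (pd j Y) x \<bullet> pd 2 Y x))"
    by (intro smooth_on_mult smooth_on_add smooth_on_inner open_S smooth_matrix_inv smooth_Y1 smooth_Y2)
  from smooth_on_cong[OF open_S this christoffel_form1[symmetric]] show ?thesis .
qed

lemma christoffel_lower:
  assumes x: "x \<in> S"
  shows "christoffel (form1 Y) 1 i j x * (pd 1 Y x \<bullet> pd l Y x)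
    + christoffel (form1 Y) 2 i j x * (pd 2 Y x \<bullet> pd l Y x) = pd i (pd j Y) x \<bullet> pd l Y x"
  using regular[OF x] exhaust_2[of l]
  unfolding christoffel_form1[OF x] matrix_inv_2[OF regular[OF x]]
  by (elim disjE) (simp_all add: divide_simps, simp_all add: det_2 inner_commute algebra_simps)

text \<open>Both sides have the same inner products with the basis \<open>pd 1 Y x\<close>, \<open>pd 2 Y x\<close>, \<open>M x\<close>.\<close>

lemma gauss_formula:
  assumes x: "x \<in> S"
  shows "pd i (pd j Y) x = christoffel (form1 Y) 1 i j x *\<^sub>R pd 1 Y x
    + christoffel (form1 Y) 2 i j x *\<^sub>R pd 2 Y x + form2 Y M x $ i $ j *\<^sub>R M x"
proof -
  have MM: "M x \<bullet> M x = 1" using unit[OF x] by (simp add: dot_square_norm)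
  have "pd i (pd j Y) x - (christoffel (form1 Y) 1 i j x *\<^sub>R pd 1 Y x
    + christoffel (form1 Y) 2 i j x *\<^sub>R pd 2 Y x + form2 Y M x $ i $ j *\<^sub>R M x) = 0" (is "?v = 0")
  proof (rule orthogonal_to_basis_eq_0[of "pd 1 Y x" "pd 2 Y x" "M x"])
    show "pd 1 Y x \<bullet> pd 1 Y x * (pd 2 Y x \<bullet> pd 2 Y x) - (pd 1 Y x \<bullet> pd 2 Y x)\<^sup>2 \<noteq> 0"
      using regular[OF x] by (simp add: det_2 power2_eq_square inner_commute)
    show "M x \<noteq> 0" using unit[OF x] by auto
    show "?v \<bullet> pd 1 Y x = 0" "?v \<bullet> pd 2 Y x = 0"
      using christoffel_lower[OF x, of i j 1] christoffel_lower[OF x, of i j 2]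
      by (simp_all add: inner_diff_left inner_add_left normal[OF x])
    have "M x \<bullet> ?v = 0"
      unfolding form2_eq[OF x] using normal[OF x] MM
      by (simp add: inner_diff_right inner_add_right)
    then show "?v \<bullet> M x = 0" by (subst inner_commute)
  qed (simp_all add: normal[OF x])
  then show ?thesis by simp
qed

text \<open>Gauss's \<^emph>\<open>Theorema Egregium\<close>. Differentiate the formula of Gauss for \<open>Y\<^sub>2\<^sub>2\<close> and \<open>Y\<^sub>1\<^sub>2\<close> and
  subtract: the third derivatives of \<open>Y\<close> cancel, and the inner product of the rest with \<open>Y\<^sub>1\<close> is the
  curvature times \<open>det (form1 Y x)\<close>, minus \<open>det (form2 Y M x)\<close>.\<close>

lemma theorema_egregium:
  assumes x: "x \<in> S"
  shows "metric_curvature (form1 Y) x = det (form2 Y M x) / det (form1 Y x)"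
proof -
  let ?C = "christoffel (form1 Y)" and ?h = "\<lambda>i j x. form2 Y M x $ i $ j"
  note dC = smooth_on_differentiable[OF smooth_christoffel x]
  note dh = smooth_on_differentiable[OF smooth_form2 x]
  have d3: "pd k (pd i (pd j Y)) x \<bullet> pd 1 Y x =
      pd k (?C 1 i j) x * (pd 1 Y x \<bullet> pd 1 Y x) + ?C 1 i j x * (pd k (pd 1 Y) x \<bullet> pd 1 Y x)
    + pd k (?C 2 i j) x * (pd 2 Y x \<bullet> pd 1 Y x) + ?C 2 i j x * (pd k (pd 2 Y) x \<bullet> pd 1 Y x)
    - ?h i j x * ?h k 1 x" for k i j
  proof -
    have "pd k (pd i (pd j Y)) x = pd k (\<lambda>x. ?C 1 i j x *\<^sub>R pd 1 Y x + ?C 2 i j x *\<^sub>R pd 2 Y x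
        + ?h i j x *\<^sub>R M x) x"
      by (rule pd_cong[OF open_S x]) (rule gauss_formula)
    also have "\<dots> = ?C 1 i j x *\<^sub>R pd k (pd 1 Y) x + pd k (?C 1 i j) x *\<^sub>R pd 1 Y x
       + (?C 2 i j x *\<^sub>R pd k (pd 2 Y) x + pd k (?C 2 i j) x *\<^sub>R pd 2 Y x)
       + (?h i j x *\<^sub>R pd k M x + pd k (\<lambda>x. ?h i j x) x *\<^sub>R M x)"
      using x dC dh by (simp add: pd_add pd_scaleR diffs differentiable_add differentiable_scaleR del: form2_nth)
    finally show ?thesis
      by (simp only: inner_add_left inner_scaleR_left normal[OF x] form2_nth[of Y M x k 1])
  qed
  have "pd 1 (pd 2 (pd 2 Y)) x \<bullet> pd 1 Y x = pd 2 (pd 1 (pd 2 Y)) x \<bullet> pd 1 Y x"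
    using pd_commute[OF open_S smooth_Y1 x] by simp
  then have "(\<Sum>l\<in>UNIV. riemann (form1 Y) l 2 1 2 x * form1 Y x $ l $ 1)
     = ?h 2 2 x * ?h 1 1 x - ?h 1 2 x * ?h 2 1 x"
    unfolding d3 riemann_def sum_2 form1_nth christoffel_lower[OF x, symmetric]
    by (simp add: algebra_simps del: form2_nth)
  then show ?thesis unfolding metric_curvature_def det_2[of "form2 Y M x"]
    by (simp add: mult.commute del: form2_nth)
qed

end

section \<open>Conformal invariance of harmonicity\<close>

text \<open>If the metric is \<open>\<rho>\<close> times the pullback of the Euclidean one under \<open>\<psi>\<close>, the factor \<open>\<rho>\<close> cancels
  in the flux, which becomes the cofactor matrix of \<open>D\<psi>\<close> applied to the pulled back gradient; and the
  cofactor matrix is divergence free.\<close>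

lemma metric_laplacian_conformal_pullback:
  assumes S: "open S" and x: "x \<in> S" and \<psi>: "smooth_on S \<psi>" and \<psi>W: "\<psi> ` S \<subseteq> W" and F: "smooth_on W F"
    and J: "\<And>y. y \<in> S \<Longrightarrow> jac \<psi> y \<noteq> 0"
    and \<rho>: "\<And>y. y \<in> S \<Longrightarrow> \<rho> y > 0"
    and G: "\<And>y i j. y \<in> S \<Longrightarrow> G y $ i $ j = \<rho> y * (pd i \<psi> y \<bullet> pd j \<psi> y)"
    and f: "\<And>y. y \<in> S \<Longrightarrow> f y = F (\<psi> y)"
    and har: "pd 1 (pd 1 F) (\<psi> x) + pd 2 (pd 2 F) (\<psi> x) = 0"
  shows "metric_laplacian G f x = 0"
proof -
  \<comment> \<open>Near \<open>x\<close> the Jacobian determinant has constant sign \<open>s\<close>, so that \<open>sqrt (det G)\<close> is the smooth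
    function \<open>\<rho> * s * jac \<psi>\<close> there.\<close>
  define s where "s = sgn (jac \<psi> x)"
  define S' where "S' = {y \<in> S. s * jac \<psi> y > 0}"
  have sm: "smooth_on S (\<lambda>y. s * jac \<psi> y)" by (intro smooth_intros S \<psi>)
  have S': "open S'" "S' \<subseteq> S" "x \<in> S'"
    using continuous_open_preimage[OF smooth_on_continuous[OF sm] S, of "{0<..}"] x J[OF x]
    by (auto simp: S'_def Int_def vimage_def s_def sgn_if)
  define Q where "Q i j y = s / jac \<psi> y * ((if i = j then 1 else - 1) *
     (pd (if j = 1 then 2 else 1) \<psi> y \<bullet> pd (if i = 1 then 2 else 1) \<psi> y))" for i j :: 2 and y
  have flux: "sqrt (det (G y)) * matrix_inv (G y) $ i $ j = Q i j y" if y: "y \<in> S'" for y i j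
  proof -
    have yS: "y \<in> S" using y S' by auto
    have jj: "jac \<psi> y ^ 2 = (pd 1 \<psi> y \<bullet> pd 1 \<psi> y) * (pd 2 \<psi> y \<bullet> pd 2 \<psi> y) - (pd 1 \<psi> y \<bullet> pd 2 \<psi> y)^2"
      by (simp add: jac_def inner_vec_def sum_2 power2_eq_square algebra_simps)
    then have det: "det (G y) = (\<rho> y * jac \<psi> y)\<^sup>2"
      by (simp add: det_2 G[OF yS] power_mult_distrib jj inner_commute) (simp add: power2_eq_square algebra_simps)
    have abs: "\<bar>jac \<psi> y\<bar> = s * jac \<psi> y" and ss: "s * s = 1"
      using y J[OF x] by (auto simp: S'_def s_def sgn_if abs_if mult_less_0_iff zero_less_mult_iff split: if_splits)
    have "sqrt (det (G y)) = \<rho> y * (s * jac \<psi> y)"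
      unfolding det using abs \<rho>[OF yS] by (simp add: abs_mult)
    moreover have "det (G y) \<noteq> 0" using det \<rho>[OF yS] J[OF yS] by simp
    moreover have "matrix_inv (G y) $ i $ j = 1 / (\<rho> y * jac \<psi> y ^ 2) * ((if i = j then 1 else - 1) *
     (pd (if j = 1 then 2 else 1) \<psi> y \<bullet> pd (if i = 1 then 2 else 1) \<psi> y))"
      using exhaust_2[of i] exhaust_2[of j] \<rho>[OF yS] J[OF yS]
      by (elim disjE) (simp_all add: matrix_inv_2[OF \<open>det (G y) \<noteq> 0\<close>] G[OF yS] det power2_eq_square
        inner_commute)
    ultimately show ?thesis unfolding Q_def using \<rho>[OF yS] J[OF yS]
      by (simp add: power2_eq_square)
  qed
  have \<psi>': "smooth_on S' \<psi>" using smooth_on_subset[OF \<psi> S'(2)] .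
  have F\<psi>: "smooth_on S' (\<lambda>y. h (\<psi> y))" if "smooth_on W h" for h :: "real^2 \<Rightarrow> real"
    by (rule smooth_on_compose[OF S'(1) that \<psi>']) (use \<psi>W S' in auto)
  define P where "P j y = pd j \<psi> y $ 1 * pd 1 F (\<psi> y) + pd j \<psi> y $ 2 * pd 2 F (\<psi> y)" for j y
  have pdf: "pd j f y = P j y" if y: "y \<in> S'" for j y
  proof -
    have yS: "y \<in> S" using y S' by auto
    have "pd j f y = pd j (\<lambda>y. F (\<psi> y)) y" by (rule pd_cong[OF S yS f])
    also have "\<dots> = P j y" unfolding P_def
      using pd_compose[of \<psi> y F j] smooth_on_differentiable[OF \<psi> yS] smooth_on_differentiable[OF F, of "\<psi> y"] \<psi>W yS
      by auto
    finally show ?thesis .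
  qed
  have smP: "smooth_on S' (P j)" for j unfolding P_def
    by (intro smooth_intros S'(1) smooth_on_pd \<psi>' F\<psi> F)
  have smQ: "smooth_on S' (Q i j)" for i j unfolding Q_def
    by (intro smooth_intros S'(1) smooth_on_pd \<psi>') (use S' J in auto)
  \<comment> \<open>The flux after cancellation: the cofactor matrix of \<open>D\<psi>\<close> applied to the gradient of \<open>F\<close>.\<close>
  define H where "H i y = s * (if i = 1
      then pd 2 \<psi> y $ 2 * pd 1 F (\<psi> y) - pd 2 \<psi> y $ 1 * pd 2 F (\<psi> y)
      else pd 1 \<psi> y $ 1 * pd 2 F (\<psi> y) - pd 1 \<psi> y $ 2 * pd 1 F (\<psi> y))" for i :: 2 and y
  have QP: "Q i 1 y * P 1 y + Q i 2 y * P 2 y = H i y" if y: "y \<in> S'" for i y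
  proof -
    have J0: "jac \<psi> y \<noteq> 0" using y S' J by auto
    have "jac \<psi> y * (Q i 1 y * P 1 y + Q i 2 y * P 2 y) = jac \<psi> y * H i y"
      using exhaust_2[of i] J0
      by (elim disjE) (simp_all add: Q_def P_def H_def field_simps,
        simp_all add: jac_def inner_vec_def sum_2 algebra_simps)
    then show ?thesis using J0 by simp
  qed
  have terms: "pd i (\<lambda>y. sqrt (det (G y)) * matrix_inv (G y) $ i $ j * pd j f y) x
      = pd i (\<lambda>y. Q i j y * P j y) x" for i j
    by (rule pd_cong[OF S'(1,3)]) (simp add: flux pdf)
  have sums: "pd i (\<lambda>y. Q i 1 y * P 1 y) x + pd i (\<lambda>y. Q i 2 y * P 2 y) x = pd i (H i) x" for i
  proof -
    have "pd i (\<lambda>y. Q i 1 y * P 1 y) x + pd i (\<lambda>y. Q i 2 y * P 2 y) x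
       = pd i (\<lambda>y. Q i 1 y * P 1 y + Q i 2 y * P 2 y) x"
      by (rule pd_add[symmetric]; rule smooth_on_differentiable[OF _ S'(3)];
        intro smooth_intros S'(1) smP smQ)
    also have "\<dots> = pd i (H i) x" by (rule pd_cong[OF S'(1,3) QP])
    finally show ?thesis .
  qed
  have d: "(\<lambda>y. pd k \<psi> y $ l) differentiable at x" "(\<lambda>y. pd k F (\<psi> y)) differentiable at x"
    "pd k \<psi> differentiable at x" "\<psi> differentiable at x" "pd k F differentiable at (\<psi> x)" for k l
  proof -
    show "(\<lambda>y. pd k \<psi> y $ l) differentiable at x" "(\<lambda>y. pd k F (\<psi> y)) differentiable at x"
      "pd k \<psi> differentiable at x" "\<psi> differentiable at x"
      by (rule smooth_on_differentiable[OF _ S'(3)]; intro smooth_intros smooth_on_pd \<psi>' F\<psi> F S'(1))+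
    show "pd k F differentiable at (\<psi> x)"
      using smooth_on_differentiable[OF smooth_on_pd[OF F]] \<psi>W x by auto
  qed
  have "pd 1 (H 1) x + pd 2 (H 2) x
      = s * jac \<psi> x * (pd 1 (pd 1 F) (\<psi> x) + pd 2 (pd 2 F) (\<psi> x))"
    unfolding H_def using d pd_commute[OF S'(1) \<psi>' S'(3), of 2 1]
    by (simp add: pd_mult pd_diff pd_component pd_compose differentiable_mult differentiable_diff jac_def algebra_simps)
  also have "\<dots> = 0" using har by simp
  finally show ?thesis unfolding metric_laplacian_def sum_2 terms sums by simp
qed

section \<open>Stereographic projection and Enneper's surface\<close>

locale frame =
  fixes e1 e2 V :: "real^3"
  assumes norms: "e1 \<bullet> e1 = 1" "e2 \<bullet> e2 = 1" "V \<bullet> V = 1"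
    and orth: "e1 \<bullet> e2 = 0" "e1 \<bullet> V = 0" "e2 \<bullet> V = 0"
begin

lemmas frame_simps = norms orth orth[unfolded inner_commute[of e1 e2]]
  orth(2)[unfolded inner_commute[of e1 V]] orth(3)[unfolded inner_commute[of e2 V]]

lemma frame_expand: "x = (x \<bullet> e1) *\<^sub>R e1 + (x \<bullet> e2) *\<^sub>R e2 + (x \<bullet> V) *\<^sub>R V"
proof -
  have V0: "V \<noteq> 0" using norms(3) by auto
  have "x - ((x \<bullet> e1) *\<^sub>R e1 + (x \<bullet> e2) *\<^sub>R e2 + (x \<bullet> V) *\<^sub>R V) = 0"
    by (rule orthogonal_to_basis_eq_0[of e1 e2 V])
      (use V0 in \<open>simp_all add: frame_simps inner_diff_left inner_add_left\<close>)
  then show ?thesis by simp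
qed

lemma frame_inner:
  "(a *\<^sub>R e1 + b *\<^sub>R e2 + c *\<^sub>R V) \<bullet> (a' *\<^sub>R e1 + b' *\<^sub>R e2 + c' *\<^sub>R V) = a * a' + b * b' + c * c'"
  by (simp add: frame_simps inner_add_left inner_add_right)

lemma pd_frame:
  fixes p q r :: "real^2 \<Rightarrow> real"
  assumes "p differentiable (at w)" "q differentiable (at w)" "r differentiable (at w)"
  shows "pd i (\<lambda>w. p w *\<^sub>R e1 + q w *\<^sub>R e2 + r w *\<^sub>R V) w
    = pd i p w *\<^sub>R e1 + pd i q w *\<^sub>R e2 + pd i r w *\<^sub>R V"
  using assms by (simp add: pd_add pd_scaleR differentiable_add differentiable_scaleR)

text \<open>Stereographic projection from \<open>- V\<close> onto the plane of \<open>e1\<close> and \<open>e2\<close>.\<close>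

definition stereo :: "real^3 \<Rightarrow> real^2" where
  "stereo n = ((n \<bullet> e1) / (1 + n \<bullet> V)) *\<^sub>R axis 1 1 + ((n \<bullet> e2) / (1 + n \<bullet> V)) *\<^sub>R axis 2 1"

definition inv_stereo :: "real^2 \<Rightarrow> real^3" where
  "inv_stereo w = (2 * w $ 1 / (1 + (w $ 1)\<^sup>2 + (w $ 2)\<^sup>2)) *\<^sub>R e1
     + (2 * w $ 2 / (1 + (w $ 1)\<^sup>2 + (w $ 2)\<^sup>2)) *\<^sub>R e2
     + ((1 - (w $ 1)\<^sup>2 - (w $ 2)\<^sup>2) / (1 + (w $ 1)\<^sup>2 + (w $ 2)\<^sup>2)) *\<^sub>R V"

text \<open>Enneper's surface with respect to the frame \<open>e1\<close>, \<open>e2\<close>, \<open>- V\<close>, and its partial derivatives. The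
  parametrization is the one whose normal is \<open>inv_stereo\<close>.\<close>

definition enn :: "real^2 \<Rightarrow> real^3" where
  "enn w = ((w $ 1 - w $ 1 ^ 3 / 3 + w $ 1 * (w $ 2)\<^sup>2) / 2) *\<^sub>R e1
     + ((- w $ 2 + w $ 2 ^ 3 / 3 - (w $ 1)\<^sup>2 * w $ 2) / 2) *\<^sub>R e2
     + (((w $ 2)\<^sup>2 - (w $ 1)\<^sup>2) / 2) *\<^sub>R V"

definition enn1 :: "real^2 \<Rightarrow> real^3" where
  "enn1 w = ((1 - (w $ 1)\<^sup>2 + (w $ 2)\<^sup>2) / 2) *\<^sub>R e1 + (- w $ 1 * w $ 2) *\<^sub>R e2 + (- w $ 1) *\<^sub>R V"

definition enn2 :: "real^2 \<Rightarrow> real^3" where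
  "enn2 w = (w $ 1 * w $ 2) *\<^sub>R e1 + ((- 1 + (w $ 2)\<^sup>2 - (w $ 1)\<^sup>2) / 2) *\<^sub>R e2 + (w $ 2) *\<^sub>R V"

text \<open>The conjugate minimal surface of \<open>enn\<close>; the combinations of both are the associated family of \<open>enn\<close>.\<close>

definition enn_conj :: "real^2 \<Rightarrow> real^3" where
  "enn_conj w = ((w $ 2 - (w $ 1)\<^sup>2 * w $ 2 + w $ 2 ^ 3 / 3) / 2) *\<^sub>R e1
     + ((w $ 1 + w $ 1 ^ 3 / 3 - w $ 1 * (w $ 2)\<^sup>2) / 2) *\<^sub>R e2 + (- w $ 1 * w $ 2) *\<^sub>R V"

text \<open>The conformal factor of \<open>enn\<close>.\<close>

definition \<kappa> :: "real^2 \<Rightarrow> real" where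
  "\<kappa> w = ((1 + (w $ 1)\<^sup>2 + (w $ 2)\<^sup>2) / 2)\<^sup>2"

lemma one_plus_squares_pos: "1 + (u::real)\<^sup>2 + v\<^sup>2 > 0"
  by (simp add: add_pos_nonneg)

lemma \<kappa>_pos: "\<kappa> w > 0"
  using one_plus_squares_pos[of "w $ 1" "w $ 2"] by (simp add: \<kappa>_def zero_less_power)

lemma coordinate_has_derivative [derivative_intros]:
  "((\<lambda>w. w $ k) has_derivative (\<lambda>h. h $ k)) (at (w::real^2))"
  by (rule bounded_linear_imp_has_derivative[OF bounded_linear_vec_nth])

lemma enn_smooth: "open S \<Longrightarrow> smooth_on S enn" "open S \<Longrightarrow> smooth_on S enn_conj"
   "open S \<Longrightarrow> smooth_on S enn1" "open S \<Longrightarrow> smooth_on S enn2"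
  unfolding enn_def enn_conj_def enn1_def enn2_def
  by (intro smooth_intros; simp)+

lemma inv_stereo_smooth: "open S \<Longrightarrow> smooth_on S inv_stereo"
  unfolding inv_stereo_def
  by (intro smooth_intros; use one_plus_squares_pos less_imp_neq in \<open>metis\<close>)

lemma coordinate_differentiable: "(\<lambda>w::real^2. w $ k) differentiable (at w)"
  using coordinate_has_derivative differentiable_def by blast

lemma pd_divide_const:
  fixes f :: "real^2 \<Rightarrow> real"
  assumes "f differentiable (at w)"
  shows "pd i (\<lambda>x. f x / c) w = pd i f w / c" "(\<lambda>x. f x / c) differentiable (at w)"
  using pd_mult[OF assms differentiable_const[of "inverse c"], of i] assms
  by (simp_all add: divide_inverse)

lemma frame_cong:
  "a = a' \<Longrightarrow> b = b' \<Longrightarrow> c = c' \<Longrightarrow>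
    a *\<^sub>R e1 + b *\<^sub>R e2 + c *\<^sub>R V = a' *\<^sub>R e1 + b' *\<^sub>R e2 + c' *\<^sub>R V"
  by simp

lemmas poly_diff = power2_eq_square power3_eq_cube pd_add pd_mult pd_diff pd_minus pd_divide_const
  coordinate_differentiable differentiable_add differentiable_diff differentiable_minus differentiable_mult

lemma minus_enn2: "- enn2 w = (- w $ 1 * w $ 2) *\<^sub>R e1 + ((1 - (w $ 2)\<^sup>2 + (w $ 1)\<^sup>2) / 2) *\<^sub>R e2
    + (- w $ 2) *\<^sub>R V"
proof -
  have "- (a *\<^sub>R e1 + b *\<^sub>R e2 + c *\<^sub>R V) = (- a) *\<^sub>R e1 + (- b) *\<^sub>R e2 + (- c) *\<^sub>R V" for a b c
    by simp
  then show ?thesis unfolding enn2_def by (simp only:) (rule frame_cong; simp add: field_simps)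
qed

lemma enn_pd: "pd 1 enn w = enn1 w" "pd 2 enn w = enn2 w"
  unfolding enn_def enn1_def enn2_def
  by (subst pd_frame; (rule frame_cong)?; simp add: poly_diff; simp add: field_simps)+

lemma enn_conj_pd: "pd 1 enn_conj w = - enn2 w" "pd 2 enn_conj w = enn1 w"
  unfolding minus_enn2 unfolding enn_conj_def enn1_def
  by (subst pd_frame; (rule frame_cong)?; simp add: poly_diff; simp add: field_simps)+

lemma enn12_pd:
  "pd 1 enn1 w = (- w $ 1) *\<^sub>R e1 + (- w $ 2) *\<^sub>R e2 + (-1) *\<^sub>R V"
  "pd 2 enn1 w = (w $ 2) *\<^sub>R e1 + (- w $ 1) *\<^sub>R e2 + 0 *\<^sub>R V"
  "pd 1 enn2 w = (w $ 2) *\<^sub>R e1 + (- w $ 1) *\<^sub>R e2 + 0 *\<^sub>R V"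
  "pd 2 enn2 w = (w $ 1) *\<^sub>R e1 + (w $ 2) *\<^sub>R e2 + 1 *\<^sub>R V"
  unfolding enn1_def enn2_def
  by (subst pd_frame; (rule frame_cong)?; simp add: poly_diff; simp add: field_simps)+

lemma enn_inner:
  "enn1 w \<bullet> enn1 w = \<kappa> w" "enn2 w \<bullet> enn2 w = \<kappa> w" "enn1 w \<bullet> enn2 w = 0" "enn2 w \<bullet> enn1 w = 0"
  unfolding enn1_def enn2_def \<kappa>_def frame_inner by (simp_all add: field_simps power2_eq_square)

lemma inv_stereo_inner:
  "inv_stereo w \<bullet> inv_stereo w = 1" "inv_stereo w \<bullet> enn1 w = 0" "inv_stereo w \<bullet> enn2 w = 0"
  "1 + inv_stereo w \<bullet> V = 1 / sqrt (\<kappa> w)"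
proof -
  define d where "d = 1 + (w $ 1)\<^sup>2 + (w $ 2)\<^sup>2"
  have d: "d > 0" unfolding d_def by (rule one_plus_squares_pos)
  show "inv_stereo w \<bullet> inv_stereo w = 1" "inv_stereo w \<bullet> enn1 w = 0" "inv_stereo w \<bullet> enn2 w = 0"
    unfolding inv_stereo_def enn1_def enn2_def frame_inner d_def[symmetric] using d
    by (simp_all add: divide_simps) (simp_all add: d_def algebra_simps power2_eq_square)
  show "1 + inv_stereo w \<bullet> V = 1 / sqrt (\<kappa> w)"
    unfolding inv_stereo_def \<kappa>_def d_def[symmetric] using d
    by (simp add: inner_add_left frame_simps divide_simps) (simp add: real_sqrt_divide, simp add: d_def)
qed

text \<open>The Gauss map of \<open>enn\<close> is conformal and reverses the orientation, whence the opposite signs.\<close>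

lemma inv_stereo_pd:
  "pd 1 inv_stereo w = (1 / \<kappa> w) *\<^sub>R enn1 w" "pd 2 inv_stereo w = (- 1 / \<kappa> w) *\<^sub>R enn2 w"
proof -
  define d where "d = 1 + (w $ 1)\<^sup>2 + (w $ 2)\<^sup>2"
  have d: "d > 0" unfolding d_def by (rule one_plus_squares_pos)
  define u v where "u = w $ 1" and "v = w $ 2"
  have 1: "((\<lambda>w. 2 * w $ 1 / (1 + (w $ 1)\<^sup>2 + (w $ 2)\<^sup>2)) has_derivative
      (\<lambda>h. h $ 1 * ((2 - 2 * u\<^sup>2 + 2 * v\<^sup>2) / d\<^sup>2) + h $ 2 * (- 4 * u * v / d\<^sup>2))) (at w)"
    using d unfolding d_def u_def v_def
    by (auto intro!: derivative_eq_intros simp: fun_eq_iff)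
      (simp add: divide_simps; simp add: algebra_simps power2_eq_square)
  have 2: "((\<lambda>w. 2 * w $ 2 / (1 + (w $ 1)\<^sup>2 + (w $ 2)\<^sup>2)) has_derivative
      (\<lambda>h. h $ 1 * (- 4 * u * v / d\<^sup>2) + h $ 2 * ((2 + 2 * u\<^sup>2 - 2 * v\<^sup>2) / d\<^sup>2))) (at w)"
    using d unfolding d_def u_def v_def
    by (auto intro!: derivative_eq_intros simp: fun_eq_iff)
      (simp add: divide_simps; simp add: algebra_simps power2_eq_square)
  have 3: "((\<lambda>w. (1 - (w $ 1)\<^sup>2 - (w $ 2)\<^sup>2) / (1 + (w $ 1)\<^sup>2 + (w $ 2)\<^sup>2)) has_derivative
      (\<lambda>h. h $ 1 * (- 4 * u / d\<^sup>2) + h $ 2 * (- 4 * v / d\<^sup>2))) (at w)"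
    using d unfolding d_def u_def v_def
    by (auto intro!: derivative_eq_intros simp: fun_eq_iff)
      (simp add: divide_simps; simp add: algebra_simps power2_eq_square)
  have k: "\<kappa> w = d\<^sup>2 / 4" by (simp add: \<kappa>_def d_def power_divide)
  show "pd 1 inv_stereo w = (1 / \<kappa> w) *\<^sub>R enn1 w" "pd 2 inv_stereo w = (- 1 / \<kappa> w) *\<^sub>R enn2 w"
    unfolding inv_stereo_def pd_frame[OF differentiableI[OF 1] differentiableI[OF 2] differentiableI[OF 3]]
      pd_eq[OF 1] pd_eq[OF 2] pd_eq[OF 3] k enn1_def enn2_def u_def[symmetric] v_def[symmetric]
    by (simp_all add: axis_def scaleR_add_right diff_divide_distrib add_divide_distrib algebra_simps)
qed

lemma stereo_inverse:
  assumes "norm n = 1" "n \<bullet> V > - 1"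
  shows "inv_stereo (stereo n) = n"
proof -
  define a b c where "a = n \<bullet> e1" and "b = n \<bullet> e2" and "c = n \<bullet> V"
  have n: "n = a *\<^sub>R e1 + b *\<^sub>R e2 + c *\<^sub>R V" unfolding a_def b_def c_def by (rule frame_expand)
  have abc: "a\<^sup>2 + b\<^sup>2 + c\<^sup>2 = 1"
    using assms(1) frame_inner[of a b c a b c] n by (simp add: dot_square_norm[symmetric] power2_eq_square norm_eq_1)
  have c: "1 + c > 0" using assms(2) by (simp add: c_def)
  have w: "stereo n $ 1 = a / (1 + c)" "stereo n $ 2 = b / (1 + c)"
    by (simp_all add: stereo_def a_def b_def c_def axis_def)
  have ab: "a\<^sup>2 + b\<^sup>2 = (1 + c) * (1 - c)" using abc by (simp add: algebra_simps power2_eq_square)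
  have s: "(a / (1 + c))\<^sup>2 + (b / (1 + c))\<^sup>2 = (1 - c) / (1 + c)"
    using c by (simp add: power_divide add_divide_distrib[symmetric] ab) (simp add: power2_eq_square)
  have e: "(1 - c) / (1 + c) = 2 / (1 + c) - 1" "2 * c / (1 + c) = 2 - 2 / (1 + c)"
    using c by (simp_all add: field_simps)
  have d: "1 + (stereo n $ 1)\<^sup>2 + (stereo n $ 2)\<^sup>2 = 2 / (1 + c)"
    unfolding w using s e by linarith
  have m: "1 - (stereo n $ 1)\<^sup>2 - (stereo n $ 2)\<^sup>2 = 2 * c / (1 + c)"
    unfolding w using s e by linarith
  show ?thesis unfolding inv_stereo_def d m unfolding w using c n by simp
qed

lemma stereo_smooth:
  assumes "open S" "smooth_on S M" "\<And>x. x \<in> S \<Longrightarrow> M x \<bullet> V > - 1"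
  shows "smooth_on S (\<lambda>x. stereo (M x))"
  unfolding stereo_def
  by (intro smooth_intros assms(1,2)) (use assms(3) in force)+

end

section \<open>Minimal patches in the Gauss coordinate\<close>

text \<open>Minimal patches whose parameter is the stereographic projection of their own normal.\<close>

locale minimal_gauss_patch = frame e1 e2 V + patch S Y M
  for e1 e2 V S Y M +
  assumes gauss: "\<And>w. w \<in> S \<Longrightarrow> M w = inv_stereo w"
    and minimal: "\<And>w. w \<in> S \<Longrightarrow> trace (matrix_inv (form1 Y w) ** form2 Y M w) = 0"
begin

text \<open>The coefficients of \<open>pd 1 Y\<close> in the orthogonal basis \<open>enn1\<close>, \<open>- enn2\<close>. They are also the entries of
  the second fundamental form up to sign.\<close>

definition P :: "real^2 \<Rightarrow> real" where "P w = (pd 1 Y w \<bullet> enn1 w) / \<kappa> w"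
definition Q :: "real^2 \<Rightarrow> real" where "Q w = - (pd 1 Y w \<bullet> enn2 w) / \<kappa> w"

lemma \<kappa>_smooth: "smooth_on S \<kappa>"
  unfolding \<kappa>_def by (intro smooth_intros open_S; simp)

lemma PQ_smooth: "smooth_on S P" "smooth_on S Q"
  unfolding P_def Q_def
  by (intro smooth_intros open_S smooth_Y1 enn_smooth \<kappa>_smooth; use \<kappa>_pos less_imp_neq in metis)+

lemma tangent_expand:
  assumes w: "w \<in> S"
  shows "pd i Y w = (pd i Y w \<bullet> enn1 w / \<kappa> w) *\<^sub>R enn1 w + (pd i Y w \<bullet> enn2 w / \<kappa> w) *\<^sub>R enn2 w"
proof -
  have k: "\<kappa> w \<noteq> 0" using \<kappa>_pos[of w] by simp
  have n: "pd i Y w \<bullet> inv_stereo w = 0"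
    using normal[OF w, of i] gauss[OF w] by (simp add: inner_commute)
  have nz: "inv_stereo w \<noteq> 0" using inv_stereo_inner(1)[of w] by auto
  have "pd i Y w - ((pd i Y w \<bullet> enn1 w / \<kappa> w) *\<^sub>R enn1 w + (pd i Y w \<bullet> enn2 w / \<kappa> w) *\<^sub>R enn2 w) = 0"
  proof (rule orthogonal_to_basis_eq_0[of "enn1 w" "enn2 w" "inv_stereo w"])
    show "enn1 w \<bullet> enn1 w * (enn2 w \<bullet> enn2 w) - (enn1 w \<bullet> enn2 w)\<^sup>2 \<noteq> 0"
      using k by (simp add: enn_inner)
  qed (use k nz n in \<open>simp_all add: inv_stereo_inner enn_inner inner_diff_left inner_add_left
     inner_diff_right inner_add_right inner_commute[of _ "inv_stereo w"]\<close>)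
  then show ?thesis by simp
qed

lemma pd_M:
  assumes w: "w \<in> S"
  shows "pd 1 M w = (1 / \<kappa> w) *\<^sub>R enn1 w" "pd 2 M w = (- 1 / \<kappa> w) *\<^sub>R enn2 w"
  using pd_cong[OF open_S w gauss] inv_stereo_pd by simp_all

text \<open>Symmetry of the second fundamental form and \<open>H = 0\<close> leave two of the four coefficients.\<close>

lemma pd_Y:
  assumes w: "w \<in> S"
  shows "pd 1 Y w = P w *\<^sub>R enn1 w - Q w *\<^sub>R enn2 w"
    and "pd 2 Y w = Q w *\<^sub>R enn1 w + P w *\<^sub>R enn2 w"
proof -
  have k: "\<kappa> w \<noteq> 0" "\<kappa> w > 0" using \<kappa>_pos[of w] by simp_all
  define p q r where "p = P w" and "q = Q w" and "r = pd 2 Y w \<bullet> enn2 w / \<kappa> w"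
  show Y1: "pd 1 Y w = P w *\<^sub>R enn1 w - Q w *\<^sub>R enn2 w"
    using tangent_expand[OF w, of 1] by (simp add: P_def Q_def)
  have "pd 2 Y w \<bullet> enn1 w / \<kappa> w = Q w"
    using form2_sym[OF w] k by (simp add: pd_M[OF w] Q_def inner_commute field_simps)
  then have Y2: "pd 2 Y w = Q w *\<^sub>R enn1 w + r *\<^sub>R enn2 w"
    using tangent_expand[OF w, of 2] by (simp add: r_def)
  have f2: "form2 Y M w $ 1 $ 1 = - p" "form2 Y M w $ 1 $ 2 = - q" "form2 Y M w $ 2 $ 1 = - q"
     "form2 Y M w $ 2 $ 2 = r"
    using k unfolding form2_nth pd_M[OF w] Y1 Y2 p_def q_def
    by (simp_all add: inner_add_right inner_diff_right enn_inner)
  have f1: "form1 Y w $ 1 $ 1 = \<kappa> w * (p\<^sup>2 + q\<^sup>2)" "form1 Y w $ 1 $ 2 = \<kappa> w * (p * q - q * r)"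
     "form1 Y w $ 2 $ 1 = \<kappa> w * (p * q - q * r)" "form1 Y w $ 2 $ 2 = \<kappa> w * (q\<^sup>2 + r\<^sup>2)"
    unfolding form1_nth Y1 Y2 p_def q_def
    by (simp_all add: inner_add_right inner_diff_right inner_add_left inner_diff_left enn_inner
      power2_eq_square algebra_simps)
  have det: "det (form1 Y w) = (\<kappa> w * (p * r + q\<^sup>2))\<^sup>2"
    unfolding det_2 f1 by (simp add: power2_eq_square algebra_simps)
  \<comment> \<open>The numerator of the mean curvature factors, and regularity excludes \<open>p * r + q\<^sup>2 = 0\<close>.\<close>
  have "0 = \<kappa> w * (p - r) * (p * r + q\<^sup>2)"
    using minimal[OF w] unfolding trace_form[OF regular[OF w]] f1 f2
    using regular[OF w] by (simp add: power2_eq_square algebra_simps)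
  then have "p = r" using regular[OF w] k unfolding det by auto
  then show "pd 2 Y w = Q w *\<^sub>R enn1 w + P w *\<^sub>R enn2 w" using Y2 by (simp add: p_def)
qed

lemma PQ_nonzero: "w \<in> S \<Longrightarrow> (P w)\<^sup>2 + (Q w)\<^sup>2 > 0"
  and form1_conformal: "w \<in> S \<Longrightarrow> form1 Y w $ i $ j = (if i = j then \<kappa> w * ((P w)\<^sup>2 + (Q w)\<^sup>2) else 0)"
  and det_form2: "w \<in> S \<Longrightarrow> det (form2 Y M w) = - ((P w)\<^sup>2 + (Q w)\<^sup>2)"
proof -
  assume w: "w \<in> S"
  have k: "\<kappa> w \<noteq> 0" using \<kappa>_pos[of w] by simp
  show f: "form1 Y w $ i $ j = (if i = j then \<kappa> w * ((P w)\<^sup>2 + (Q w)\<^sup>2) else 0)" for i j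
    using exhaust_2[of i] exhaust_2[of j] unfolding form1_nth
    by (elim disjE) (simp_all add: pd_Y[OF w] inner_add_right inner_diff_right inner_add_left
       inner_diff_left enn_inner power2_eq_square algebra_simps)
  have "(P w)\<^sup>2 + (Q w)\<^sup>2 \<noteq> 0" using regular[OF w] unfolding det_2 f by auto
  then show "(P w)\<^sup>2 + (Q w)\<^sup>2 > 0" using sum_power2_ge_zero[of "P w" "Q w"] by linarith
  show "det (form2 Y M w) = - ((P w)\<^sup>2 + (Q w)\<^sup>2)"
    using k unfolding det_2 form2_nth pd_M[OF w] pd_Y[OF w]
    by (simp add: inner_add_right inner_diff_right enn_inner power2_eq_square)
qed

text \<open>Equality of the mixed derivatives of \<open>Y\<close>, since \<open>enn\<close> is harmonic.\<close>

lemma cauchy_riemann: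
  assumes w: "w \<in> S"
  shows "pd 2 P w = pd 1 Q w" "pd 2 Q w = - pd 1 P w"
proof -
  note d = smooth_on_differentiable[OF PQ_smooth(1) w] smooth_on_differentiable[OF PQ_smooth(2) w]
    smooth_on_differentiable[OF enn_smooth(3)[OF open_S] w] smooth_on_differentiable[OF enn_smooth(4)[OF open_S] w]
  have k: "\<kappa> w \<noteq> 0" using \<kappa>_pos[of w] by simp
  have "pd 2 (pd 1 Y) w = pd 2 (\<lambda>w. P w *\<^sub>R enn1 w - Q w *\<^sub>R enn2 w) w"
    by (rule pd_cong[OF open_S w pd_Y(1)])
  also have "\<dots> = P w *\<^sub>R pd 2 enn1 w + pd 2 P w *\<^sub>R enn1 w - (Q w *\<^sub>R pd 2 enn2 w + pd 2 Q w *\<^sub>R enn2 w)"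
    using d by (simp add: pd_diff pd_scaleR differentiable_scaleR)
  finally have 1: "pd 2 (pd 1 Y) w = \<dots>" .
  have "pd 1 (pd 2 Y) w = pd 1 (\<lambda>w. Q w *\<^sub>R enn1 w + P w *\<^sub>R enn2 w) w"
    by (rule pd_cong[OF open_S w pd_Y(2)])
  also have "\<dots> = Q w *\<^sub>R pd 1 enn1 w + pd 1 Q w *\<^sub>R enn1 w + (P w *\<^sub>R pd 1 enn2 w + pd 1 P w *\<^sub>R enn2 w)"
    using d by (simp add: pd_add pd_scaleR differentiable_scaleR)
  finally have 2: "pd 1 (pd 2 Y) w = \<dots>" .
  have h: "pd 2 enn1 w = pd 1 enn2 w" "pd 2 enn2 w = - pd 1 enn1 w"
    unfolding enn12_pd by simp_all
  have "pd 2 (pd 1 Y) w - pd 1 (pd 2 Y) w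
      = (pd 2 P w - pd 1 Q w) *\<^sub>R enn1 w + (- pd 2 Q w - pd 1 P w) *\<^sub>R enn2 w"
    unfolding 1 2 h by (simp add: algebra_simps)
  then have "(pd 2 P w - pd 1 Q w) *\<^sub>R enn1 w + (- pd 2 Q w - pd 1 P w) *\<^sub>R enn2 w = 0" (is "?v = 0")
    using pd_commute[OF open_S smooth_Y w, of 2 1] by simp
  then have "?v \<bullet> enn1 w = 0" "?v \<bullet> enn2 w = 0" by simp_all
  then show "pd 2 P w = pd 1 Q w" "pd 2 Q w = - pd 1 P w"
    using k by (simp_all add: inner_add_left enn_inner)
qed

text \<open>Half the logarithm of the modulus of \<open>P - iQ\<close>.\<close>

definition logmod :: "real^2 \<Rightarrow> real" where "logmod w = ln ((P w)\<^sup>2 + (Q w)\<^sup>2) / 4"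

lemma logmod_smooth: "smooth_on S logmod"
  unfolding logmod_def
  by (intro smooth_intros open_S PQ_smooth PQ_nonzero; simp)

lemma PQ_differentiable: "w \<in> S \<Longrightarrow> P differentiable (at w)" "w \<in> S \<Longrightarrow> Q differentiable (at w)"
   "w \<in> S \<Longrightarrow> pd i P differentiable (at w)" "w \<in> S \<Longrightarrow> pd i Q differentiable (at w)"
  using smooth_on_differentiable smooth_on_pd PQ_smooth by metis+

lemma logmod_pd:
  assumes w: "w \<in> S"
  shows "pd i logmod w = (P w * pd i P w + Q w * pd i Q w) / (2 * ((P w)\<^sup>2 + (Q w)\<^sup>2))"
proof -
  note d = PQ_differentiable[OF w]
  have d2: "(\<lambda>w. (P w)\<^sup>2 + (Q w)\<^sup>2) differentiable (at w)"
    using d by (simp add: power2_eq_square differentiable_add differentiable_mult)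
  note l = pd_real_compose[OF d2 DERIV_ln[OF PQ_nonzero[OF w]]]
  have "pd i logmod w = pd i (\<lambda>w. ln ((P w)\<^sup>2 + (Q w)\<^sup>2)) w / 4"
    using pd_divide_const(1)[OF l(2)] by (simp add: logmod_def[abs_def])
  also have "\<dots> = inverse ((P w)\<^sup>2 + (Q w)\<^sup>2) * pd i (\<lambda>w. (P w)\<^sup>2 + (Q w)\<^sup>2) w / 4"
    unfolding l(1) ..
  also have "pd i (\<lambda>w. (P w)\<^sup>2 + (Q w)\<^sup>2) w = 2 * (P w * pd i P w + Q w * pd i Q w)"
    using d by (simp add: power2_eq_square pd_add pd_mult differentiable_mult algebra_simps)
  finally show ?thesis using PQ_nonzero[OF w] by (simp add: field_simps)
qed

text \<open>\<open>P - iQ\<close> is holomorphic: its parts are harmonic with orthogonal gradients of equal length, and the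
  second order terms of \<open>ln (P\<^sup>2 + Q\<^sup>2)\<close> cancel.\<close>

lemma logmod_harmonic:
  assumes w: "w \<in> S"
  shows "pd 1 (pd 1 logmod) w + pd 2 (pd 2 logmod) w = 0"
proof -
  note d = PQ_differentiable[OF w]
  define \<rho> where "\<rho> w = (P w)\<^sup>2 + (Q w)\<^sup>2" for w
  have \<rho>: "\<rho> w > 0" using PQ_nonzero[OF w] by (simp add: \<rho>_def)
  have d\<rho>: "\<rho> differentiable (at w)" unfolding \<rho>_def[abs_def]
    using d by (simp add: power2_eq_square differentiable_add differentiable_mult)
  have i\<rho>: "((\<lambda>x. inverse x) has_real_derivative - (inverse (\<rho> w) * inverse (\<rho> w))) (at (\<rho> w))"
    using DERIV_inverse[of "\<rho> w"] \<rho> by (simp add: power2_eq_square)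
  have pd\<rho>: "pd i \<rho> w = 2 * (P w * pd i P w + Q w * pd i Q w)" for i
    unfolding \<rho>_def[abs_def]
    using d by (simp add: power2_eq_square pd_add pd_mult differentiable_mult algebra_simps)
  have pd2: "pd i (pd i logmod) w = ((pd i P w)\<^sup>2 + (pd i Q w)\<^sup>2 + P w * pd i (pd i P) w + Q w * pd i (pd i Q) w)
      / (2 * \<rho> w) - (P w * pd i P w + Q w * pd i Q w)\<^sup>2 / (\<rho> w)\<^sup>2" for i
  proof -
    have "pd i (pd i logmod) w = pd i (\<lambda>w. (P w * pd i P w + Q w * pd i Q w) / 2 * inverse (\<rho> w)) w"
      by (rule pd_cong[OF open_S w]) (simp add: logmod_pd \<rho>_def divide_simps)
    also have "\<dots> = (P w * pd i P w + Q w * pd i Q w) / 2 *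
         (- (inverse (\<rho> w) * inverse (\<rho> w)) * (2 * (P w * pd i P w + Q w * pd i Q w)))
       + ((P w * pd i (pd i P) w + pd i P w * pd i P w + (Q w * pd i (pd i Q) w + pd i Q w * pd i Q w)) / 2)
         * inverse (\<rho> w)"
      using d pd_real_compose[OF d\<rho> i\<rho>]
      by (simp add: pd_mult pd_add pd_divide_const differentiable_add differentiable_mult pd\<rho>)
    finally show ?thesis using \<rho> by (simp add: field_simps power2_eq_square)
  qed
  have lapP: "pd 1 (pd 1 P) w + pd 2 (pd 2 P) w = 0"
  proof -
    have "pd 2 (pd 2 P) w = pd 2 (pd 1 Q) w" by (rule pd_cong[OF open_S w cauchy_riemann(1)])
    also have "\<dots> = pd 1 (pd 2 Q) w" using pd_commute[OF open_S PQ_smooth(2) w] .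
    also have "\<dots> = pd 1 (\<lambda>w. - pd 1 P w) w" by (rule pd_cong[OF open_S w cauchy_riemann(2)])
    also have "\<dots> = - pd 1 (pd 1 P) w" using d by (simp add: pd_minus)
    finally show ?thesis by simp
  qed
  have lapQ: "pd 1 (pd 1 Q) w + pd 2 (pd 2 Q) w = 0"
  proof -
    have "pd 2 (pd 2 Q) w = pd 2 (\<lambda>w. - pd 1 P w) w" by (rule pd_cong[OF open_S w cauchy_riemann(2)])
    also have "\<dots> = - pd 2 (pd 1 P) w" using d by (simp add: pd_minus)
    also have "pd 2 (pd 1 P) w = pd 1 (pd 2 P) w" using pd_commute[OF open_S PQ_smooth(1) w] .
    also have "pd 1 (pd 2 P) w = pd 1 (pd 1 Q) w" by (rule pd_cong[OF open_S w cauchy_riemann(1)])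
    finally show ?thesis by simp
  qed
  define p q a b where "p = P w" and "q = Q w" and "a = pd 1 P w" and "b = pd 1 Q w"
  have "pd 1 (pd 1 logmod) w + pd 2 (pd 2 logmod) w
     = (2 * (a\<^sup>2 + b\<^sup>2) + p * (pd 1 (pd 1 P) w + pd 2 (pd 2 P) w) + q * (pd 1 (pd 1 Q) w + pd 2 (pd 2 Q) w))
        / (2 * \<rho> w) - ((p * a + q * b)\<^sup>2 + (p * b - q * a)\<^sup>2) / (\<rho> w)\<^sup>2"
    unfolding pd2 cauchy_riemann[OF w] p_def q_def a_def b_def
    by (simp add: add_divide_distrib diff_divide_distrib algebra_simps)
  also have "(p * a + q * b)\<^sup>2 + (p * b - q * a)\<^sup>2 = (a\<^sup>2 + b\<^sup>2) * \<rho> w"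
    unfolding \<rho>_def p_def q_def by (simp add: power2_eq_square algebra_simps)
  finally show ?thesis unfolding lapP lapQ using \<rho> by (simp add: power2_eq_square field_simps)
qed

text \<open>By \<open>theorema_egregium\<close> the first factor is \<open>(- K) powr (-1/4)\<close>, so the left-hand side is the
  Chern-Ricci function. The factor \<open>\<kappa> powr (1/2)\<close> coming from the curvature cancels against \<open>1 + M \<bullet> V\<close>.\<close>

lemma curvature_angle_eq_logmod:
  assumes w: "w \<in> S"
  shows "ln ((- (det (form2 Y M w) / det (form1 Y w))) powr (-1/4) * (1 + M w \<bullet> V)) = logmod w"
proof -
  define r where "r = (P w)\<^sup>2 + (Q w)\<^sup>2"
  have r: "r > 0" using PQ_nonzero[OF w] by (simp add: r_def)
  note k = \<kappa>_pos[of w]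
  have d: "det (form1 Y w) = (\<kappa> w * r)\<^sup>2"
    unfolding det_2 form1_conformal[OF w] r_def by (simp add: power2_eq_square)
  have c: "- (det (form2 Y M w) / det (form1 Y w)) = inverse ((\<kappa> w)\<^sup>2 * r)"
    unfolding d det_form2[OF w] r_def[symmetric] using r k by (simp add: power2_eq_square divide_simps)
  have "ln ((inverse ((\<kappa> w)\<^sup>2 * r)) powr (-1/4) * (1 / sqrt (\<kappa> w))) = ln r / 4"
    using r k by (simp add: ln_mult ln_powr ln_div ln_inverse ln_realpow ln_sqrt field_simps)
  then show ?thesis unfolding c gauss[OF w] inv_stereo_inner logmod_def r_def .
qed

text \<open>A holomorphic function of constant modulus is constant, so the expressions of \<open>pd_Y\<close> can be
  integrated: \<open>enn_conj\<close> has the partial derivatives \<open>- enn2\<close> and \<open>enn1\<close>.\<close>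

lemma logmod_constant_imp_associate:
  assumes conn: "connected S" and const: "\<And>w. w \<in> S \<Longrightarrow> logmod w = c" and w0: "w0 \<in> S"
  shows "\<exists>b p q. p\<^sup>2 + q\<^sup>2 = exp (4 * c) \<and> (\<forall>w\<in>S. Y w = b + p *\<^sub>R enn w + q *\<^sub>R enn_conj w)"
proof -
  have pd0: "pd i P w = 0" "pd i Q w = 0" if w: "w \<in> S" for i w
  proof -
    have "pd i logmod w = 0" for i using pd_cong[OF open_S w const] by simp
    then have 0: "P w * pd i P w + Q w * pd i Q w = 0" for i
      using logmod_pd[OF w, of i] PQ_nonzero[OF w] by auto
    let ?a = "pd 1 P w" and ?b = "pd 1 Q w"
    have "((P w)\<^sup>2 + (Q w)\<^sup>2) * (?a\<^sup>2 + ?b\<^sup>2) = (P w * ?a + Q w * ?b)\<^sup>2 + (P w * ?b + Q w * (- ?a))\<^sup>2"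
      by (simp add: power2_eq_square algebra_simps)
    also have "\<dots> = 0" using 0[of 1] 0[of 2] unfolding cauchy_riemann[OF w] by simp
    finally have "?a = 0" "?b = 0" using PQ_nonzero[OF w] by auto
    then show "pd i P w = 0" "pd i Q w = 0" using exhaust_2[of i] cauchy_riemann[OF w] by auto
  qed
  have const_of_pd: "f w = f w0" if "w \<in> S" "\<And>w. w \<in> S \<Longrightarrow> f differentiable (at w)"
    "\<And>w i. w \<in> S \<Longrightarrow> pd i f w = 0" for f :: "real^2 \<Rightarrow> 'x::real_normed_vector" and w
  proof (rule has_derivative_zero_unique_connected[OF open_S conn _ \<open>w \<in> S\<close> w0])
    show "(f has_derivative (\<lambda>x. 0)) (at w)" if "w \<in> S" for w
      using has_derivative_pd[of f w] \<open>w \<in> S\<close> \<open>\<And>w. w \<in> S \<Longrightarrow> f differentiable (at w)\<close>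
        \<open>\<And>w i. w \<in> S \<Longrightarrow> pd i f w = 0\<close> by simp
  qed
  define p q where "p = P w0" and "q = Q w0"
  have pq: "P w = p" "Q w = q" if "w \<in> S" for w
    unfolding p_def q_def using that PQ_differentiable pd0 by (auto intro!: const_of_pd)
  let ?Z = "\<lambda>w. Y w - (p *\<^sub>R enn w + q *\<^sub>R enn_conj w)"
  have "?Z w = ?Z w0" if "w \<in> S" for w
  proof (rule const_of_pd[OF that])
    fix w i assume w: "w \<in> S"
    note d = smooth_on_differentiable[OF smooth_Y w] smooth_on_differentiable[OF enn_smooth(1)[OF open_S] w]
       smooth_on_differentiable[OF enn_smooth(2)[OF open_S] w]
    show "?Z differentiable (at w)" using d by (simp add: differentiable_diff differentiable_add differentiable_scaleR)
    have "pd i ?Z w = pd i Y w - (p *\<^sub>R pd i enn w + q *\<^sub>R pd i enn_conj w)"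
      using d by (simp add: pd_diff pd_add pd_scaleR differentiable_add differentiable_scaleR)
    then show "pd i ?Z w = 0" using exhaust_2[of i] pd_Y[OF w] pq[OF w]
      by (auto simp: enn_pd enn_conj_pd algebra_simps)
  qed
  then have "\<forall>w\<in>S. Y w = ?Z w0 + p *\<^sub>R enn w + q *\<^sub>R enn_conj w" by (auto simp: algebra_simps)
  moreover have "p\<^sup>2 + q\<^sup>2 = exp (4 * c)"
    using const[OF w0] exp_ln[OF PQ_nonzero[OF w0]] unfolding logmod_def p_def q_def
    by (metis mult.commute nonzero_divide_eq_eq zero_neq_numeral)
  ultimately show ?thesis by blast
qed

end

section \<open>Change of coordinates\<close>

lemma jac_compose:
  assumes "g differentiable (at x)" "f differentiable (at (g x))"
  shows "jac (\<lambda>x. f (g x)) x = jac f (g x) * jac g x"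
  unfolding jac_def pd_compose[OF assms] by (simp add: algebra_simps)

text \<open>The forms are bilinear in the derivatives, so the Jacobian matrix acts on them by congruence. The
  quotient of the determinants, which is the curvature, and the mean curvature do not change.\<close>

lemma form_compose:
  assumes "\<psi> differentiable (at x)" "Y differentiable (at (\<psi> x))" "M differentiable (at (\<psi> x))"
  shows det_form1_compose: "det (form1 (\<lambda>x. Y (\<psi> x)) x) = (jac \<psi> x)\<^sup>2 * det (form1 Y (\<psi> x))"
    and det_form2_compose: "det (form2 (\<lambda>x. Y (\<psi> x)) (\<lambda>x. M (\<psi> x)) x) = (jac \<psi> x)\<^sup>2 * det (form2 Y M (\<psi> x))"
  unfolding det_2 form1_nth form2_nth pd_compose[OF assms(1,2)] pd_compose[OF assms(1,3)] jac_def
  by (simp_all add: inner_add_left inner_add_right power2_eq_square algebra_simps inner_commute)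

lemma trace_form_compose:
  assumes d: "\<psi> differentiable (at x)" "Y differentiable (at (\<psi> x))" "M differentiable (at (\<psi> x))"
    and nz: "jac \<psi> x \<noteq> 0" "det (form1 Y (\<psi> x)) \<noteq> 0"
  shows "trace (matrix_inv (form1 (\<lambda>x. Y (\<psi> x)) x) ** form2 (\<lambda>x. Y (\<psi> x)) (\<lambda>x. M (\<psi> x)) x)
    = trace (matrix_inv (form1 Y (\<psi> x)) ** form2 Y M (\<psi> x))"
proof -
  have n: "det (form1 (\<lambda>x. Y (\<psi> x)) x) \<noteq> 0" using nz by (simp add: form_compose[OF d])
  let ?num = "\<lambda>Y M x. form1 Y x $ 2 $ 2 * form2 Y M x $ 1 $ 1 - form1 Y x $ 1 $ 2 * form2 Y M x $ 2 $ 1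
     - form1 Y x $ 1 $ 2 * form2 Y M x $ 1 $ 2 + form1 Y x $ 1 $ 1 * form2 Y M x $ 2 $ 2"
  have "?num (\<lambda>x. Y (\<psi> x)) (\<lambda>x. M (\<psi> x)) x = (jac \<psi> x)\<^sup>2 * ?num Y M (\<psi> x)"
    unfolding form1_nth form2_nth pd_compose[OF d(1,2)] pd_compose[OF d(1,3)] jac_def
    by (simp add: inner_add_left inner_add_right power2_eq_square algebra_simps inner_commute)
  then show ?thesis
    unfolding trace_form[OF n] trace_form[OF nz(2)] unfolding form_compose(1)[OF d] using nz by simp
qed

lemma form_cong:
  assumes "open S" "x \<in> S" "\<And>y. y \<in> S \<Longrightarrow> Y y = Y' y" "\<And>y. y \<in> S \<Longrightarrow> M y = M' y"
  shows "form1 Y x = form1 Y' x" "form2 Y M x = form2 Y' M' x"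
  using pd_cong[OF assms(1,2,3)] pd_cong[OF assms(1,2,4)]
  by (simp_all add: form1_def form2_def)

lemma jac_cong: "open S \<Longrightarrow> x \<in> S \<Longrightarrow> (\<And>y. y \<in> S \<Longrightarrow> f y = g y) \<Longrightarrow> jac f x = jac g x"
  unfolding jac_def using pd_cong[of S x f g] by simp

lemma jac_id: "jac (\<lambda>x. x) x = 1"
proof -
  have "pd i (\<lambda>x. x) x = axis i 1" for i using pd_eq[OF has_derivative_ident] .
  then show ?thesis by (simp add: jac_def axis_def)
qed

lemma Ck_on_local: "(\<And>x. x \<in> S \<Longrightarrow> \<exists>U. open U \<and> x \<in> U \<and> Ck_on k U f) \<Longrightarrow> Ck_on k S f"
proof (induction k arbitrary: f)
  case 0
  have "continuous (at x) f" if "x \<in> S" for x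
    using 0[OF that] by (auto simp: continuous_on_eq_continuous_at)
  then show ?case by (simp add: continuous_at_imp_continuous_on)
next
  case (Suc k)
  have "Ck_on k S (pd i f)" for i
    by (rule Suc.IH) (use Suc.prems in fastforce)
  moreover have "f differentiable (at x)" if "x \<in> S" for x using Suc.prems[OF that] by auto
  ultimately show ?case by simp
qed

lemma smooth_on_local: "(\<And>x. x \<in> S \<Longrightarrow> \<exists>U. open U \<and> x \<in> U \<and> smooth_on U f) \<Longrightarrow> smooth_on S f"
  unfolding smooth_on_def using Ck_on_local[of S _ f] by metis

section \<open>Charts of an immersed surface\<close>

lemma chart_inv_into: "x \<in> snd c ` fst c \<Longrightarrow> chart_inv c x \<in> fst c"
  and snd_chart_inv: "x \<in> snd c ` fst c \<Longrightarrow> snd c (chart_inv c x) = x"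
  unfolding chart_inv_def by (simp_all add: inv_into_into f_inv_into_f)

context
  fixes T :: "'a topology" and c :: "'a chart"
  assumes c: "is_chart T c"
begin

lemma chart_openin: "openin T (fst c)" and chart_open: "open (snd c ` fst c)"
  using c by (auto simp: is_chart_def)

lemma chart_homeomorphic: "homeomorphic_map (subtopology T (fst c)) (top_of_set (snd c ` fst c)) (snd c)"
  using c by (simp add: is_chart_def)

lemma chart_topspace: "topspace (subtopology T (fst c)) = fst c"
  using openin_subset[OF chart_openin] by auto

lemma chart_inj: "inj_on (snd c) (fst c)"
  using homeomorphic_imp_injective_map[OF chart_homeomorphic] chart_topspace by simp

lemma chart_inv_snd: "p \<in> fst c \<Longrightarrow> chart_inv c (snd c p) = p"
  unfolding chart_inv_def using chart_inj by simp

lemma chart_open_image: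
  assumes "openin T V" "V \<subseteq> fst c"
  shows "open (snd c ` V)"
proof -
  have "openin (subtopology T (fst c)) V" using assms openin_open_subtopology[OF chart_openin] by simp
  then have "openin (top_of_set (snd c ` fst c)) (snd c ` V)"
    using homeomorphic_imp_open_map[OF chart_homeomorphic] by (simp add: open_map_def)
  then show ?thesis using chart_open openin_open_trans by blast
qed

lemma chart_open_preimage:
  assumes "open W"
  shows "openin T {p \<in> fst c. snd c p \<in> W}"
proof -
  have "openin (top_of_set (snd c ` fst c)) (snd c ` fst c \<inter> W)" using assms by blast
  then have "openin (subtopology T (fst c)) {p \<in> topspace (subtopology T (fst c)). snd c p \<in> snd c ` fst c \<inter> W}"
    using openin_continuous_map_preimage[OF homeomorphic_imp_continuous_map[OF chart_homeomorphic]] by blast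
  moreover have "{p \<in> topspace (subtopology T (fst c)). snd c p \<in> snd c ` fst c \<inter> W} = {p \<in> fst c. snd c p \<in> W}"
    unfolding chart_topspace by auto
  ultimately show ?thesis using chart_openin openin_trans_full by metis
qed

end

lemma transition_chain:
  assumes c: "is_chart T c" and d: "is_chart T d" and x: "x \<in> snd c ` (fst c \<inter> fst d)"
  shows "(f \<circ> chart_inv c) x = (f \<circ> chart_inv d) ((snd d \<circ> chart_inv c) x)"
    and "(snd d \<circ> chart_inv c) x \<in> snd d ` (fst c \<inter> fst d)"
    and "(snd c \<circ> chart_inv d) ((snd d \<circ> chart_inv c) x) = x"
proof -
  obtain p where p: "p \<in> fst c" "p \<in> fst d" "x = snd c p" using x by auto
  then show "(f \<circ> chart_inv c) x = (f \<circ> chart_inv d) ((snd d \<circ> chart_inv c) x)"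
    "(snd d \<circ> chart_inv c) x \<in> snd d ` (fst c \<inter> fst d)"
    "(snd c \<circ> chart_inv d) ((snd d \<circ> chart_inv c) x) = x"
    using chart_inv_snd[OF c] chart_inv_snd[OF d] by auto
qed

text \<open>The two transition maps are inverse to each other, so their Jacobian determinants multiply to 1.\<close>

lemma transition_smooth:
  assumes "is_chart T c" "is_chart T d" "compatible_charts c d"
  shows "open (snd c ` (fst c \<inter> fst d))"
    and "smooth_on (snd c ` (fst c \<inter> fst d)) (snd d \<circ> chart_inv c)"
    and "x \<in> snd c ` (fst c \<inter> fst d) \<Longrightarrow> jac (snd d \<circ> chart_inv c) x \<noteq> 0"
proof -
  let ?S = "snd c ` (fst c \<inter> fst d)" and ?S' = "snd d ` (fst c \<inter> fst d)"
  have o: "openin T (fst c \<inter> fst d)" using chart_openin assms(1,2) by blast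
  show S: "open ?S" by (rule chart_open_image[OF assms(1) o]) simp
  show sm: "smooth_on ?S (snd d \<circ> chart_inv c)"
    using assms(3) by (simp add: compatible_charts_def smooth_transition_def)
  have sm': "smooth_on ?S' (snd c \<circ> chart_inv d)"
    using assms(3) by (simp add: compatible_charts_def smooth_transition_def Int_commute)
  assume x: "x \<in> ?S"
  note t = transition_chain[OF assms(1,2)]
  have "1 = jac (\<lambda>y. y) x" by (simp add: jac_id)
  also have "\<dots> = jac (\<lambda>y. (snd c \<circ> chart_inv d) ((snd d \<circ> chart_inv c) y)) x"
    by (rule jac_cong[OF S x]) (rule t(3)[symmetric])
  also have "\<dots> = jac (snd c \<circ> chart_inv d) ((snd d \<circ> chart_inv c) x) * jac (snd d \<circ> chart_inv c) x"
    by (rule jac_compose[OF smooth_on_differentiable[OF sm x] smooth_on_differentiable[OF sm' t(2)[OF x]]])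
  finally show "jac (snd d \<circ> chart_inv c) x \<noteq> 0" by auto
qed

lemma compatible_sym: "compatible_charts c d \<longleftrightarrow> compatible_charts d c"
  by (auto simp: compatible_charts_def)

locale immersed_surface =
  fixes T :: "'a topology" and A :: "'a chart set" and X N :: "'a \<Rightarrow> real^3"
  assumes surface: "smooth_surface T A" and imm: "immersion A X" and nor: "unit_normal A X N"
begin

text \<open>The charts of the maximal atlas.\<close>

definition admissible :: "'a chart \<Rightarrow> bool" where
  "admissible c \<longleftrightarrow> is_chart T c \<and> (\<forall>d\<in>A. compatible_charts d c)"

lemma atlas_admissible: "c \<in> A \<Longrightarrow> admissible c"
  using surface by (auto simp: admissible_def smooth_surface_def)

lemma admissible_is_chart: "admissible c \<Longrightarrow> is_chart T c" by (simp add: admissible_def)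

lemma chart_at:
  assumes "p \<in> topspace T"
  shows "chart_at A p \<in> A \<and> p \<in> fst (chart_at A p)"
proof -
  have "p \<in> (\<Union>c\<in>A. fst c)" using surface assms by (simp add: smooth_surface_def)
  then obtain c where "c \<in> A \<and> p \<in> fst c" by blast
  then show ?thesis unfolding chart_at_def by (rule someI[of "\<lambda>c. c \<in> A \<and> p \<in> fst c"])
qed

lemma fst_subset_topspace: "admissible c \<Longrightarrow> fst c \<subseteq> topspace T"
  using chart_openin[OF admissible_is_chart] openin_subset by blast

lemma smooth_map_admissible:
  assumes f: "smooth_map A f" and c: "admissible c"
  shows "smooth_on (snd c ` fst c) (f \<circ> chart_inv c)"
proof (rule smooth_on_local)
  fix x assume x: "x \<in> snd c ` fst c"
  define d where "d = chart_at A (chart_inv c x)"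
  have d: "d \<in> A" "chart_inv c x \<in> fst d"
    using chart_at chart_inv_into[OF x] fst_subset_topspace[OF c] by (auto simp: d_def)
  have dc: "is_chart T c" "is_chart T d" "compatible_charts c d"
    using c d atlas_admissible by (auto simp: admissible_def compatible_sym)
  let ?S = "snd c ` (fst c \<inter> fst d)"
  have xS: "x \<in> ?S" using d chart_inv_into[OF x] snd_chart_inv[OF x] by (metis IntI image_eqI)
  note tr = transition_smooth[OF dc]
  have "smooth_on ?S (\<lambda>x. (f \<circ> chart_inv d) ((snd d \<circ> chart_inv c) x))"
  proof (rule smooth_on_compose[OF tr(1) _ tr(2)])
    show "smooth_on (snd d ` fst d) (f \<circ> chart_inv d)" using f d(1) by (simp add: smooth_map_def)
    show "(snd d \<circ> chart_inv c) ` ?S \<subseteq> snd d ` fst d" using transition_chain(2)[OF dc(1,2)] by blast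
  qed
  from smooth_on_cong[OF tr(1) this transition_chain(1)[OF dc(1,2), symmetric]]
  show "\<exists>U. open U \<and> x \<in> U \<and> smooth_on U (f \<circ> chart_inv c)" using tr(1) xS by blast
qed

lemma smooth_X: "smooth_map A X" using imm by (simp add: immersion_def)
lemma smooth_N: "smooth_map A N" using nor by (simp add: unit_normal_def)

lemma atlas_det_form1:
  assumes c: "c \<in> A" and x: "x \<in> snd c ` fst c"
  shows "det (form1 (X \<circ> chart_inv c) x) \<noteq> 0"
proof
  let ?Y = "X \<circ> chart_inv c"
  let ?a = "pd 1 ?Y x" and ?b = "pd 2 ?Y x"
  assume "det (form1 ?Y x) = 0"
  then have g: "(?a \<bullet> ?a) * (?b \<bullet> ?b) = (?a \<bullet> ?b) * (?a \<bullet> ?b)" by (simp add: det_2 inner_commute)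
  have dY: "?Y differentiable (at x)"
    using smooth_on_differentiable[OF smooth_map_admissible[OF smooth_X atlas_admissible[OF c]] x] .
  have inj: "inj (frechet_derivative ?Y (at x))" using imm c x by (auto simp: immersion_def)
  have ker: "h = 0" if "h $ 1 *\<^sub>R ?a + h $ 2 *\<^sub>R ?b = 0" for h :: "real^2"
  proof -
    have "frechet_derivative ?Y (at x) h = frechet_derivative ?Y (at x) 0"
      using that by (simp add: frechet_derivative_pd[OF dY])
    then show ?thesis using inj by (simp add: inj_eq)
  qed
  \<comment> \<open>The image of \<open>?h\<close> is \<open>?b \<bullet> ?b\<close> times the component of \<open>?a\<close> orthogonal to \<open>?b\<close>, whose squared length
    contains the Gram determinant as a factor.\<close>
  let ?h = "(?b \<bullet> ?b) *\<^sub>R axis 1 1 - (?a \<bullet> ?b) *\<^sub>R axis 2 1 :: real^2"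
  have h: "?h $ 1 = ?b \<bullet> ?b" "?h $ 2 = - (?a \<bullet> ?b)" by (simp_all add: axis_def)
  let ?v = "(?b \<bullet> ?b) *\<^sub>R ?a + (- (?a \<bullet> ?b)) *\<^sub>R ?b"
  have "?v \<bullet> ?v = (?b \<bullet> ?b) * ((?a \<bullet> ?a) * (?b \<bullet> ?b) - (?a \<bullet> ?b) * (?a \<bullet> ?b))"
    by (simp add: inner_add_left inner_add_right inner_diff_left inner_diff_right inner_commute algebra_simps)
  then have "?v \<bullet> ?v = 0" using g by simp
  then have "?v = 0" by (rule iffD1[OF inner_eq_zero_iff])
  then have "?h = 0" using ker[of ?h] unfolding h by blast
  then have "?b \<bullet> ?b = 0" using h(1) by (metis zero_index)
  then have "?b = 0" by simp
  then have "(axis 2 1 :: real^2) = 0" using ker[of "axis 2 1"] by (simp add: axis_def)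
  then show False by (simp add: axis_eq_0_iff)
qed

lemma atlas_patch: "c \<in> A \<Longrightarrow> patch (snd c ` fst c) (X \<circ> chart_inv c) (N \<circ> chart_inv c)"
proof (unfold_locales)
  assume c: "c \<in> A"
  note a = atlas_admissible[OF c]
  show "open (snd c ` fst c)" using chart_open admissible_is_chart[OF a] by blast
  show "smooth_on (snd c ` fst c) (X \<circ> chart_inv c)" "smooth_on (snd c ` fst c) (N \<circ> chart_inv c)"
    using smooth_map_admissible smooth_X smooth_N a by blast+
  fix x assume x: "x \<in> snd c ` fst c"
  show "det (form1 (X \<circ> chart_inv c) x) \<noteq> 0" by (rule atlas_det_form1[OF c x])
  have "norm (N (chart_inv c x)) = 1 \<and> (\<forall>h. N (chart_inv c x) \<bullet>
     frechet_derivative (X \<circ> chart_inv c) (at (snd c (chart_inv c x))) h = 0)"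
    using nor c chart_inv_into[OF x] by (auto simp: unit_normal_def)
  then show "norm ((N \<circ> chart_inv c) x) = 1" "(N \<circ> chart_inv c) x \<bullet> pd i (X \<circ> chart_inv c) x = 0" for i
    by (simp_all add: pd_def snd_chart_inv[OF x])
qed

text \<open>Near a point, an admissible chart is a reparametrization of a chart \<open>d\<close> of the atlas; this transports
  regularity, the normal and the curvatures from \<open>d\<close>.\<close>

lemma admissible_transport:
  assumes c: "admissible c" and d: "d \<in> A" and p: "p \<in> fst c" "p \<in> fst d"
  shows "\<exists>\<psi> S. open S \<and> snd c p \<in> S \<and> S \<subseteq> snd c ` fst c \<and> smooth_on S \<psi> \<and> \<psi> ` S \<subseteq> snd d ` fst d \<and>
     (\<forall>x\<in>S. jac \<psi> x \<noteq> 0) \<and> \<psi> (snd c p) = snd d p \<and>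
     (\<forall>x\<in>S. (X \<circ> chart_inv c) x = (X \<circ> chart_inv d) (\<psi> x)) \<and>
     (\<forall>x\<in>S. (N \<circ> chart_inv c) x = (N \<circ> chart_inv d) (\<psi> x))"
proof -
  have dc: "is_chart T c" "is_chart T d" "compatible_charts c d"
    using c d atlas_admissible by (auto simp: admissible_def compatible_sym)
  let ?S = "snd c ` (fst c \<inter> fst d)" and ?\<psi> = "snd d \<circ> chart_inv c"
  note tr = transition_smooth[OF dc]
  have "?\<psi> (snd c p) = snd d p" using chart_inv_snd[OF dc(1) p(1)] by simp
  moreover have "?\<psi> ` ?S \<subseteq> snd d ` fst d" using transition_chain(2)[OF dc(1,2)] by blast
  moreover have "\<forall>x\<in>?S. (f \<circ> chart_inv c) x = (f \<circ> chart_inv d) (?\<psi> x)" for f :: "'a \<Rightarrow> real^3"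
    using transition_chain(1)[OF dc(1,2)] by blast
  ultimately show ?thesis
    using tr p by (intro exI[of _ ?\<psi>] exI[of _ ?S]) blast
qed

lemma admissible_forms:
  assumes c: "admissible c" and d: "d \<in> A" and p: "p \<in> fst c" "p \<in> fst d"
  shows "\<exists>j. j \<noteq> 0 \<and> det (form1 (X \<circ> chart_inv c) (snd c p)) = j\<^sup>2 * det (form1 (X \<circ> chart_inv d) (snd d p))
     \<and> det (form2 (X \<circ> chart_inv c) (N \<circ> chart_inv c) (snd c p))
         = j\<^sup>2 * det (form2 (X \<circ> chart_inv d) (N \<circ> chart_inv d) (snd d p))
     \<and> trace (matrix_inv (form1 (X \<circ> chart_inv c) (snd c p)) ** form2 (X \<circ> chart_inv c) (N \<circ> chart_inv c) (snd c p))
       = trace (matrix_inv (form1 (X \<circ> chart_inv d) (snd d p)) ** form2 (X \<circ> chart_inv d) (N \<circ> chart_inv d) (snd d p))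
     \<and> norm (N p) = 1 \<and> (\<forall>i. N p \<bullet> pd i (X \<circ> chart_inv c) (snd c p) = 0)"
proof -
  interpret D: patch "snd d ` fst d" "X \<circ> chart_inv d" "N \<circ> chart_inv d" by (rule atlas_patch[OF d])
  obtain \<psi> S where S: "open S" "snd c p \<in> S" and \<psi>: "smooth_on S \<psi>" "\<psi> ` S \<subseteq> snd d ` fst d"
      "jac \<psi> (snd c p) \<noteq> 0" "\<psi> (snd c p) = snd d p"
    and XN: "\<And>x. x \<in> S \<Longrightarrow> (X \<circ> chart_inv c) x = (X \<circ> chart_inv d) (\<psi> x)"
     "\<And>x. x \<in> S \<Longrightarrow> (N \<circ> chart_inv c) x = (N \<circ> chart_inv d) (\<psi> x)"
    using admissible_transport[OF assms] by metis
  have q: "snd d p \<in> snd d ` fst d" using p by simp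
  have dif: "\<psi> differentiable (at (snd c p))" "(X \<circ> chart_inv d) differentiable (at (\<psi> (snd c p)))"
    "(N \<circ> chart_inv d) differentiable (at (\<psi> (snd c p)))"
    using smooth_on_differentiable[OF \<psi>(1) S(2)] D.diffs q by (simp_all add: \<psi>(4))
  have reg: "det (form1 (X \<circ> chart_inv d) (\<psi> (snd c p))) \<noteq> 0" using D.regular[OF q] by (simp add: \<psi>(4))
  have fc: "form1 (X \<circ> chart_inv c) (snd c p) = form1 (\<lambda>x. (X \<circ> chart_inv d) (\<psi> x)) (snd c p)"
    "form2 (X \<circ> chart_inv c) (N \<circ> chart_inv c) (snd c p)
      = form2 (\<lambda>x. (X \<circ> chart_inv d) (\<psi> x)) (\<lambda>x. (N \<circ> chart_inv d) (\<psi> x)) (snd c p)"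
    by (rule form_cong[OF S XN]; assumption)+
  have "norm (N p) = 1" using D.unit[OF q] chart_inv_snd[OF admissible_is_chart[OF atlas_admissible[OF d]] p(2)] by simp
  moreover have "N p \<bullet> pd i (X \<circ> chart_inv c) (snd c p) = 0" for i
  proof -
    have "pd i (X \<circ> chart_inv c) (snd c p) = pd i (\<lambda>x. (X \<circ> chart_inv d) (\<psi> x)) (snd c p)"
      by (rule pd_cong[OF S XN(1)])
    also have "\<dots> = pd i \<psi> (snd c p) $ 1 *\<^sub>R pd 1 (X \<circ> chart_inv d) (snd d p)
        + pd i \<psi> (snd c p) $ 2 *\<^sub>R pd 2 (X \<circ> chart_inv d) (snd d p)"
      unfolding pd_compose[OF dif(1,2)] \<psi>(4) ..
    finally show ?thesis
      using D.normal[OF q] chart_inv_snd[OF admissible_is_chart[OF atlas_admissible[OF d]] p(2)]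
      by (simp add: inner_add_right)
  qed
  moreover note \<psi>(3)
  moreover have "det (form1 (X \<circ> chart_inv c) (snd c p)) = (jac \<psi> (snd c p))\<^sup>2 * det (form1 (X \<circ> chart_inv d) (snd d p))"
    unfolding fc form_compose[OF dif] \<psi>(4) ..
  moreover have "det (form2 (X \<circ> chart_inv c) (N \<circ> chart_inv c) (snd c p))
     = (jac \<psi> (snd c p))\<^sup>2 * det (form2 (X \<circ> chart_inv d) (N \<circ> chart_inv d) (snd d p))"
    unfolding fc form_compose[OF dif] \<psi>(4) ..
  moreover have "trace (matrix_inv (form1 (X \<circ> chart_inv c) (snd c p)) ** form2 (X \<circ> chart_inv c) (N \<circ> chart_inv c) (snd c p))
       = trace (matrix_inv (form1 (X \<circ> chart_inv d) (snd d p)) ** form2 (X \<circ> chart_inv d) (N \<circ> chart_inv d) (snd d p))"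
    unfolding fc trace_form_compose[OF dif \<psi>(3) reg] \<psi>(4) ..
  ultimately show ?thesis by (intro exI[of _ "jac \<psi> (snd c p)"] conjI allI)
qed

lemma admissible_patch:
  assumes c: "admissible c"
  shows "patch (snd c ` fst c) (X \<circ> chart_inv c) (N \<circ> chart_inv c)"
proof (unfold_locales)
  show "open (snd c ` fst c)" using chart_open admissible_is_chart[OF c] by blast
  show "smooth_on (snd c ` fst c) (X \<circ> chart_inv c)" "smooth_on (snd c ` fst c) (N \<circ> chart_inv c)"
    using smooth_map_admissible smooth_X smooth_N c by blast+
  fix x assume x: "x \<in> snd c ` fst c"
  then obtain p where p: "p \<in> fst c" "x = snd c p" by blast
  have pT: "p \<in> topspace T" using p fst_subset_topspace[OF c] by blast
  note d = chart_at[OF pT]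
  show "det (form1 (X \<circ> chart_inv c) x) \<noteq> 0" "norm ((N \<circ> chart_inv c) x) = 1"
    "(N \<circ> chart_inv c) x \<bullet> pd i (X \<circ> chart_inv c) x = 0" for i
    using admissible_forms[OF c _ p(1), of "chart_at A p"] d p(2)
      patch.regular[OF atlas_patch, of "chart_at A p" "snd (chart_at A p) p"]
      chart_inv_snd[OF admissible_is_chart[OF c] p(1)] by auto
qed

lemma induced_metric_eq: "induced_metric X c = form1 (X \<circ> chart_inv c)"
  by (simp add: fun_eq_iff induced_metric_def form1_def)

text \<open>\<open>gauss_curvature\<close> evaluates the intrinsic formula in a chart that may vary with the point; the
  quotient of determinants identifies its value with the one in any given chart.\<close>

lemma gauss_curvature_eq:
  assumes c: "admissible c" and p: "p \<in> fst c"
  shows "gauss_curvature A X p =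
    det (form2 (X \<circ> chart_inv c) (N \<circ> chart_inv c) (snd c p)) / det (form1 (X \<circ> chart_inv c) (snd c p))"
proof -
  define d where "d = chart_at A p"
  have d: "d \<in> A" "p \<in> fst d" using chart_at fst_subset_topspace[OF c] p by (auto simp: d_def)
  have "gauss_curvature A X p = metric_curvature (form1 (X \<circ> chart_inv d)) (snd d p)"
    by (simp add: gauss_curvature_def Let_def d_def induced_metric_eq)
  also have "\<dots> = det (form2 (X \<circ> chart_inv d) (N \<circ> chart_inv d) (snd d p)) / det (form1 (X \<circ> chart_inv d) (snd d p))"
    using patch.theorema_egregium[OF atlas_patch[OF d(1)]] d(2) by blast
  finally show ?thesis using admissible_forms[OF c d(1) p d(2)] by auto
qed

lemma mean_curvature_eq:
  assumes c: "admissible c" and p: "p \<in> fst c"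
  shows "mean_curvature A X N p = 1/2 * trace (matrix_inv (form1 (X \<circ> chart_inv c) (snd c p)) **
    form2 (X \<circ> chart_inv c) (N \<circ> chart_inv c) (snd c p))"
proof -
  define d where "d = chart_at A p"
  have d: "d \<in> A" "p \<in> fst d" using chart_at fst_subset_topspace[OF c] p by (auto simp: d_def)
  have f: "second_form X N d = form2 (X \<circ> chart_inv d) (N \<circ> chart_inv d)"
    by (simp add: fun_eq_iff second_form_def form2_def)
  show ?thesis using admissible_forms[OF c d(1) p d(2)]
    unfolding mean_curvature_def Let_def d_def[symmetric] induced_metric_eq f by auto
qed

end

section \<open>The Gauss map as a chart of the surface\<close>

text \<open>The frame is a parameter of its own, since the proof passes from one frame to a rotated one.\<close>

locale gauss_surface = immersed_surface T A X N + frame e1 e2 V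
  for T :: "'a topology" and A X N and e1 e2 V :: "real^3" +
  assumes min: "minimal T A X N"
    and neg: "\<And>p. p \<in> topspace T \<Longrightarrow> gauss_curvature A X p < 0"
    and angle: "\<And>p. p \<in> topspace T \<Longrightarrow> N p \<bullet> V > - 1"
begin

definition gmap :: "'a \<Rightarrow> real^2" where "gmap p = stereo (N p)"

lemma gmap_smooth:
  assumes c: "admissible c"
  shows "smooth_on (snd c ` fst c) (gmap \<circ> chart_inv c)"
proof -
  interpret patch "snd c ` fst c" "X \<circ> chart_inv c" "N \<circ> chart_inv c" by (rule admissible_patch[OF c])
  have "smooth_on (snd c ` fst c) (\<lambda>x. stereo ((N \<circ> chart_inv c) x))"
  proof (rule stereo_smooth[OF open_S smooth_M])
    show "(N \<circ> chart_inv c) x \<bullet> V > - 1" if "x \<in> snd c ` fst c" for x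
      using angle chart_inv_into[OF that] fst_subset_topspace[OF c] by auto
  qed
  then show ?thesis by (simp add: gmap_def o_def)
qed

lemma inv_stereo_gmap:
  assumes c: "admissible c" and p: "p \<in> fst c"
  shows "inv_stereo (gmap p) = N p"
proof -
  have pT: "p \<in> topspace T" using p fst_subset_topspace[OF c] by blast
  have "norm (N p) = 1" using admissible_forms[OF c _ p, of "chart_at A p"] chart_at[OF pT] by blast
  then show ?thesis unfolding gmap_def using angle[OF pT] by (rule stereo_inverse)
qed

text \<open>If \<open>N\<close> factors through a map with vanishing Jacobian, then \<open>det (form2)\<close> and hence the
  curvature vanish.\<close>

lemma gmap_jac:
  assumes c: "admissible c" and x: "x \<in> snd c ` fst c"
  shows "jac (gmap \<circ> chart_inv c) x \<noteq> 0"
proof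
  let ?\<psi> = "gmap \<circ> chart_inv c" and ?Y = "X \<circ> chart_inv c" and ?M = "N \<circ> chart_inv c"
  assume j: "jac ?\<psi> x = 0"
  interpret patch "snd c ` fst c" ?Y ?M by (rule admissible_patch[OF c])
  have "pd i ?M x = pd i (\<lambda>x. inv_stereo (?\<psi> x)) x" for i
    by (rule pd_cong[OF open_S x]) (use inv_stereo_gmap[OF c chart_inv_into] in auto)
  then have M: "pd i ?M x = pd i ?\<psi> x $ 1 *\<^sub>R pd 1 inv_stereo (?\<psi> x) + pd i ?\<psi> x $ 2 *\<^sub>R pd 2 inv_stereo (?\<psi> x)" for i
    using pd_compose[OF smooth_on_differentiable[OF gmap_smooth[OF c] x]
        smooth_on_differentiable[OF inv_stereo_smooth[OF open_UNIV]]] by simp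
  let ?n = "\<lambda>k. pd k inv_stereo (?\<psi> x)"
  have "det (form2 ?Y ?M x) = jac ?\<psi> x *
      ((?n 1 \<bullet> pd 1 ?Y x) * (?n 2 \<bullet> pd 2 ?Y x) - (?n 1 \<bullet> pd 2 ?Y x) * (?n 2 \<bullet> pd 1 ?Y x))"
    unfolding det_2 form2_nth M jac_def by (simp add: inner_add_left algebra_simps)
  then have "det (form2 ?Y ?M x) = 0" using j by simp
  then have "gauss_curvature A X (chart_inv c x) = 0"
    using gauss_curvature_eq[OF c chart_inv_into[OF x]] snd_chart_inv[OF x] by simp
  then show False using neg[of "chart_inv c x"] chart_inv_into[OF x] fst_subset_topspace[OF c] by auto
qed

text \<open>Shrink a chart \<open>c\<close> of the atlas to a domain on which \<open>gmap \<circ> chart_inv c\<close> has a smooth inverse. Then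
  \<open>gmap\<close> is the composition of \<open>c\<close> with this diffeomorphism.\<close>

lemma gauss_chart:
  assumes p: "p \<in> topspace T"
  shows "\<exists>U. p \<in> U \<and> admissible (U, gmap)"
proof -
  define c where "c = chart_at A p"
  have cA: "c \<in> A" and pc: "p \<in> fst c" using chart_at[OF p] by (auto simp: c_def)
  have ac: "admissible c" and c: "is_chart T c" using atlas_admissible[OF cA] by (auto simp: admissible_def)
  define S where "S = snd c ` fst c"
  define \<psi> where "\<psi> = gmap \<circ> chart_inv c"
  have S: "open S" unfolding S_def by (rule chart_open[OF c])
  have \<psi>: "smooth_on S \<psi>" unfolding S_def \<psi>_def by (rule gmap_smooth[OF ac])
  have xp: "snd c p \<in> S" using pc by (simp add: S_def)
  have jp: "jac \<psi> (snd c p) \<noteq> 0" using gmap_jac[OF ac] xp unfolding \<psi>_def S_def by blast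
  obtain W where W: "open W" "snd c p \<in> W" "W \<subseteq> S" "inj_on \<psi> W" "open (\<psi> ` W)"
    "homeomorphism W (\<psi> ` W) \<psi> (inv_into W \<psi>)" "smooth_on (\<psi> ` W) (inv_into W \<psi>)"
    using smooth_inverse_function[OF S \<psi> xp jp] by metis
  define U where "U = {q \<in> fst c. snd c q \<in> W}"
  have U: "openin T U" unfolding U_def by (rule chart_open_preimage[OF c W(1)])
  have Uc: "U \<subseteq> fst c" by (auto simp: U_def)
  have g_eq: "gmap q = \<psi> (snd c q)" if "q \<in> fst c" for q
    using that by (simp add: \<psi>_def chart_inv_snd[OF c])
  have sU: "snd c ` U = W" using W(3) by (auto simp: U_def S_def)
  have gimg: "gmap ` V = \<psi> ` (snd c ` V)" if "V \<subseteq> U" for V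
    using that Uc g_eq by (auto simp: image_image intro!: image_cong)
  have gU: "gmap ` U = \<psi> ` W" using gimg[of U] sU by simp
  have injg: "inj_on gmap U"
  proof (rule inj_onI)
    fix q r assume q: "q \<in> U" and r: "r \<in> U" and "gmap q = gmap r"
    moreover have "q \<in> fst c" "r \<in> fst c" using q r Uc by auto
    ultimately have "\<psi> (snd c q) = \<psi> (snd c r)" using g_eq[of q] g_eq[of r] by simp
    then have "snd c q = snd c r" using W(4) q r by (auto simp: U_def inj_on_def)
    then show "q = r" using chart_inj[OF c] q r Uc by (auto simp: inj_on_def)
  qed
  have inv: "chart_inv (U, gmap) w = chart_inv c (inv_into W \<psi> w)"
    if w: "w \<in> gmap ` U" for w
  proof -
    obtain q where q: "q \<in> U" "w = gmap q" using w by blast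
    have "chart_inv (U, gmap) w = q" unfolding chart_inv_def using q injg by simp
    moreover have "inv_into W \<psi> w = snd c q"
      using q W(4) g_eq Uc by (auto simp: U_def)
    moreover have "chart_inv c (snd c q) = q" using chart_inv_snd[OF c] q Uc by blast
    ultimately show ?thesis by simp
  qed
  have topU: "topspace (subtopology T U) = U" using openin_subset[OF U] by auto
  have open_img: "open (gmap ` V)" if V: "openin T V" "V \<subseteq> U" for V
  proof -
    have "open (snd c ` V)" using chart_open_image[OF c V(1)] V(2) Uc by blast
    then have "openin (top_of_set W) (snd c ` V)" using V(2) sU W(1) by (metis image_mono openin_open_eq)
    then have "openin (top_of_set (\<psi> ` W)) (\<psi> ` (snd c ` V))" using homeomorphism_imp_open_map[OF W(6)] by blast
    then show ?thesis using W(5) gimg[OF V(2)] openin_open_trans by metis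
  qed
  have chart: "is_chart T (U, gmap)"
    unfolding is_chart_def fst_conv snd_conv
  proof (intro conjI bijective_open_imp_homeomorphic_map)
    show "openin T U" by (rule U)
    show "open (gmap ` U)" unfolding gU by (rule W(5))
    show "continuous_map (subtopology T U) (top_of_set (gmap ` U)) gmap"
      unfolding continuous_map_in_subtopology
    proof
      show "continuous_map (subtopology T U) euclidean gmap"
        unfolding continuous_map topU
      proof (intro conjI allI impI)
        fix D :: "(real^2) set" assume "openin euclidean D"
        then have D: "open D" by simp
        have "open {x \<in> W. \<psi> x \<in> D}"
          using continuous_open_preimage[OF continuous_on_subset[OF smooth_on_continuous[OF \<psi>] W(3)] W(1) D]
          by (simp add: Int_def vimage_def)
        then have "openin T {q \<in> fst c. snd c q \<in> {x \<in> W. \<psi> x \<in> D}}" by (rule chart_open_preimage[OF c])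
        moreover have "{q \<in> fst c. snd c q \<in> {x \<in> W. \<psi> x \<in> D}} = {q \<in> U. gmap q \<in> D}"
          using g_eq by (auto simp: U_def)
        ultimately show "openin (subtopology T U) {q \<in> U. gmap q \<in> D}"
          using openin_open_subtopology[OF U] by auto
      qed auto
      show "gmap \<in> topspace (subtopology T U) \<rightarrow> gmap ` U" unfolding topU by blast
    qed
    show "open_map (subtopology T U) (top_of_set (gmap ` U)) gmap"
      unfolding open_map_def
    proof (intro allI impI)
      fix V assume "openin (subtopology T U) V"
      then have V: "openin T V" "V \<subseteq> U" using openin_open_subtopology[OF U] by auto
      show "openin (top_of_set (gmap ` U)) (gmap ` V)"
        using open_img[OF V] V(2) by (metis image_mono open_subset)
    qed
    show "gmap ` topspace (subtopology T U) = topspace (top_of_set (gmap ` U))" unfolding topU by simp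
    show "inj_on gmap (topspace (subtopology T U))" unfolding topU by (rule injg)
  qed
  have "compatible_charts d (U, gmap)" if d: "d \<in> A" for d
    unfolding compatible_charts_def smooth_transition_def fst_conv snd_conv
  proof
    note ad = atlas_admissible[OF d]
    show "smooth_on (snd d ` (fst d \<inter> U)) (gmap \<circ> chart_inv d)"
      by (rule smooth_on_subset[OF gmap_smooth[OF ad]]) blast
    have dc: "compatible_charts c d" using cA d surface by (auto simp: smooth_surface_def)
    note tr = transition_smooth[OF c admissible_is_chart[OF ad] dc]
    have op: "open (gmap ` (U \<inter> fst d))"
      by (rule open_img) (use U chart_openin[OF admissible_is_chart[OF ad]] in auto)
    have "smooth_on (gmap ` (U \<inter> fst d)) (\<lambda>w. (snd d \<circ> chart_inv c) (inv_into W \<psi> w))"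
    proof (rule smooth_on_compose[OF op tr(2)])
      show "smooth_on (gmap ` (U \<inter> fst d)) (inv_into W \<psi>)"
        by (rule smooth_on_subset[OF W(7)]) (use gU in blast)
      have "inv_into W \<psi> (gmap q) = snd c q" if "q \<in> U" for q
        using that W(4) g_eq Uc by (auto simp: U_def)
      then show "inv_into W \<psi> ` gmap ` (U \<inter> fst d) \<subseteq> snd c ` (fst c \<inter> fst d)" using Uc by force
    qed
    then show "smooth_on (gmap ` (U \<inter> fst d)) (snd d \<circ> chart_inv (U, gmap))"
      by (rule smooth_on_cong[OF op]) (use inv in auto)
  qed
  then have "admissible (U, gmap)" using chart by (simp add: admissible_def)
  moreover have "p \<in> U" using pc W(2) by (simp add: U_def)
  ultimately show ?thesis by blast
qed

lemma gauss_chart_patch: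
  assumes c: "admissible (U, gmap)"
  shows "minimal_gauss_patch e1 e2 V (gmap ` U) (X \<circ> chart_inv (U, gmap)) (N \<circ> chart_inv (U, gmap))"
proof -
  interpret patch "gmap ` U" "X \<circ> chart_inv (U, gmap)" "N \<circ> chart_inv (U, gmap)"
    using admissible_patch[OF c] by simp
  show ?thesis
  proof unfold_locales
    fix w assume w: "w \<in> gmap ` U"
    then have q: "chart_inv (U, gmap) w \<in> U" "gmap (chart_inv (U, gmap) w) = w"
      using chart_inv_into[of w "(U, gmap)"] snd_chart_inv[of w "(U, gmap)"] by auto
    show "(N \<circ> chart_inv (U, gmap)) w = inv_stereo w"
      using inv_stereo_gmap[OF c, of "chart_inv (U, gmap) w"] q by simp
    have "mean_curvature A X N (chart_inv (U, gmap) w) = 0"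
      using min q(1) fst_subset_topspace[OF c] by (auto simp: minimal_def)
    then show "trace (matrix_inv (form1 (X \<circ> chart_inv (U, gmap)) w) **
        form2 (X \<circ> chart_inv (U, gmap)) (N \<circ> chart_inv (U, gmap)) w) = 0"
      using mean_curvature_eq[OF c, of "chart_inv (U, gmap) w"] q by simp
  qed
qed

lemma chern_ricci1_gauss_chart:
  assumes c: "admissible (U, gmap)" and p: "p \<in> U"
  shows "chern_ricci1 A X N V p
    = minimal_gauss_patch.logmod e1 e2 V (X \<circ> chart_inv (U, gmap)) (gmap p)"
proof -
  interpret minimal_gauss_patch e1 e2 V "gmap ` U" "X \<circ> chart_inv (U, gmap)" "N \<circ> chart_inv (U, gmap)"
    by (rule gauss_chart_patch[OF c])
  have "chart_inv (U, gmap) (gmap p) = p" using chart_inv_snd[OF admissible_is_chart[OF c]] p by simp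
  then show ?thesis
    using curvature_angle_eq_logmod[of "gmap p"] gauss_curvature_eq[OF c] p
    by (simp add: chern_ricci1_def angle_function_def)
qed

text \<open>In a chart of the atlas, both the Chern-Ricci function and the metric are pulled back from the
  coordinate \<open>gmap\<close>, where the first is \<open>logmod\<close> and the second is conformal to the flat metric.\<close>

theorem chern_ricci1_harmonic: "harmonic T A X (chern_ricci1 A X N V)"
  unfolding harmonic_def
proof (intro conjI ballI)
  let ?f = "chern_ricci1 A X N V"
  have key: "\<exists>S. open S \<and> snd c p \<in> S \<and> smooth_on S (?f \<circ> chart_inv c) \<and>
      metric_laplacian (induced_metric X c) (?f \<circ> chart_inv c) (snd c p) = 0"
    if c: "c \<in> A" and p: "p \<in> fst c" for c p
  proof -
    have ac: "admissible c" by (rule atlas_admissible[OF c])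
    obtain U where U: "p \<in> U" "admissible (U, gmap)"
      using gauss_chart fst_subset_topspace[OF ac] p by blast
    interpret G: minimal_gauss_patch e1 e2 V "gmap ` U" "X \<circ> chart_inv (U, gmap)" "N \<circ> chart_inv (U, gmap)"
      by (rule gauss_chart_patch[OF U(2)])
    let ?S = "snd c ` (fst c \<inter> U)" and ?\<psi> = "gmap \<circ> chart_inv c"
    have cc: "is_chart T c" "is_chart T (U, gmap)" "compatible_charts c (U, gmap)"
      using ac U(2) c by (auto simp: admissible_def)
    note tr = transition_smooth[OF cc, unfolded fst_conv snd_conv]
    note ch = transition_chain[OF cc(1,2), unfolded fst_conv snd_conv]
    have into: "?\<psi> ` ?S \<subseteq> gmap ` U" using ch(2) by blast
    have x: "snd c p \<in> ?S" using p U(1) by blast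
    have f: "(?f \<circ> chart_inv c) y = G.logmod (?\<psi> y)" if y: "y \<in> ?S" for y
    proof -
      obtain q where "q \<in> fst c" "q \<in> U" "y = snd c q" using y by blast
      then show ?thesis using chern_ricci1_gauss_chart[OF U(2), of q] chart_inv_snd[OF cc(1)] by simp
    qed
    have "smooth_on ?S (\<lambda>y. G.logmod (?\<psi> y))"
      by (rule smooth_on_compose[OF tr(1) G.logmod_smooth tr(2) into])
    then have sm: "smooth_on ?S (?f \<circ> chart_inv c)"
      by (rule smooth_on_cong[OF tr(1)]) (simp only: f)
    have lap: "metric_laplacian (induced_metric X c) (?f \<circ> chart_inv c) (snd c p) = 0"
    proof (rule metric_laplacian_conformal_pullback[OF tr(1) x tr(2) into G.logmod_smooth tr(3) _ _ f])
      show "\<kappa> (?\<psi> y) * ((G.P (?\<psi> y))\<^sup>2 + (G.Q (?\<psi> y))\<^sup>2) > 0" if "y \<in> ?S" for y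
        using \<kappa>_pos G.PQ_nonzero[of "?\<psi> y"] into that by (intro mult_pos_pos) blast+
      fix y i j assume y: "y \<in> ?S"
      have \<psi>y: "?\<psi> y \<in> gmap ` U" using into y by blast
      have pdX: "pd k (X \<circ> chart_inv c) y = pd k ?\<psi> y $ 1 *\<^sub>R pd 1 (X \<circ> chart_inv (U, gmap)) (?\<psi> y)
          + pd k ?\<psi> y $ 2 *\<^sub>R pd 2 (X \<circ> chart_inv (U, gmap)) (?\<psi> y)" for k
      proof -
        have "pd k (X \<circ> chart_inv c) y = pd k (\<lambda>y. (X \<circ> chart_inv (U, gmap)) (?\<psi> y)) y"
          by (rule pd_cong[OF tr(1) y ch(1)])
        also have "\<dots> = pd k ?\<psi> y $ 1 *\<^sub>R pd 1 (X \<circ> chart_inv (U, gmap)) (?\<psi> y)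
          + pd k ?\<psi> y $ 2 *\<^sub>R pd 2 (X \<circ> chart_inv (U, gmap)) (?\<psi> y)"
          by (rule pd_compose[OF smooth_on_differentiable[OF tr(2) y] smooth_on_differentiable[OF G.smooth_Y \<psi>y]])
        finally show ?thesis .
      qed
      note cf = G.form1_conformal[OF \<psi>y, unfolded form1_nth]
      show "induced_metric X c y $ i $ j
          = \<kappa> (?\<psi> y) * ((G.P (?\<psi> y))\<^sup>2 + (G.Q (?\<psi> y))\<^sup>2) * (pd i ?\<psi> y \<bullet> pd j ?\<psi> y)"
        unfolding induced_metric_eq form1_nth pdX inner_add_left inner_add_right inner_scaleR_left inner_scaleR_right cf
        by (simp add: inner_vec_def sum_2 algebra_simps)
    next
      show "pd 1 (pd 1 G.logmod) (?\<psi> (snd c p)) + pd 2 (pd 2 G.logmod) (?\<psi> (snd c p)) = 0"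
        using G.logmod_harmonic[of "?\<psi> (snd c p)"] into x by blast
    qed
    show ?thesis using tr(1) x sm lap by blast
  qed
  show "smooth_map A ?f" unfolding smooth_map_def
  proof
    fix c assume c: "c \<in> A"
    show "smooth_on (snd c ` fst c) (?f \<circ> chart_inv c)"
      by (rule smooth_on_local) (use key[OF c] in blast)
  qed
  show "laplace_beltrami A X ?f p = 0" if "p \<in> topspace T" for p
    using key[of "chart_at A p" p] chart_at[OF that] by (auto simp: laplace_beltrami_def Let_def)
qed

end

section \<open>Surfaces with constant Chern-Ricci function\<close>

text \<open>If every point has exactly one label and labels persist in a neighborhood, the points carrying a
  given label form an open set, and so do those carrying another one.\<close>

lemma connected_space_common_label:
  assumes conn: "connected_space T"
    and ex: "\<And>p. p \<in> topspace T \<Longrightarrow> \<exists>t. R p t"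
    and nbhd: "\<And>p t. p \<in> topspace T \<Longrightarrow> R p t \<Longrightarrow> \<exists>U. openin T U \<and> p \<in> U \<and> (\<forall>q\<in>U. R q t)"
    and uniq: "\<And>p t t'. p \<in> topspace T \<Longrightarrow> R p t \<Longrightarrow> R p t' \<Longrightarrow> t = t'"
  shows "\<exists>t. \<forall>p\<in>topspace T. R p t"
proof (cases "topspace T = {}")
  case False
  then obtain p0 where p0: "p0 \<in> topspace T" by blast
  then obtain t where t: "R p0 t" using ex by blast
  let ?A = "{p \<in> topspace T. R p t}" and ?B = "{p \<in> topspace T. \<exists>t'. t' \<noteq> t \<and> R p t'}"
  have oA: "openin T ?A"
    unfolding openin_subopen[of T ?A]
  proof
    fix p assume "p \<in> ?A"
    then obtain U where "openin T U" "p \<in> U" "\<forall>q\<in>U. R q t" using nbhd by blast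
    then show "\<exists>U. openin T U \<and> p \<in> U \<and> U \<subseteq> ?A" using openin_subset by blast
  qed
  have oB: "openin T ?B"
    unfolding openin_subopen[of T ?B]
  proof
    fix p assume "p \<in> ?B"
    then obtain t' where t': "p \<in> topspace T" "t' \<noteq> t" "R p t'" by blast
    then obtain U where "openin T U" "p \<in> U" "\<forall>q\<in>U. R q t'" using nbhd by blast
    then show "\<exists>U. openin T U \<and> p \<in> U \<and> U \<subseteq> ?B" using t'(2) openin_subset by blast
  qed
  have cover: "topspace T \<subseteq> ?A \<union> ?B"
  proof
    fix p assume p: "p \<in> topspace T"
    then obtain t' where "R p t'" using ex by blast
    then show "p \<in> ?A \<union> ?B" using p by (cases "t' = t") auto
  qed
  have disj: "?A \<inter> ?B = {}"
  proof (rule equals0I)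
    fix p assume "p \<in> ?A \<inter> ?B"
    then obtain t' where "p \<in> topspace T" "R p t" "t' \<noteq> t" "R p t'" by blast
    then show False using uniq[of p t' t] by simp
  qed
  have "?A \<noteq> {}" using p0 t by auto
  have "?B = {}"
  proof (rule ccontr)
    assume "?B \<noteq> {}"
    with oA oB cover disj \<open>?A \<noteq> {}\<close>
    have "\<exists>E1 E2. openin T E1 \<and> openin T E2 \<and> topspace T \<subseteq> E1 \<union> E2 \<and> E1 \<inter> E2 = {} \<and> E1 \<noteq> {} \<and> E2 \<noteq> {}"
      by (intro exI[of _ ?A] exI[of _ ?B] conjI)
    from conn[unfolded connected_space_def] this show False by (rule notE)
  qed
  with cover have "topspace T \<subseteq> ?A" by simp
  then show ?thesis by (intro exI[of _ t]) auto
qed auto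

lemma minimal_gauss_patch_subset:
  assumes "minimal_gauss_patch e1 e2 V S Y M" "open B" "B \<subseteq> S"
  shows "minimal_gauss_patch e1 e2 V B Y M"
proof -
  interpret minimal_gauss_patch e1 e2 V S Y M by (rule assms(1))
  show ?thesis
  proof (intro minimal_gauss_patch.intro frame_axioms patch.intro minimal_gauss_patch_axioms.intro)
    show "open B" "smooth_on B Y" "smooth_on B M"
      using assms(2) smooth_on_subset[OF smooth_Y assms(3)] smooth_on_subset[OF smooth_M assms(3)] .
    fix x assume "x \<in> B"
    then have x: "x \<in> S" using assms(3) by blast
    show "det (form1 Y x) \<noteq> 0" "norm (M x) = 1" "M x \<bullet> pd i Y x = 0" "M x = inv_stereo x"
      "trace (matrix_inv (form1 Y x) ** form2 Y M x) = 0" for i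
      by (rule regular[OF x] unit[OF x] normal[OF x] gauss[OF x] minimal[OF x])+
  qed
qed

context gauss_surface
begin

text \<open>Near \<open>p\<close>, the surface is a translate of the member with parameters \<open>s\<close> and \<open>t\<close> of the (scaled)
  associated family of Enneper's surface.\<close>

definition associate_near :: "'a \<Rightarrow> (real^3) \<times> real \<times> real \<Rightarrow> bool" where
  "associate_near p l \<longleftrightarrow> (case l of (b, s, t) \<Rightarrow>
     \<exists>U. openin T U \<and> p \<in> U \<and> (\<forall>q\<in>U. X q = b + s *\<^sub>R enn (gmap q) + t *\<^sub>R enn_conj (gmap q)))"

lemma associate_near_exists:
  assumes const: "\<And>q. q \<in> topspace T \<Longrightarrow> chern_ricci1 A X N V q = c" and p: "p \<in> topspace T"
  shows "\<exists>b s t. s\<^sup>2 + t\<^sup>2 = exp (4 * c) \<and> associate_near p (b, s, t)"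
proof -
  obtain U where U: "p \<in> U" "admissible (U, gmap)" using gauss_chart[OF p] by blast
  note ch = admissible_is_chart[OF U(2)]
  note G = gauss_chart_patch[OF U(2)]
  have "open (gmap ` U)" using chart_open[OF ch] by simp
  then obtain e where e: "e > 0" "ball (gmap p) e \<subseteq> gmap ` U" using U(1) openE by blast
  \<comment> \<open>A ball in the coordinate domain is connected, as the integration requires.\<close>
  let ?B = "ball (gmap p) e"
  interpret minimal_gauss_patch e1 e2 V ?B "X \<circ> chart_inv (U, gmap)" "N \<circ> chart_inv (U, gmap)"
    by (rule minimal_gauss_patch_subset[OF G open_ball e(2)])
  have "logmod w = c" if "w \<in> ?B" for w
  proof -
    obtain q where "q \<in> U" "w = gmap q" using e(2) \<open>w \<in> ?B\<close> by blast
    then show ?thesis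
      using chern_ricci1_gauss_chart[OF U(2), of q] const[of q] fst_subset_topspace[OF U(2)] by auto
  qed
  then obtain b s t where st: "s\<^sup>2 + t\<^sup>2 = exp (4 * c)"
    and X: "\<And>w. w \<in> ?B \<Longrightarrow> (X \<circ> chart_inv (U, gmap)) w = b + s *\<^sub>R enn w + t *\<^sub>R enn_conj w"
    using logmod_constant_imp_associate[OF connected_ball, of c "gmap p"] e(1) by auto
  let ?U = "{q \<in> U. gmap q \<in> ?B}"
  have "openin T ?U" using chart_open_preimage[OF ch open_ball, of "gmap p" e] by simp
  moreover have "p \<in> ?U" using U(1) e(1) by simp
  moreover have "X q = b + s *\<^sub>R enn (gmap q) + t *\<^sub>R enn_conj (gmap q)" if "q \<in> ?U" for q
    using X[of "gmap q"] chart_inv_snd[OF ch, of q] that by simp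
  ultimately show ?thesis using st unfolding associate_near_def by blast
qed

text \<open>The parameters can be read off the derivative of \<open>X\<close> in the chart \<open>gmap\<close>.\<close>

lemma associate_near_unique:
  assumes p: "p \<in> topspace T" and l: "associate_near p l" "associate_near p l'"
  shows "l = l'"
proof -
  obtain b s t b' s' t' where ll: "l = (b, s, t)" "l' = (b', s', t')" by (metis prod_cases3)
  obtain U1 U2 where U12: "openin T U1" "p \<in> U1" "openin T U2" "p \<in> U2"
    and X1: "\<And>q. q \<in> U1 \<Longrightarrow> X q = b + s *\<^sub>R enn (gmap q) + t *\<^sub>R enn_conj (gmap q)"
    and X2: "\<And>q. q \<in> U2 \<Longrightarrow> X q = b' + s' *\<^sub>R enn (gmap q) + t' *\<^sub>R enn_conj (gmap q)"
    using l unfolding ll associate_near_def by auto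
  obtain U where U: "p \<in> U" "admissible (U, gmap)" using gauss_chart[OF p] by blast
  note ch = admissible_is_chart[OF U(2)]
  let ?W = "gmap ` (U1 \<inter> U2 \<inter> U)"
  have W: "open ?W"
    using chart_open_image[OF ch, of "U1 \<inter> U2 \<inter> U"] U12 chart_openin[OF ch] by auto
  have pW: "gmap p \<in> ?W" using U12 U(1) by blast
  define Z where "Z w = (b - b') + (s - s') *\<^sub>R enn w + (t - t') *\<^sub>R enn_conj w" for w
  have Z0: "Z w = 0" if "w \<in> ?W" for w
  proof -
    obtain q where q: "q \<in> U1" "q \<in> U2" "w = gmap q" using \<open>w \<in> ?W\<close> by blast
    then show ?thesis using X1[OF q(1)] X2[OF q(2)] by (simp add: Z_def algebra_simps)
  qed
  note d = smooth_on_differentiable[OF enn_smooth(1)[OF open_UNIV]] smooth_on_differentiable[OF enn_smooth(2)[OF open_UNIV]]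
  have "pd 1 Z (gmap p) = pd 1 (\<lambda>w. 0) (gmap p)" by (rule pd_cong[OF W pW Z0])
  moreover have "pd 1 Z (gmap p) = (s - s') *\<^sub>R enn1 (gmap p) - (t - t') *\<^sub>R enn2 (gmap p)"
    unfolding Z_def[abs_def] using d
    by (simp add: pd_add pd_scaleR differentiable_add differentiable_scaleR enn_pd enn_conj_pd)
  ultimately have v: "(s - s') *\<^sub>R enn1 (gmap p) - (t - t') *\<^sub>R enn2 (gmap p) = 0" (is "?v = 0") by simp
  then have "?v \<bullet> enn1 (gmap p) = 0" "?v \<bullet> enn2 (gmap p) = 0" by simp_all
  then have "s = s'" "t = t'"
    using \<kappa>_pos[of "gmap p"] by (simp_all add: inner_diff_left enn_inner)
  moreover from this have "b = b'" using Z0[OF pW] by (simp add: Z_def)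
  ultimately show ?thesis by (simp add: ll)
qed

lemma associate_global:
  assumes conn: "connected_space T" and ne: "topspace T \<noteq> {}"
    and const: "\<And>q. q \<in> topspace T \<Longrightarrow> chern_ricci1 A X N V q = c"
  shows "\<exists>b s t. s\<^sup>2 + t\<^sup>2 = exp (4 * c) \<and>
    (\<forall>q\<in>topspace T. X q = b + s *\<^sub>R enn (gmap q) + t *\<^sub>R enn_conj (gmap q))"
proof -
  have "\<exists>l. \<forall>p\<in>topspace T. associate_near p l"
  proof (rule connected_space_common_label[OF conn])
    show "\<exists>l. associate_near p l" if "p \<in> topspace T" for p
      using associate_near_exists[OF const that] by blast
    show "\<exists>U. openin T U \<and> p \<in> U \<and> (\<forall>q\<in>U. associate_near q l)" if "associate_near p l" for p l
      using that unfolding associate_near_def by (cases l) fastforce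
  qed (rule associate_near_unique)
  then obtain b s t where l: "\<And>p. p \<in> topspace T \<Longrightarrow> associate_near p (b, s, t)" by (metis prod_cases3)
  obtain p where p: "p \<in> topspace T" using ne by blast
  have "s\<^sup>2 + t\<^sup>2 = exp (4 * c)"
    using associate_near_exists[OF const p] associate_near_unique[OF p l[OF p]] by auto
  moreover have "X q = b + s *\<^sub>R enn (gmap q) + t *\<^sub>R enn_conj (gmap q)" if "q \<in> topspace T" for q
    using l[OF that] unfolding associate_near_def by auto
  ultimately show ?thesis by blast
qed

end

context frame
begin

lemma rotated_frame:
  assumes "c\<^sup>2 + d\<^sup>2 = 1"
  shows "frame (c *\<^sub>R e1 + d *\<^sub>R e2) (- d *\<^sub>R e1 + c *\<^sub>R e2) V"
  using assms by unfold_locales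
    (simp_all add: inner_add_left inner_add_right frame_simps power2_eq_square algebra_simps)

text \<open>In complex notation the horizontal part of \<open>enn\<close> is \<open>(cnj w - w\<^sup>3 / 3) / 2\<close>, so turning the frame by
  an angle \<open>\<alpha>\<close> multiplies \<open>cnj w\<close> by \<open>exp (2 \<i> \<alpha>)\<close> and \<open>w\<^sup>3\<close> by the conjugate factor.\<close>

lemma enn_rotated_frame:
  assumes cd: "c\<^sup>2 + d\<^sup>2 = 1" and s: "s = r * (c\<^sup>2 - d\<^sup>2)" and t: "t = 2 * r * c * d"
  shows "r *\<^sub>R frame.enn (c *\<^sub>R e1 + d *\<^sub>R e2) (- d *\<^sub>R e1 + c *\<^sub>R e2) V
        (frame.stereo (c *\<^sub>R e1 + d *\<^sub>R e2) (- d *\<^sub>R e1 + c *\<^sub>R e2) V n)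
     = s *\<^sub>R enn (stereo n) + t *\<^sub>R enn_conj (stereo n)"
proof -
  interpret R: frame "c *\<^sub>R e1 + d *\<^sub>R e2" "- d *\<^sub>R e1 + c *\<^sub>R e2" V by (rule rotated_frame[OF cd])
  define u v where "u = stereo n $ 1" and "v = stereo n $ 2"
  define u' v' where "u' = c * u + d * v" and "v' = - d * u + c * v"
  have w': "R.stereo n $ 1 = u'" "R.stereo n $ 2 = v'"
    unfolding u'_def v'_def u_def v_def R.stereo_def stereo_def
    by (simp_all add: axis_def inner_add_right inner_diff_right add_divide_distrib diff_divide_distrib)
  define a b k where "a = (u' - u' ^ 3 / 3 + u' * v'\<^sup>2) / 2" and "b = (- v' + v' ^ 3 / 3 - u'\<^sup>2 * v') / 2"
    and "k = (v'\<^sup>2 - u'\<^sup>2) / 2"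
  \<comment> \<open>The linear terms have degree 2 in \<open>c\<close> and \<open>d\<close>, the cubic ones degree 4; the difference is absorbed
    by the factor \<open>c\<^sup>2 + d\<^sup>2 = 1\<close>.\<close>
  have "c * a - d * b = (c\<^sup>2 - d\<^sup>2) * u / 2 + c * d * v
      + (c\<^sup>2 + d\<^sup>2) * ((c\<^sup>2 - d\<^sup>2) * (u * v\<^sup>2 - u ^ 3 / 3) / 2 + c * d * (- u\<^sup>2 * v + v ^ 3 / 3))"
    unfolding a_def b_def u'_def v'_def by (simp add: field_simps power2_eq_square power3_eq_cube)
  then have ab: "c * a - d * b = (c\<^sup>2 - d\<^sup>2) * u / 2 + c * d * v
      + ((c\<^sup>2 - d\<^sup>2) * (u * v\<^sup>2 - u ^ 3 / 3) / 2 + c * d * (- u\<^sup>2 * v + v ^ 3 / 3))"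
    unfolding cd by simp
  have 1: "r * (c * a - d * b) = s * ((u - u ^ 3 / 3 + u * v\<^sup>2) / 2) + t * ((v - u\<^sup>2 * v + v ^ 3 / 3) / 2)"
    unfolding ab s t by (simp add: field_simps)
  have "d * a + c * b = - (c\<^sup>2 - d\<^sup>2) * v / 2 + c * d * u
      + (c\<^sup>2 + d\<^sup>2) * ((c\<^sup>2 - d\<^sup>2) * (v ^ 3 / 3 - u\<^sup>2 * v) / 2 + c * d * (u ^ 3 / 3 - u * v\<^sup>2))"
    unfolding a_def b_def u'_def v'_def by (simp add: field_simps power2_eq_square power3_eq_cube)
  then have ba: "d * a + c * b = - (c\<^sup>2 - d\<^sup>2) * v / 2 + c * d * u
      + ((c\<^sup>2 - d\<^sup>2) * (v ^ 3 / 3 - u\<^sup>2 * v) / 2 + c * d * (u ^ 3 / 3 - u * v\<^sup>2))"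
    unfolding cd by simp
  have 2: "r * (d * a + c * b) = s * ((- v + v ^ 3 / 3 - u\<^sup>2 * v) / 2) + t * ((u + u ^ 3 / 3 - u * v\<^sup>2) / 2)"
    unfolding ba s t by (simp add: field_simps)
  have 3: "r * k = s * ((v\<^sup>2 - u\<^sup>2) / 2) + t * (- u * v)"
    unfolding k_def u'_def v'_def s t by (simp add: field_simps power2_eq_square)
  have "r *\<^sub>R R.enn (R.stereo n) = (r * (c * a - d * b)) *\<^sub>R e1 + (r * (d * a + c * b)) *\<^sub>R e2 + (r * k) *\<^sub>R V"
    unfolding R.enn_def w' a_def[symmetric] b_def[symmetric] k_def[symmetric]
    by (simp add: algebra_simps)
  also have "\<dots> = s *\<^sub>R enn (stereo n) + t *\<^sub>R enn_conj (stereo n)"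
    unfolding 1 2 3 enn_def enn_conj_def u_def[symmetric] v_def[symmetric]
    by (simp only: scaleR_add_left scaleR_add_right scaleR_scaleR) (simp only: ac_simps)
  finally show ?thesis .
qed

text \<open>Enneper's surface has \<open>- axis 3 1\<close> in the role of \<open>V\<close>.\<close>

lemma enneper_similarity:
  assumes "r > 0"
  shows "isometry_homothety_comp (\<lambda>x. b + r *\<^sub>R (x $ 1 *\<^sub>R e1 + x $ 2 *\<^sub>R e2 + (- x $ 3) *\<^sub>R V))" (is "isometry_homothety_comp ?S")
    and "b + r *\<^sub>R ((enneper w) $ 1 *\<^sub>R e1 + (enneper w) $ 2 *\<^sub>R e2 + (- enneper w $ 3) *\<^sub>R V) = b + r *\<^sub>R enn w"
proof -
  define L where "L x = (1 / r) *\<^sub>R b + (x $ 1 *\<^sub>R e1 + x $ 2 *\<^sub>R e2 + (- x $ 3) *\<^sub>R V)" for x :: "real^3"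
  have "dist (L x) (L y) = dist x y" for x y
  proof -
    have "L x - L y = (x - y) $ 1 *\<^sub>R e1 + (x - y) $ 2 *\<^sub>R e2 + (- (x - y) $ 3) *\<^sub>R V"
      by (simp add: L_def algebra_simps)
    then have "(L x - L y) \<bullet> (L x - L y) = (x - y) \<bullet> (x - y)"
      by (simp only: frame_inner) (simp add: inner_vec_def sum_3 algebra_simps)
    then show ?thesis by (simp add: dist_norm norm_eq)
  qed
  then have "isometry_homothety_comp L" by (intro isometry_homothety_comp.isometry) blast
  moreover have "isometry_homothety_comp (\<lambda>x. 0 + r *\<^sub>R (x - 0))"
    using assms by (intro isometry_homothety_comp.homothety) simp
  ultimately have "isometry_homothety_comp ((\<lambda>x. 0 + r *\<^sub>R (x - 0)) \<circ> L)"
    by (intro isometry_homothety_comp.comp)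
  moreover have "(\<lambda>x. 0 + r *\<^sub>R (x - 0)) \<circ> L = ?S"
    using assms by (auto simp: fun_eq_iff L_def scaleR_add_right)
  ultimately show "isometry_homothety_comp ?S" by simp
  show "b + r *\<^sub>R ((enneper w) $ 1 *\<^sub>R e1 + (enneper w) $ 2 *\<^sub>R e2 + (- enneper w $ 3) *\<^sub>R V) = b + r *\<^sub>R enn w"
  proof -
    have "enneper w $ 1 *\<^sub>R e1 + enneper w $ 2 *\<^sub>R e2 + (- enneper w $ 3) *\<^sub>R V = enn w"
      unfolding enn_def enneper_def Let_def vector_3 by (rule frame_cong) (simp_all add: field_simps)
    then show ?thesis by simp
  qed
qed

end

text \<open>The number \<open>c + id\<close> is a square root of \<open>(s + it) / r\<close>, found by halving the argument.\<close>

lemma half_angle: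
  fixes s t r :: real
  assumes "s\<^sup>2 + t\<^sup>2 = r\<^sup>2" "r > 0"
  shows "\<exists>c d. c\<^sup>2 + d\<^sup>2 = 1 \<and> s = r * (c\<^sup>2 - d\<^sup>2) \<and> t = 2 * r * c * d"
proof -
  have "(s / r)\<^sup>2 + (t / r)\<^sup>2 = 1" using assms by (simp add: power_divide add_divide_distrib[symmetric])
  then obtain \<theta> where \<theta>: "s / r = cos \<theta>" "t / r = sin \<theta>" using sincos_total_2pi by metis
  have "(cos (\<theta> / 2))\<^sup>2 + (sin (\<theta> / 2))\<^sup>2 = 1" by simp
  moreover have "s = r * ((cos (\<theta> / 2))\<^sup>2 - (sin (\<theta> / 2))\<^sup>2)"
    using \<theta>(1) cos_double[of "\<theta> / 2"] assms(2) by (simp add: divide_eq_eq mult.commute)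
  moreover have "t = 2 * r * cos (\<theta> / 2) * sin (\<theta> / 2)"
    using \<theta>(2) sin_double[of "\<theta> / 2"] assms(2) by (simp add: field_simps)
  ultimately show ?thesis by blast
qed

text \<open>In the frame rotated by half the argument of \<open>s + it\<close>, the surface is a similar copy of \<open>enn\<close>
  parametrized by the new \<open>gmap\<close>, which serves as the diffeomorphism onto a part of the plane.\<close>

theorem (in gauss_surface) chern_ricci1_constant_imp_enneper:
  assumes conn: "connected_space T" and const: "(chern_ricci1 A X N V) constant_on (topspace T)"
  shows "part_of_enneper T A X"
proof (cases "topspace T = {}")
  case True
  have "isometry_homothety_comp (\<lambda>x. x)" by (rule isometry_homothety_comp.isometry) simp
  then show ?thesis using True by (auto simp: part_of_enneper_def)
next
  case False
  obtain k where k: "\<And>q. q \<in> topspace T \<Longrightarrow> chern_ricci1 A X N V q = k"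
    using const by (auto simp: constant_on_def)
  obtain b s t where st: "s\<^sup>2 + t\<^sup>2 = exp (4 * k)"
    and X: "\<And>q. q \<in> topspace T \<Longrightarrow> X q = b + s *\<^sub>R enn (gmap q) + t *\<^sub>R enn_conj (gmap q)"
    using associate_global[OF conn False k] by blast
  define r where "r = exp (2 * k)"
  have r: "r > 0" "s\<^sup>2 + t\<^sup>2 = r\<^sup>2" by (simp_all add: r_def st exp_double[symmetric])
  obtain c d where cd: "c\<^sup>2 + d\<^sup>2 = 1" "s = r * (c\<^sup>2 - d\<^sup>2)" "t = 2 * r * c * d"
    using half_angle[OF r(2,1)] by blast
  define f1 f2 where "f1 = c *\<^sub>R e1 + d *\<^sub>R e2" and "f2 = - d *\<^sub>R e1 + c *\<^sub>R e2"
  interpret F: frame f1 f2 V unfolding f1_def f2_def by (rule rotated_frame[OF cd(1)])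
  interpret R: gauss_surface T A X N f1 f2 V by unfold_locales (use min neg angle in auto)
  let ?S = "\<lambda>x. b + r *\<^sub>R (x $ 1 *\<^sub>R f1 + x $ 2 *\<^sub>R f2 + (- x $ 3) *\<^sub>R V)"
  have XS: "X q = ?S (enneper (R.gmap q))" if "q \<in> topspace T" for q
  proof -
    have "r *\<^sub>R F.enn (R.gmap q) = s *\<^sub>R enn (gmap q) + t *\<^sub>R enn_conj (gmap q)"
      using enn_rotated_frame[OF cd, of "N q"] unfolding f1_def[symmetric] f2_def[symmetric]
      by (simp add: gmap_def R.gmap_def)
    then have "X q = b + r *\<^sub>R F.enn (R.gmap q)" using X[OF that] by (simp add: add.assoc)
    then show ?thesis unfolding F.enneper_similarity(2)[OF r(1)] .
  qed
  show ?thesis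
    unfolding part_of_enneper_def
  proof (intro exI[of _ ?S] conjI ballI)
    show "isometry_homothety_comp ?S" by (rule F.enneper_similarity(1)[OF r(1)])
    fix p assume "p \<in> topspace T"
    then obtain U where U: "p \<in> U" "admissible (U, R.gmap)" using R.gauss_chart by blast
    then have "U \<subseteq> topspace T" using fst_subset_topspace by fastforce
    then show "\<exists>U \<phi>. p \<in> U \<and> is_chart T (U, \<phi>) \<and> (\<forall>c\<in>A. compatible_charts c (U, \<phi>)) \<and>
        (\<forall>q\<in>U. X q = ?S (enneper (\<phi> q)))"
      using U XS unfolding admissible_def by blast
  qed
qed

lemma frame_exists:
  assumes V: "norm (V :: real^3) = 1"
  shows "\<exists>e1 e2. frame e1 e2 V"
proof -
  obtain y where y: "y \<noteq> 0" "orthogonal V y" using orthogonal_to_vector_exists[of V] by auto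
  define e1 where "e1 = (1 / norm y) *\<^sub>R y"
  have VV: "V \<bullet> V = 1" using V by (simp add: dot_square_norm)
  have e1: "e1 \<bullet> e1 = 1" "e1 \<bullet> V = 0"
    using y by (simp_all add: e1_def orthogonal_def inner_commute dot_square_norm power2_eq_square)
  have "frame e1 (cross3 V e1) V"
    using VV e1 by unfold_locales (simp_all add: dot_cross dot_cross_self inner_commute)
  then show ?thesis by blast
qed

theorem theorem1p2:
  fixes T :: "'a topology"
    and A :: "'a chart set"
    and X N :: "'a \<Rightarrow> real^3"
    and V :: "real^3"
  assumes "smooth_surface T A"
    and "connected_space T"
    and "oriented_atlas A"
    and "immersion A X"
    and "unit_normal A X N"
    and "minimal T A X N"
    and "\<forall>p \<in> topspace T. gauss_curvature A X p < 0"
    and "norm V = 1"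
    and "\<forall>p \<in> topspace T. angle_function N V p \<in> {-1<..1}"
  shows "harmonic T A X (chern_ricci1 A X N V) \<and>
    (\<forall>p \<in> topspace T. laplace_beltrami A X
       (\<lambda>q. ln ((1 + angle_function N V q) / (- gauss_curvature A X q) powr (1/4))) p = 0) \<and>
    ((chern_ricci1 A X N V) constant_on (topspace T) \<longrightarrow> part_of_enneper T A X)"
proof -
  obtain e1 e2 where e: "frame e1 e2 V" using frame_exists[OF assms(8)] by blast
  interpret gauss_surface T A X N e1 e2 V
    using e assms by (auto simp: gauss_surface_def immersed_surface_def gauss_surface_axioms_def angle_function_def)
  have eq: "(\<lambda>q. ln ((1 + angle_function N V q) / (- gauss_curvature A X q) powr (1/4))) = chern_ricci1 A X N V"
    unfolding chern_ricci1_def by (simp add: fun_eq_iff powr_minus_divide)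
  show ?thesis
    unfolding eq using chern_ricci1_harmonic chern_ricci1_constant_imp_enneper[OF assms(2)]
    by (auto simp: harmonic_def)
qed

end
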